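(* Assume that $(F_n,f_{m,n})_{n\in\mathbb{N}}$ is an inductive system of Fréchet spaces with injective transition morphisms and that $\varinjlim_{n\in\mathbb{N}}F_n$ is complete. Then the canonical morphism $$\varinjlim_{n\in\mathbb{N}}\mathrm{IB}(F_n)\to\mathrm{IB}(\varinjlim_{n\in\mathbb{N}}F_n)$$ is an isomorphism.
   Context: $\varinjlim_nF_n$ is the inductive limit in the category $\mathcal{T}c$ of complex locally convex topological vector spaces (not necessarily Hausdorff) and continuous linear maps; "complete" includes Hausdorff. The inductive limit $\varinjlim_n\mathrm{IB}(F_n)$ is taken in $\mathrm{Ind}(\mathcal{B}an)$. $\mathcal{B}an$ is the category of complex Banach spaces and continuous linear maps; $\mathrm{Ind}(\mathcal{B}an)$ is its category of ind-objects (formal filtered inductive limits $``\varinjlim"_iE_i$ with $\mathrm{Hom}(``\varinjlim"_iE_i,``\varinjlim"_jF_j)=\varprojlim_i\varinjlim_j\mathrm{Hom}(E_i,F_j)$). For $E$ in $\mathcal{T}c$, $\mathrm{IB}(E)=``\varinjlim"_B\widehat{E}_B$, where $B$ runs over the absolutely convex bounded subsets of $E$ (ordered by inclusion), $E_B$ is the linear hull of $B$ with the gauge semi-norm of $B$, and $\widehat{E}_B$ its completion; a continuous linear map $f:E\to F$ induces $\mathrm{IB}(f)$ via the maps $\widehat{E}_B\to\widehat{F}_{f(B)}$. The canonical morphism is the one induced by applying $\mathrm{IB}$ to the canonical maps $F_n\to\varinjlim_nF_n$. *)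

theory Defs
  imports "HOL-Analysis.Analysis" "HOL-Algebra.Module"
begin

section \<open>Complex vector spaces\<close>

definition complex_ring :: "complex ring" where
  "complex_ring = \<lparr>carrier = UNIV, mult = (*), one = 1, zero = 0, add = (+)\<rparr>"

text \<open>
  Complex vector spaces are the modules over \<^const>\<open>complex_ring\<close> of HOL-Algebra, so that all
  spaces have explicit carriers. The multiplicative fields \<^const>\<open>mult\<close> and \<^const>\<open>one\<close> of the
  record of a module play no role.
\<close>

abbreviation vec_space :: "(complex, 'a, 'm) module_scheme \<Rightarrow> bool" where
  "vec_space V \<equiv> Module.module complex_ring V"

definition linear_map ::
    "(complex, 'a, 'm) module_scheme \<Rightarrow> (complex, 'b, 'n) module_scheme \<Rightarrow> ('a \<Rightarrow> 'b) \<Rightarrow> bool" where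
  "linear_map V W h \<longleftrightarrow>
     h \<in> carrier V \<rightarrow> carrier W \<and>
     (\<forall>x\<in>carrier V. \<forall>y\<in>carrier V. h (x \<oplus>\<^bsub>V\<^esub> y) = h x \<oplus>\<^bsub>W\<^esub> h y) \<and>
     (\<forall>c. \<forall>x\<in>carrier V. h (c \<odot>\<^bsub>V\<^esub> x) = c \<odot>\<^bsub>W\<^esub> h x)"


section \<open>Locally convex spaces\<close>

record 'a tvs = "(complex, 'a) module" + topol :: "'a topology"

definition convex_in :: "'a tvs \<Rightarrow> 'a set \<Rightarrow> bool" where
  "convex_in E C \<longleftrightarrow> C \<subseteq> carrier E \<and>
     (\<forall>x\<in>C. \<forall>y\<in>C. \<forall>t\<in>{0..1}.
        complex_of_real (1 - t) \<odot>\<^bsub>E\<^esub> x \<oplus>\<^bsub>E\<^esub> complex_of_real t \<odot>\<^bsub>E\<^esub> y \<in> C)"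

text \<open>Topological vector spaces and locally convex spaces need not be Hausdorff.\<close>

definition top_vec_space :: "'a tvs \<Rightarrow> bool" where
  "top_vec_space E \<longleftrightarrow> vec_space E \<and> topspace (topol E) = carrier E \<and>
     continuous_map (prod_topology (topol E) (topol E)) (topol E) (\<lambda>(x, y). x \<oplus>\<^bsub>E\<^esub> y) \<and>
     continuous_map (prod_topology euclidean (topol E)) (topol E) (\<lambda>(c, x). c \<odot>\<^bsub>E\<^esub> x)"

definition loc_convex :: "'a tvs \<Rightarrow> bool" where
  "loc_convex E \<longleftrightarrow> top_vec_space E \<and>
     (\<forall>U. openin (topol E) U \<and> \<zero>\<^bsub>E\<^esub> \<in> U \<longrightarrow>
        (\<exists>C V. convex_in E C \<and> openin (topol E) V \<and> \<zero>\<^bsub>E\<^esub> \<in> V \<and> V \<subseteq> C \<and> C \<subseteq> U))"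

definition cont_linear :: "'a tvs \<Rightarrow> 'b tvs \<Rightarrow> ('a \<Rightarrow> 'b) \<Rightarrow> bool" where
  "cont_linear E F h \<longleftrightarrow> linear_map E F h \<and> continuous_map (topol E) (topol F) h"

definition cauchy_filter_in :: "'a tvs \<Rightarrow> 'a filter \<Rightarrow> bool" where
  "cauchy_filter_in E G \<longleftrightarrow> G \<noteq> bot \<and> eventually (\<lambda>x. x \<in> carrier E) G \<and>
     (\<forall>U. openin (topol E) U \<and> \<zero>\<^bsub>E\<^esub> \<in> U \<longrightarrow>
        (\<exists>A. A \<subseteq> carrier E \<and> eventually (\<lambda>x. x \<in> A) G \<and> (\<forall>x\<in>A. \<forall>y\<in>A. x \<ominus>\<^bsub>E\<^esub> y \<in> U)))"

definition complete_tvs :: "'a tvs \<Rightarrow> bool" where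
  "complete_tvs E \<longleftrightarrow> Hausdorff_space (topol E) \<and>
     (\<forall>G. cauchy_filter_in E G \<longrightarrow> (\<exists>l. limitin (topol E) (\<lambda>x. x) l G))"

definition frechet_space :: "'a tvs \<Rightarrow> bool" where
  "frechet_space E \<longleftrightarrow> loc_convex E \<and> metrizable_space (topol E) \<and> complete_tvs E"

definition bounded_in :: "'a tvs \<Rightarrow> 'a set \<Rightarrow> bool" where
  "bounded_in E B \<longleftrightarrow> B \<subseteq> carrier E \<and>
     (\<forall>U. openin (topol E) U \<and> \<zero>\<^bsub>E\<^esub> \<in> U \<longrightarrow>
        (\<exists>s>0. \<forall>c. s \<le> cmod c \<longrightarrow> B \<subseteq> (\<lambda>x. c \<odot>\<^bsub>E\<^esub> x) ` U))"

text \<open>Absolutely convex sets are taken to be nonempty.\<close>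

definition abs_convex_in :: "'a tvs \<Rightarrow> 'a set \<Rightarrow> bool" where
  "abs_convex_in E B \<longleftrightarrow> B \<subseteq> carrier E \<and> B \<noteq> {} \<and>
     (\<forall>x\<in>B. \<forall>y\<in>B. \<forall>a b. cmod a + cmod b \<le> 1 \<longrightarrow> a \<odot>\<^bsub>E\<^esub> x \<oplus>\<^bsub>E\<^esub> b \<odot>\<^bsub>E\<^esub> y \<in> B)"


section \<open>Inductive limits of sequences of locally convex spaces\<close>

text \<open>\<open>f m n\<close> is the transition morphism from \<open>F n\<close> to \<open>F m\<close>, for \<open>n \<le> m\<close>.\<close>

definition inductive_system :: "(nat \<Rightarrow> 'a tvs) \<Rightarrow> (nat \<Rightarrow> nat \<Rightarrow> 'a \<Rightarrow> 'a) \<Rightarrow> bool" where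
  "inductive_system F f \<longleftrightarrow>
     (\<forall>n. loc_convex (F n)) \<and>
     (\<forall>m n. n \<le> m \<longrightarrow> cont_linear (F n) (F m) (f m n)) \<and>
     (\<forall>n. \<forall>x\<in>carrier (F n). f n n x = x) \<and>
     (\<forall>k m n. n \<le> m \<and> m \<le> k \<longrightarrow> (\<forall>x\<in>carrier (F n). f k m (f m n x) = f k n x))"

text \<open>The underlying vector space of the inductive limit consists of the classes of pairs \<open>(n, x)\<close>
  with \<open>x\<close> in \<open>F n\<close>, two pairs being identified if they have the same image in some \<open>F k\<close>.\<close>

definition lim_class ::
    "(nat \<Rightarrow> 'a tvs) \<Rightarrow> (nat \<Rightarrow> nat \<Rightarrow> 'a \<Rightarrow> 'a) \<Rightarrow> nat \<Rightarrow> 'a \<Rightarrow> (nat \<times> 'a) set" where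
  "lim_class F f n x =
     {(m, y). y \<in> carrier (F m) \<and> (\<exists>k. n \<le> k \<and> m \<le> k \<and> f k n x = f k m y)}"

definition lim_rep :: "(nat \<times> 'a) set \<Rightarrow> nat \<times> 'a" where
  "lim_rep A = (SOME p. p \<in> A)"

definition lim_vec_space ::
    "(nat \<Rightarrow> 'a tvs) \<Rightarrow> (nat \<Rightarrow> nat \<Rightarrow> 'a \<Rightarrow> 'a) \<Rightarrow> (complex, (nat \<times> 'a) set) module" where
  "lim_vec_space F f =
     \<lparr>carrier = (\<Union>n. lim_class F f n ` carrier (F n)),
      mult = undefined, one = undefined,
      zero = lim_class F f 0 \<zero>\<^bsub>F 0\<^esub>,
      add = (\<lambda>A B. case (lim_rep A, lim_rep B) of ((n, x), (m, y)) \<Rightarrow>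
               lim_class F f (max n m)
                 (f (max n m) n x \<oplus>\<^bsub>F (max n m)\<^esub> f (max n m) m y)),
      smult = (\<lambda>c A. case lim_rep A of (n, x) \<Rightarrow> lim_class F f n (c \<odot>\<^bsub>F n\<^esub> x))\<rparr>"

definition with_topol :: "(complex, 'a) module \<Rightarrow> 'a topology \<Rightarrow> 'a tvs" where
  "with_topol V T = module.extend V \<lparr>topol = T\<rparr>"

text \<open>The topology of the inductive limit is the finest locally convex topology making all canonical
  maps continuous, i.e. the supremum of all locally convex topologies with this property.\<close>

definition ind_lim :: "(nat \<Rightarrow> 'a tvs) \<Rightarrow> (nat \<Rightarrow> nat \<Rightarrow> 'a \<Rightarrow> 'a) \<Rightarrow> (nat \<times> 'a) set tvs" where
  "ind_lim F f = with_topol (lim_vec_space F f)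
     (topology_generated_by
        (\<Union>{{U. openin T U} | T.
            loc_convex (with_topol (lim_vec_space F f) T) \<and>
            (\<forall>n. continuous_map (topol (F n)) T (lim_class F f n))}))"


section \<open>Seminormed spaces, Banach spaces and completions\<close>

record 'a seminormed = "(complex, 'a) module" + snorm :: "'a \<Rightarrow> real"

definition seminormed_space :: "'a seminormed \<Rightarrow> bool" where
  "seminormed_space X \<longleftrightarrow> vec_space X \<and>
     (\<forall>x\<in>carrier X. 0 \<le> snorm X x) \<and>
     (\<forall>x\<in>carrier X. \<forall>y\<in>carrier X. snorm X (x \<oplus>\<^bsub>X\<^esub> y) \<le> snorm X x + snorm X y) \<and>
     (\<forall>c. \<forall>x\<in>carrier X. snorm X (c \<odot>\<^bsub>X\<^esub> x) = cmod c * snorm X x)"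

definition cauchy_seq :: "'a seminormed \<Rightarrow> (nat \<Rightarrow> 'a) \<Rightarrow> bool" where
  "cauchy_seq X s \<longleftrightarrow> (\<forall>k. s k \<in> carrier X) \<and>
     (\<forall>e>0. \<exists>N. \<forall>k\<ge>N. \<forall>l\<ge>N. snorm X (s k \<ominus>\<^bsub>X\<^esub> s l) < e)"

definition banach_space :: "'a seminormed \<Rightarrow> bool" where
  "banach_space X \<longleftrightarrow> seminormed_space X \<and>
     (\<forall>x\<in>carrier X. snorm X x = 0 \<longrightarrow> x = \<zero>\<^bsub>X\<^esub>) \<and>
     (\<forall>s. cauchy_seq X s \<longrightarrow> (\<exists>l\<in>carrier X. (\<lambda>k. snorm X (s k \<ominus>\<^bsub>X\<^esub> l)) \<longlonglongrightarrow> 0))"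

text \<open>The completion of a seminormed space (a Banach space, the kernel of the seminorm being
  collapsed) is the space of classes of Cauchy sequences modulo null sequences.\<close>

definition compl_class :: "'a seminormed \<Rightarrow> (nat \<Rightarrow> 'a) \<Rightarrow> (nat \<Rightarrow> 'a) set" where
  "compl_class X s = {t. cauchy_seq X t \<and> (\<lambda>k. snorm X (s k \<ominus>\<^bsub>X\<^esub> t k)) \<longlonglongrightarrow> 0}"

definition compl_rep :: "(nat \<Rightarrow> 'a) set \<Rightarrow> nat \<Rightarrow> 'a" where
  "compl_rep A = (SOME s. s \<in> A)"

definition completion :: "'a seminormed \<Rightarrow> (nat \<Rightarrow> 'a) set seminormed" where
  "completion X =
     \<lparr>carrier = compl_class X ` {s. cauchy_seq X s},
      mult = undefined, one = undefined,
      zero = compl_class X (\<lambda>k. \<zero>\<^bsub>X\<^esub>),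
      add = (\<lambda>A B. compl_class X (\<lambda>k. compl_rep A k \<oplus>\<^bsub>X\<^esub> compl_rep B k)),
      smult = (\<lambda>c A. compl_class X (\<lambda>k. c \<odot>\<^bsub>X\<^esub> compl_rep A k)),
      snorm = (\<lambda>A. lim (\<lambda>k. snorm X (compl_rep A k)))\<rparr>"

text \<open>The map between the completions of \<open>X\<close> and \<open>Y\<close> induced by a continuous linear map \<open>h\<close>.\<close>

definition completion_map ::
    "'a seminormed \<Rightarrow> 'b seminormed \<Rightarrow> ('a \<Rightarrow> 'b) \<Rightarrow> (nat \<Rightarrow> 'a) set \<Rightarrow> (nat \<Rightarrow> 'b) set" where
  "completion_map X Y h =
     (\<lambda>A\<in>carrier (completion X). compl_class Y (\<lambda>k. h (compl_rep A k)))"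

text \<open>Morphisms of Banach spaces are extensional functions (i.e. \<^const>\<open>undefined\<close> outside of the
  carrier), so that equality of morphisms is equality in HOL.\<close>

definition ban_hom :: "'a seminormed \<Rightarrow> 'b seminormed \<Rightarrow> ('a \<Rightarrow> 'b) set" where
  "ban_hom X Y = {h \<in> extensional (carrier X). linear_map X Y h \<and>
     (\<forall>x\<in>carrier X. \<forall>e>0. \<exists>d>0. \<forall>y\<in>carrier X.
        snorm X (y \<ominus>\<^bsub>X\<^esub> x) < d \<longrightarrow> snorm Y (h y \<ominus>\<^bsub>Y\<^esub> h x) < e)}"

definition ban_id :: "'a seminormed \<Rightarrow> 'a \<Rightarrow> 'a" where
  "ban_id X = (\<lambda>x\<in>carrier X. x)"


section \<open>Ind-objects of the category of Banach spaces\<close>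

text \<open>An ind-object is given by a functor to Banach spaces defined on a directed preordered set
  \<open>idx\<close>; \<open>trans i j\<close> is the morphism \<open>obj i \<rightarrow> obj j\<close> for \<open>i \<le> j\<close>.\<close>

record ('i, 'a) ind =
  idx :: "'i set"
  le :: "'i \<Rightarrow> 'i \<Rightarrow> bool"
  obj :: "'i \<Rightarrow> 'a seminormed"
  trans :: "'i \<Rightarrow> 'i \<Rightarrow> 'a \<Rightarrow> 'a"

definition ind_object :: "('i, 'a) ind \<Rightarrow> bool" where
  "ind_object X \<longleftrightarrow>
     idx X \<noteq> {} \<and>
     (\<forall>i\<in>idx X. le X i i) \<and>
     (\<forall>i\<in>idx X. \<forall>j\<in>idx X. \<forall>k\<in>idx X. le X i j \<and> le X j k \<longrightarrow> le X i k) \<and>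
     (\<forall>i\<in>idx X. \<forall>j\<in>idx X. \<exists>k\<in>idx X. le X i k \<and> le X j k) \<and>
     (\<forall>i\<in>idx X. banach_space (obj X i)) \<and>
     (\<forall>i\<in>idx X. \<forall>j\<in>idx X. le X i j \<longrightarrow> trans X i j \<in> ban_hom (obj X i) (obj X j)) \<and>
     (\<forall>i\<in>idx X. trans X i i = ban_id (obj X i)) \<and>
     (\<forall>i\<in>idx X. \<forall>j\<in>idx X. \<forall>k\<in>idx X. le X i j \<and> le X j k \<longrightarrow>
        compose (carrier (obj X i)) (trans X j k) (trans X i j) = trans X i k)"

text \<open>For a Banach space \<open>V\<close>, the elements of the set \<open>\<varinjlim>\<^sub>j Hom(V, Y\<^sub>j)\<close> are the classes of pairs
  \<open>(j, g)\<close> with \<open>g\<close> in \<open>Hom(V, Y\<^sub>j)\<close>, two pairs being identified if their images in some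
  \<open>Hom(V, Y\<^sub>l)\<close> coincide.\<close>

definition hom_germ ::
    "'a seminormed \<Rightarrow> ('j, 'b) ind \<Rightarrow> 'j \<Rightarrow> ('a \<Rightarrow> 'b) \<Rightarrow> ('j \<times> ('a \<Rightarrow> 'b)) set" where
  "hom_germ V Y j g =
     {(k, h). k \<in> idx Y \<and> h \<in> ban_hom V (obj Y k) \<and>
        (\<exists>l\<in>idx Y. le Y j l \<and> le Y k l \<and>
           compose (carrier V) (trans Y j l) g = compose (carrier V) (trans Y k l) h)}"

definition hom_colim :: "'a seminormed \<Rightarrow> ('j, 'b) ind \<Rightarrow> ('j \<times> ('a \<Rightarrow> 'b)) set set" where
  "hom_colim V Y = {hom_germ V Y j g | j g. j \<in> idx Y \<and> g \<in> ban_hom V (obj Y j)}"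

text \<open>\<open>Hom(X, Y) = \<varprojlim>\<^sub>i \<varinjlim>\<^sub>j Hom(X\<^sub>i, Y\<^sub>j)\<close>: a morphism is a family of elements of
  \<open>\<varinjlim>\<^sub>j Hom(X\<^sub>i, Y\<^sub>j)\<close> compatible with the transition morphisms of \<open>X\<close>.\<close>

definition ind_hom ::
    "('i, 'a) ind \<Rightarrow> ('j, 'b) ind \<Rightarrow> ('i \<Rightarrow> ('j \<times> ('a \<Rightarrow> 'b)) set) set" where
  "ind_hom X Y =
     {u \<in> (\<Pi>\<^sub>E i\<in>idx X. hom_colim (obj X i) Y).
        \<forall>i\<in>idx X. \<forall>i'\<in>idx X. le X i i' \<longrightarrow>
          (\<forall>(j, g)\<in>u i'. (j, compose (carrier (obj X i)) g (trans X i i')) \<in> u i)}"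

definition ind_id :: "('i, 'a) ind \<Rightarrow> 'i \<Rightarrow> ('i \<times> ('a \<Rightarrow> 'a)) set" where
  "ind_id X = (\<lambda>i\<in>idx X. hom_germ (obj X i) X i (ban_id (obj X i)))"

text \<open>\<open>ind_comp X Z v u\<close> is the composition of \<open>u : X \<rightarrow> Y\<close> and \<open>v : Y \<rightarrow> Z\<close>. All the germs in the
  union below coincide.\<close>

definition ind_comp ::
    "('i, 'a) ind \<Rightarrow> ('k, 'c) ind \<Rightarrow> ('j \<Rightarrow> ('k \<times> ('b \<Rightarrow> 'c)) set) \<Rightarrow>
     ('i \<Rightarrow> ('j \<times> ('a \<Rightarrow> 'b)) set) \<Rightarrow> 'i \<Rightarrow> ('k \<times> ('a \<Rightarrow> 'c)) set" where
  "ind_comp X Z v u =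
     (\<lambda>i\<in>idx X. \<Union>(j, g)\<in>u i. \<Union>(k, h)\<in>v j.
        hom_germ (obj X i) Z k (compose (carrier (obj X i)) h g))"

definition ind_iso ::
    "('i, 'a) ind \<Rightarrow> ('j, 'b) ind \<Rightarrow> ('i \<Rightarrow> ('j \<times> ('a \<Rightarrow> 'b)) set) \<Rightarrow> bool" where
  "ind_iso X Y u \<longleftrightarrow> u \<in> ind_hom X Y \<and>
     (\<exists>v\<in>ind_hom Y X. ind_comp X X v u = ind_id X \<and> ind_comp Y Y u v = ind_id Y)"

text \<open>The morphism of ind-objects given by an index map \<open>\<sigma>\<close> and morphisms
  \<open>g i : X\<^sub>i \<rightarrow> Y\<^bsub>\<sigma> i\<^esub>\<close>.\<close>

definition level_mor ::
    "('i, 'a) ind \<Rightarrow> ('j, 'b) ind \<Rightarrow> ('i \<Rightarrow> 'j) \<Rightarrow> ('i \<Rightarrow> 'a \<Rightarrow> 'b) \<Rightarrow>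
     'i \<Rightarrow> ('j \<times> ('a \<Rightarrow> 'b)) set" where
  "level_mor X Y \<sigma> g = (\<lambda>i\<in>idx X. hom_germ (obj X i) Y (\<sigma> i) (g i))"


section \<open>Inductive limits of sequences of ind-objects\<close>

text \<open>A sequence of ind-objects \<open>X n\<close> whose transition morphisms \<open>X n \<rightarrow> X m\<close> are given by index maps
  \<open>\<sigma> m n\<close> and morphisms \<open>g m n i\<close> compatible on the nose.\<close>

definition level_system ::
    "(nat \<Rightarrow> ('i, 'a) ind) \<Rightarrow> (nat \<Rightarrow> nat \<Rightarrow> 'i \<Rightarrow> 'i) \<Rightarrow> (nat \<Rightarrow> nat \<Rightarrow> 'i \<Rightarrow> 'a \<Rightarrow> 'a) \<Rightarrow> bool" where
  "level_system X \<sigma> g \<longleftrightarrow>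
     (\<forall>n. ind_object (X n)) \<and>
     (\<forall>m n. n \<le> m \<longrightarrow> (\<forall>i\<in>idx (X n).
        \<sigma> m n i \<in> idx (X m) \<and> g m n i \<in> ban_hom (obj (X n) i) (obj (X m) (\<sigma> m n i)))) \<and>
     (\<forall>m n. n \<le> m \<longrightarrow> (\<forall>i\<in>idx (X n). \<forall>j\<in>idx (X n). le (X n) i j \<longrightarrow>
        le (X m) (\<sigma> m n i) (\<sigma> m n j) \<and>
        compose (carrier (obj (X n) i)) (g m n j) (trans (X n) i j) =
          compose (carrier (obj (X n) i)) (trans (X m) (\<sigma> m n i) (\<sigma> m n j)) (g m n i))) \<and>
     (\<forall>n. \<forall>i\<in>idx (X n). \<sigma> n n i = i \<and> g n n i = ban_id (obj (X n) i)) \<and>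
     (\<forall>k m n. n \<le> m \<and> m \<le> k \<longrightarrow> (\<forall>i\<in>idx (X n). \<sigma> k m (\<sigma> m n i) = \<sigma> k n i \<and>
        compose (carrier (obj (X n) i)) (g k m (\<sigma> m n i)) (g m n i) = g k n i))"

text \<open>Its inductive limit is the ind-object formed by all the \<open>obj (X n) i\<close>, indexed by the pairs
  \<open>(n, i)\<close>; \<open>seq_ind_lim_universal\<close> below establishes the universal property.\<close>

definition seq_ind_lim ::
    "(nat \<Rightarrow> ('i, 'a) ind) \<Rightarrow> (nat \<Rightarrow> nat \<Rightarrow> 'i \<Rightarrow> 'i) \<Rightarrow> (nat \<Rightarrow> nat \<Rightarrow> 'i \<Rightarrow> 'a \<Rightarrow> 'a) \<Rightarrow>
     (nat \<times> 'i, 'a) ind" where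
  "seq_ind_lim X \<sigma> g =
     \<lparr>idx = (SIGMA n:UNIV. idx (X n)),
      le = (\<lambda>(n, i) (m, j). n \<le> m \<and> le (X m) (\<sigma> m n i) j),
      obj = (\<lambda>(n, i). obj (X n) i),
      trans = (\<lambda>(n, i) (m, j).
        compose (carrier (obj (X n) i)) (trans (X m) (\<sigma> m n i) j) (g m n i))\<rparr>"

definition seq_ind_lim_in ::
    "(nat \<Rightarrow> ('i, 'a) ind) \<Rightarrow> (nat \<Rightarrow> nat \<Rightarrow> 'i \<Rightarrow> 'i) \<Rightarrow> (nat \<Rightarrow> nat \<Rightarrow> 'i \<Rightarrow> 'a \<Rightarrow> 'a) \<Rightarrow>
     nat \<Rightarrow> 'i \<Rightarrow> ((nat \<times> 'i) \<times> ('a \<Rightarrow> 'a)) set" where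
  "seq_ind_lim_in X \<sigma> g n =
     level_mor (X n) (seq_ind_lim X \<sigma> g) (Pair n) (\<lambda>i. ban_id (obj (X n) i))"

text \<open>The morphism out of the inductive limit induced by a family of morphisms \<open>w n\<close> out of \<open>X n\<close>.\<close>

definition seq_ind_lim_desc ::
    "(nat \<Rightarrow> ('i, 'a) ind) \<Rightarrow> (nat \<Rightarrow> 'i \<Rightarrow> ('j \<times> ('a \<Rightarrow> 'b)) set) \<Rightarrow>
     nat \<times> 'i \<Rightarrow> ('j \<times> ('a \<Rightarrow> 'b)) set" where
  "seq_ind_lim_desc X w = (\<lambda>(n, i)\<in>(SIGMA n:UNIV. idx (X n)). w n i)"


section \<open>The functor IB\<close>

definition linear_hull :: "'a tvs \<Rightarrow> 'a set \<Rightarrow> 'a set" where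
  "linear_hull E B = \<Inter>{H. submodule H complex_ring E \<and> B \<subseteq> H}"

definition minkowski_gauge :: "'a tvs \<Rightarrow> 'a set \<Rightarrow> 'a \<Rightarrow> real" where
  "minkowski_gauge E B x = Inf {t. 0 < t \<and> (\<exists>b\<in>B. x = complex_of_real t \<odot>\<^bsub>E\<^esub> b)}"

definition hull_space :: "'a tvs \<Rightarrow> 'a set \<Rightarrow> 'a seminormed" where
  "hull_space E B =
     \<lparr>carrier = linear_hull E B, mult = undefined, one = undefined, zero = \<zero>\<^bsub>E\<^esub>,
      add = add E, smult = smult E, snorm = minkowski_gauge E B\<rparr>"

definition IB :: "'a tvs \<Rightarrow> ('a set, (nat \<Rightarrow> 'a) set) ind" where
  "IB E =
     \<lparr>idx = {B. abs_convex_in E B \<and> bounded_in E B},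
      le = (\<subseteq>),
      obj = (\<lambda>B. completion (hull_space E B)),
      trans = (\<lambda>B C. completion_map (hull_space E B) (hull_space E C) (\<lambda>x. x))\<rparr>"

abbreviation IB_comp ::
    "'a tvs \<Rightarrow> 'b tvs \<Rightarrow> ('a \<Rightarrow> 'b) \<Rightarrow> 'a set \<Rightarrow> (nat \<Rightarrow> 'a) set \<Rightarrow> (nat \<Rightarrow> 'b) set" where
  "IB_comp E F f B \<equiv> completion_map (hull_space E B) (hull_space F (f ` B)) f"

definition IB_map ::
    "'a tvs \<Rightarrow> 'b tvs \<Rightarrow> ('a \<Rightarrow> 'b) \<Rightarrow>
     'a set \<Rightarrow> ('b set \<times> ((nat \<Rightarrow> 'a) set \<Rightarrow> (nat \<Rightarrow> 'b) set)) set" where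
  "IB_map E F f = level_mor (IB E) (IB F) ((`) f) (IB_comp E F f)"

definition lim_IB ::
    "(nat \<Rightarrow> 'a tvs) \<Rightarrow> (nat \<Rightarrow> nat \<Rightarrow> 'a \<Rightarrow> 'a) \<Rightarrow> (nat \<times> 'a set, (nat \<Rightarrow> 'a) set) ind" where
  "lim_IB F f = seq_ind_lim (\<lambda>n. IB (F n)) (\<lambda>m n. (`) (f m n)) (\<lambda>m n. IB_comp (F n) (F m) (f m n))"

definition canonical_mor where
  "canonical_mor F f =
     seq_ind_lim_desc (\<lambda>n. IB (F n)) (\<lambda>n. IB_map (F n) (ind_lim F f) (lim_class F f n))"

end

theory Submission
  imports Defs
begin

text \<open>
  Write \<open>L\<close> for the limit and \<open>i\<^sub>n : F\<^sub>n \<rightarrow> L\<close> for the canonical maps, which are injective because the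
  transition morphisms are. For a bounded absolutely convex subset \<open>C\<close> of \<open>F\<^sub>n\<close>, the map \<open>i\<^sub>n\<close>
  restricts to an isometric isomorphism from the span of \<open>C\<close>, normed by the gauge of \<open>C\<close>, onto the span
  of \<open>i\<^sub>n(C)\<close>. The canonical morphism is therefore given, at each index \<open>(n, C)\<close>, by an isomorphism of
  Banach spaces onto the term of index \<open>i\<^sub>n(C)\<close> of \<open>IB(L)\<close>, and these isomorphisms commute with the
  transition morphisms. Such a morphism of ind-objects is invertible as soon as the indices that it
  hits are cofinal (\<open>ind_iso_cofinal\<close>). Everything thus reduces to the statement that each bounded
  absolutely convex subset \<open>B\<close> of \<open>L\<close> is contained in some \<open>i\<^sub>n(C)\<close> (\<open>bounded_disc_from_step\<close>).

  This is where the completeness of \<open>L\<close> and of the \<open>F\<^sub>n\<close> enters. The closure \<open>K\<close> of \<open>B\<close> is bounded and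
  absolutely convex, and since \<open>L\<close> is complete the span of \<open>K\<close> is a Banach space for the gauge of \<open>K\<close>
  (\<open>banach_space_hull\<close>); it maps continuously into the Hausdorff space \<open>L\<close>, which is the union of the
  images of the Frechet spaces \<open>F\<^sub>n\<close>. Grothendieck's factorization theorem (\<open>ball_in_image\<close>) applies:
  for a suitable \<open>n\<close>, the image under \<open>i\<^sub>n\<close> of each neighbourhood of zero of \<open>F\<^sub>n\<close> contains a ball of
  the Banach space. Its proof is that of the open mapping theorem. By Baire's theorem in the Banach
  space there is \<open>n\<close> such that, for each neighbourhood \<open>W\<close> of zero in \<open>F\<^sub>n\<close>, the image of \<open>W\<close> is dense
  in some ball about zero (\<open>almost_open\<close>); successive approximation, using that \<open>F\<^sub>n\<close> is metrizable and
  complete, removes the word \<open>dense\<close>. It follows that \<open>C = i\<^sub>n\<^sup>-\<^sup>1(K)\<close> satisfies \<open>i\<^sub>n(C) = K\<close> and is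
  absorbed by every neighbourhood of zero, so that \<open>C\<close> is bounded and \<open>B \<subseteq> K = i\<^sub>n(C)\<close>.
\<close>

section \<open>Complex vector spaces with explicit carriers\<close>

lemma cring_complex_ring: "cring complex_ring"
proof (rule cringI)
  show "abelian_group complex_ring"
  proof (rule abelian_groupI)
    show "\<exists>y\<in>carrier complex_ring. y \<oplus>\<^bsub>complex_ring\<^esub> x = \<zero>\<^bsub>complex_ring\<^esub>" for x
      by (rule bexI[of _ "- x"]) (auto simp: complex_ring_def)
  qed (auto simp: complex_ring_def)
  show "comm_monoid complex_ring"
    by (rule comm_monoidI) (auto simp: complex_ring_def)
qed (auto simp: complex_ring_def algebra_simps)

text \<open>
  Additive inverses need not be given: \<open>(-1) \<odot> x\<close> is one, thanks to the axiom \<open>0 \<odot> x = \<zero>\<close>. This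
  is convenient for the spaces below, which come with no formula for the inverse.
\<close>

lemma vec_spaceI:
  assumes "\<And>x y. x \<in> carrier V \<Longrightarrow> y \<in> carrier V \<Longrightarrow> x \<oplus>\<^bsub>V\<^esub> y \<in> carrier V"
    and "\<zero>\<^bsub>V\<^esub> \<in> carrier V"
    and smult: "\<And>c x. x \<in> carrier V \<Longrightarrow> c \<odot>\<^bsub>V\<^esub> x \<in> carrier V"
    and "\<And>x y z. x \<in> carrier V \<Longrightarrow> y \<in> carrier V \<Longrightarrow> z \<in> carrier V \<Longrightarrow>
      (x \<oplus>\<^bsub>V\<^esub> y) \<oplus>\<^bsub>V\<^esub> z = x \<oplus>\<^bsub>V\<^esub> (y \<oplus>\<^bsub>V\<^esub> z)"
    and "\<And>x y. x \<in> carrier V \<Longrightarrow> y \<in> carrier V \<Longrightarrow> x \<oplus>\<^bsub>V\<^esub> y = y \<oplus>\<^bsub>V\<^esub> x"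
    and "\<And>x. x \<in> carrier V \<Longrightarrow> \<zero>\<^bsub>V\<^esub> \<oplus>\<^bsub>V\<^esub> x = x"
    and zero: "\<And>x. x \<in> carrier V \<Longrightarrow> 0 \<odot>\<^bsub>V\<^esub> x = \<zero>\<^bsub>V\<^esub>"
    and distl: "\<And>a b x. x \<in> carrier V \<Longrightarrow> (a + b) \<odot>\<^bsub>V\<^esub> x = a \<odot>\<^bsub>V\<^esub> x \<oplus>\<^bsub>V\<^esub> b \<odot>\<^bsub>V\<^esub> x"
    and "\<And>a x y. x \<in> carrier V \<Longrightarrow> y \<in> carrier V \<Longrightarrow> a \<odot>\<^bsub>V\<^esub> (x \<oplus>\<^bsub>V\<^esub> y) = a \<odot>\<^bsub>V\<^esub> x \<oplus>\<^bsub>V\<^esub> a \<odot>\<^bsub>V\<^esub> y"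
    and "\<And>a b x. x \<in> carrier V \<Longrightarrow> (a * b) \<odot>\<^bsub>V\<^esub> x = a \<odot>\<^bsub>V\<^esub> (b \<odot>\<^bsub>V\<^esub> x)"
    and one: "\<And>x. x \<in> carrier V \<Longrightarrow> 1 \<odot>\<^bsub>V\<^esub> x = x"
  shows "vec_space V"
proof (rule moduleI[OF cring_complex_ring])
  show "abelian_group V"
  proof (rule abelian_groupI)
    show "\<exists>y\<in>carrier V. y \<oplus>\<^bsub>V\<^esub> x = \<zero>\<^bsub>V\<^esub>" if "x \<in> carrier V" for x
      using distl[OF that, of "-1" 1] zero[OF that] one[OF that] smult[OF that]
      by (intro bexI[of _ "(-1) \<odot>\<^bsub>V\<^esub> x"]) auto
  qed (use assms in auto)
qed (use assms in \<open>auto simp: complex_ring_def\<close>)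

locale complex_space =
  fixes V :: "(complex, 'a, 'm) module_scheme" (structure)
  assumes vec_space: "vec_space V"
begin

sublocale Module.module complex_ring V
  by (rule vec_space)

lemma smult_cl [simp, intro]: "x \<in> carrier V \<Longrightarrow> c \<odot> x \<in> carrier V"
  using smult_closed[of c x] by (simp add: complex_ring_def)

lemma smult_add_left: "x \<in> carrier V \<Longrightarrow> (a + b) \<odot> x = a \<odot> x \<oplus> b \<odot> x"
  using smult_l_distr[of a b x] by (simp add: complex_ring_def)

lemma smult_add_right:
  "x \<in> carrier V \<Longrightarrow> y \<in> carrier V \<Longrightarrow> c \<odot> (x \<oplus> y) = c \<odot> x \<oplus> c \<odot> y"
  using smult_r_distr[of c x y] by (simp add: complex_ring_def)

lemma smult_smult: "x \<in> carrier V \<Longrightarrow> a \<odot> (b \<odot> x) = (a * b) \<odot> x"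
  using smult_assoc1[of a b x] by (simp add: complex_ring_def)

lemma smult_1 [simp]: "x \<in> carrier V \<Longrightarrow> 1 \<odot> x = x"
  using smult_one[of x] by (simp add: complex_ring_def)

lemma smult_0 [simp]: "x \<in> carrier V \<Longrightarrow> 0 \<odot> x = \<zero>"
  using smult_l_null[of x] by (simp add: complex_ring_def)

lemma smult_zero [simp]: "c \<odot> \<zero> = \<zero>"
  using smult_r_null[of c] by (simp add: complex_ring_def)

lemma smult_uminus_one: "x \<in> carrier V \<Longrightarrow> (-1) \<odot> x = \<ominus> x"
  using smult_add_left[of x "-1" 1] by (metis add.left_inverse minus_equality smult_0 smult_1 smult_cl)

lemma minus_eq_smult: "x \<in> carrier V \<Longrightarrow> y \<in> carrier V \<Longrightarrow> x \<ominus> y = x \<oplus> (-1) \<odot> y"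
  by (simp add: a_minus_def smult_uminus_one)

lemma smult_minus_right:
  "x \<in> carrier V \<Longrightarrow> y \<in> carrier V \<Longrightarrow> c \<odot> (x \<ominus> y) = c \<odot> x \<ominus> c \<odot> y"
  by (simp add: minus_eq_smult smult_add_right smult_smult)

lemma minus_self [simp]: "x \<in> carrier V \<Longrightarrow> x \<ominus> x = \<zero>"
  by (simp add: a_minus_def r_neg)

lemma minus_zero [simp]: "x \<in> carrier V \<Longrightarrow> x \<ominus> \<zero> = x"
  by (simp add: a_minus_def)

lemma minus_minus_eq: "x \<in> carrier V \<Longrightarrow> y \<in> carrier V \<Longrightarrow> \<ominus> (x \<ominus> y) = y \<ominus> x"
  by (simp add: a_minus_def minus_add a_comm)

lemma minus_add_minus:
  "\<lbrakk>x \<in> carrier V; y \<in> carrier V; z \<in> carrier V\<rbrakk> \<Longrightarrow> (x \<ominus> y) \<oplus> (y \<ominus> z) = x \<ominus> z"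
  by (simp add: a_minus_def a_assoc r_neg2 r_neg1)

lemma add_minus_add:
  "\<lbrakk>x \<in> carrier V; y \<in> carrier V; x' \<in> carrier V; y' \<in> carrier V\<rbrakk> \<Longrightarrow>
    (x \<oplus> y) \<ominus> (x' \<oplus> y') = (x \<ominus> x') \<oplus> (y \<ominus> y')"
  by (simp add: a_minus_def minus_add a_ac)

lemma add_minus_cancel [simp]: "x \<in> carrier V \<Longrightarrow> y \<in> carrier V \<Longrightarrow> x \<oplus> (y \<ominus> x) = y"
  by (simp add: a_minus_def a_lcomm[of x y] r_neg)

lemma minus_eq_zero_iff: "x \<in> carrier V \<Longrightarrow> y \<in> carrier V \<Longrightarrow> x \<ominus> y = \<zero> \<longleftrightarrow> x = y"
  by (metis add_minus_cancel minus_self r_zero)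

lemma add_minus_cancel_left [simp]:
  "x \<in> carrier V \<Longrightarrow> y \<in> carrier V \<Longrightarrow> (x \<oplus> y) \<ominus> x = y"
  by (simp add: a_minus_def a_comm[of x y] a_assoc r_neg)

lemma minus_minus_minus:
  "\<lbrakk>x \<in> carrier V; y \<in> carrier V; z \<in> carrier V\<rbrakk> \<Longrightarrow> (x \<ominus> z) \<ominus> (y \<ominus> z) = x \<ominus> y"
  by (metis a_minus_def minus_add_minus minus_minus_eq)

lemma minus_diff_minus:
  "\<lbrakk>x \<in> carrier V; y \<in> carrier V; z \<in> carrier V\<rbrakk> \<Longrightarrow> (y \<ominus> (x \<ominus> z)) \<ominus> z = y \<ominus> x"
  by (simp add: a_minus_def minus_add a_assoc r_neg)

lemma add_add_add:
  "\<lbrakk>x \<in> carrier V; y \<in> carrier V; z \<in> carrier V; w \<in> carrier V\<rbrakk> \<Longrightarrow>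
    (x \<oplus> y) \<oplus> (z \<oplus> w) = (x \<oplus> z) \<oplus> (y \<oplus> w)"
  by (simp add: a_ac)

lemma smult_inverse_cancel [simp]:
  assumes "c \<noteq> 0" "x \<in> carrier V"
  shows "c \<odot> (inverse c \<odot> x) = x" "inverse c \<odot> (c \<odot> x) = x"
  using assms by (simp_all add: smult_smult)

end

locale complex_linear = V: complex_space V + W: complex_space W
  for V :: "(complex, 'a, 'm) module_scheme" and W :: "(complex, 'b, 'n) module_scheme" +
  fixes h :: "'a \<Rightarrow> 'b"
  assumes linear: "linear_map V W h"
begin

lemma h_closed [simp, intro]: "x \<in> carrier V \<Longrightarrow> h x \<in> carrier W"
  using linear by (auto simp: linear_map_def)

lemma h_add [simp]: "x \<in> carrier V \<Longrightarrow> y \<in> carrier V \<Longrightarrow> h (x \<oplus>\<^bsub>V\<^esub> y) = h x \<oplus>\<^bsub>W\<^esub> h y"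
  using linear by (auto simp: linear_map_def)

lemma h_smult [simp]: "x \<in> carrier V \<Longrightarrow> h (c \<odot>\<^bsub>V\<^esub> x) = c \<odot>\<^bsub>W\<^esub> h x"
  using linear by (auto simp: linear_map_def)

lemma h_minus [simp]: "x \<in> carrier V \<Longrightarrow> y \<in> carrier V \<Longrightarrow> h (x \<ominus>\<^bsub>V\<^esub> y) = h x \<ominus>\<^bsub>W\<^esub> h y"
  by (simp add: V.minus_eq_smult W.minus_eq_smult)

lemma h_zero [simp]: "h \<zero>\<^bsub>V\<^esub> = \<zero>\<^bsub>W\<^esub>"
  by (metis V.smult_0 V.zero_closed W.smult_0 h_closed h_smult)

end


section \<open>Morphisms of ind-objects given levelwise\<close>

lemma ban_hom_closed: "g \<in> ban_hom V W \<Longrightarrow> x \<in> carrier V \<Longrightarrow> g x \<in> carrier W"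
  by (auto simp: ban_hom_def linear_map_def)

lemma ban_hom_compose:
  assumes U: "vec_space U" and g: "g \<in> ban_hom U V" and h: "h \<in> ban_hom V W"
  shows "compose (carrier U) h g \<in> ban_hom U W"
proof -
  interpret U: complex_space U by (rule complex_space.intro[OF U])
  note cl = ban_hom_closed[OF g]
  have "linear_map U W (compose (carrier U) h g)"
    using g h cl
    by (auto simp: ban_hom_def linear_map_def Pi_iff compose_def)
  moreover have "\<exists>d>0. \<forall>y\<in>carrier U. snorm U (y \<ominus>\<^bsub>U\<^esub> x) < d \<longrightarrow>
      snorm W (compose (carrier U) h g y \<ominus>\<^bsub>W\<^esub> compose (carrier U) h g x) < e"
    if x: "x \<in> carrier U" and "e > 0" for x e
  proof -
    obtain d where "d > 0" and d: "\<And>y. y \<in> carrier V \<Longrightarrow> snorm V (y \<ominus>\<^bsub>V\<^esub> g x) < d \<Longrightarrow>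
        snorm W (h y \<ominus>\<^bsub>W\<^esub> h (g x)) < e"
      using h cl[OF x] \<open>e > 0\<close> unfolding ban_hom_def by blast
    obtain d' where "d' > 0" and d': "\<And>y. y \<in> carrier U \<Longrightarrow> snorm U (y \<ominus>\<^bsub>U\<^esub> x) < d' \<Longrightarrow>
        snorm V (g y \<ominus>\<^bsub>V\<^esub> g x) < d"
      using g x \<open>d > 0\<close> unfolding ban_hom_def by blast
    show ?thesis
      using \<open>d' > 0\<close> d d' cl x by (intro exI[of _ d']) (auto simp: compose_def)
  qed
  ultimately show ?thesis
    by (auto simp: ban_hom_def)
qed

lemma ban_hom_compose_assoc:
  assumes "g \<in> ban_hom U V"
  shows "compose (carrier U) (compose (carrier V) k h) g = compose (carrier U) k (compose (carrier U) h g)"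
  using ban_hom_closed[OF assms] by (auto simp: compose_def fun_eq_iff)

lemma ban_hom_compose_id:
  assumes "g \<in> ban_hom U V"
  shows "compose (carrier U) (ban_id V) g = g" "compose (carrier U) g (ban_id U) = g"
  using assms ban_hom_closed[OF assms]
  by (auto simp: compose_def ban_id_def ban_hom_def extensional_def fun_eq_iff)

text \<open>
  The structure on which the calculus of germs of morphisms into an ind-object rests: a directed
  system, whose terms are vector spaces so that composites of morphisms are linear.
\<close>

locale ind_diagram =
  fixes X :: "('i, 'a) ind"
  assumes le_refl: "i \<in> idx X \<Longrightarrow> le X i i"
    and le_trans: "\<lbrakk>i \<in> idx X; j \<in> idx X; k \<in> idx X; le X i j; le X j k\<rbrakk> \<Longrightarrow> le X i k"
    and directed: "\<lbrakk>i \<in> idx X; j \<in> idx X\<rbrakk> \<Longrightarrow> \<exists>k\<in>idx X. le X i k \<and> le X j k"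
    and obj_vec_space: "i \<in> idx X \<Longrightarrow> vec_space (obj X i)"
    and trans_hom: "\<lbrakk>i \<in> idx X; j \<in> idx X; le X i j\<rbrakk> \<Longrightarrow> trans X i j \<in> ban_hom (obj X i) (obj X j)"
    and trans_id: "i \<in> idx X \<Longrightarrow> trans X i i = ban_id (obj X i)"
    and trans_comp: "\<lbrakk>i \<in> idx X; j \<in> idx X; k \<in> idx X; le X i j; le X j k\<rbrakk> \<Longrightarrow>
      compose (carrier (obj X i)) (trans X j k) (trans X i j) = trans X i k"
begin

lemma hom_germ_refl:
  assumes "j \<in> idx X" "g \<in> ban_hom V (obj X j)"
  shows "(j, g) \<in> hom_germ V X j g"
  using assms le_refl by (auto simp: hom_germ_def)

lemma trans_comp_hom:
  assumes "i \<in> idx X" "j \<in> idx X" "k \<in> idx X" "le X i j" "le X j k" "g \<in> ban_hom V (obj X i)"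
  shows "compose (carrier V) (trans X j k) (compose (carrier V) (trans X i j) g) =
    compose (carrier V) (trans X i k) g"
  using assms by (metis ban_hom_compose_assoc trans_comp)

text \<open>
  Equality in some common \<open>obj X l\<close> is transitive because the index set is directed, so that germs are
  genuine equivalence classes.
\<close>

lemma hom_germ_eqI:
  assumes j: "j \<in> idx X" and g: "g \<in> ban_hom V (obj X j)" and kh: "(k, h) \<in> hom_germ V X j g"
  shows "hom_germ V X k h = hom_germ V X j g"
proof -
  have trans_germ: "(k', h') \<in> hom_germ V X j g"
    if j: "j \<in> idx X" and g: "g \<in> ban_hom V (obj X j)"
      and kh: "(k, h) \<in> hom_germ V X j g" and kh': "(k', h') \<in> hom_germ V X k h" for j g k h k' h'
  proof -
    obtain l where k: "k \<in> idx X" "h \<in> ban_hom V (obj X k)" and l: "l \<in> idx X" "le X j l" "le X k l"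
      and eq: "compose (carrier V) (trans X j l) g = compose (carrier V) (trans X k l) h"
      using kh by (auto simp: hom_germ_def)
    obtain l' where k': "k' \<in> idx X" "h' \<in> ban_hom V (obj X k')"
      and l': "l' \<in> idx X" "le X k l'" "le X k' l'"
      and eq': "compose (carrier V) (trans X k l') h = compose (carrier V) (trans X k' l') h'"
      using kh' by (auto simp: hom_germ_def)
    obtain m where m: "m \<in> idx X" "le X l m" "le X l' m"
      using directed l l' by blast
    have "compose (carrier V) (trans X j m) g =
        compose (carrier V) (trans X l m) (compose (carrier V) (trans X j l) g)"
      using trans_comp_hom j g l m by metis
    also have "\<dots> = compose (carrier V) (trans X k m) h"
      unfolding eq using trans_comp_hom k l m by metis
    also have "\<dots> = compose (carrier V) (trans X l' m) (compose (carrier V) (trans X k l') h)"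
      using trans_comp_hom k l' m by metis
    also have "\<dots> = compose (carrier V) (trans X k' m) h'"
      unfolding eq' using trans_comp_hom k' l' m by metis
    finally show ?thesis
      using k' m le_trans j l l' unfolding hom_germ_def by blast
  qed
  have k: "k \<in> idx X" "h \<in> ban_hom V (obj X k)"
    using kh by (auto simp: hom_germ_def)
  have jg: "(j, g) \<in> hom_germ V X k h"
    using kh j g by (fastforce simp: hom_germ_def)
  show ?thesis
  proof (intro subset_antisym subrelI)
    show "(k', h') \<in> hom_germ V X j g" if "(k', h') \<in> hom_germ V X k h" for k' h'
      using that by (rule trans_germ[OF j g kh])
    show "(k', h') \<in> hom_germ V X k h" if "(k', h') \<in> hom_germ V X j g" for k' h'
      using that by (rule trans_germ[OF k jg])
  qed
qed

lemma hom_germ_trans: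
  assumes "j \<in> idx X" "l \<in> idx X" "le X j l" "vec_space V" "g \<in> ban_hom V (obj X j)"
  shows "hom_germ V X l (compose (carrier V) (trans X j l) g) = hom_germ V X j g"
proof (rule hom_germ_eqI)
  have h: "compose (carrier V) (trans X j l) g \<in> ban_hom V (obj X l)"
    using assms ban_hom_compose trans_hom by blast
  then have "compose (carrier V) (trans X l l) (compose (carrier V) (trans X j l) g) =
      compose (carrier V) (trans X j l) g"
    using assms by (simp add: trans_id ban_hom_compose_id)
  then show "(l, compose (carrier V) (trans X j l) g) \<in> hom_germ V X j g"
    using assms le_refl h unfolding hom_germ_def by force
qed (use assms in auto)

lemma hom_germ_precompose:
  assumes "vec_space U" "t \<in> ban_hom U V" "(k, h) \<in> hom_germ V X j g"
  shows "(k, compose (carrier U) h t) \<in> hom_germ U X j (compose (carrier U) g t)"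
proof -
  obtain l where "k \<in> idx X" "h \<in> ban_hom V (obj X k)" and l: "l \<in> idx X" "le X j l" "le X k l"
    and eq: "compose (carrier V) (trans X j l) g = compose (carrier V) (trans X k l) h"
    using assms(3) by (auto simp: hom_germ_def)
  moreover have "compose (carrier U) h t \<in> ban_hom U (obj X k)"
    using ban_hom_compose assms calculation by blast
  moreover have "compose (carrier U) (trans X j l) (compose (carrier U) g t) =
     compose (carrier U) (trans X k l) (compose (carrier U) h t)"
    using eq ban_hom_compose_assoc[OF assms(2)] by metis
  ultimately show ?thesis
    unfolding hom_germ_def by blast
qed

end

lemma level_mor_in_ind_hom:
  assumes X: "ind_diagram X" and Y: "ind_diagram Y"
    and \<sigma>: "\<And>i. i \<in> idx X \<Longrightarrow> \<sigma> i \<in> idx Y"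
    and g: "\<And>i. i \<in> idx X \<Longrightarrow> g i \<in> ban_hom (obj X i) (obj Y (\<sigma> i))"
    and compat: "\<And>i i'. \<lbrakk>i \<in> idx X; i' \<in> idx X; le X i i'\<rbrakk> \<Longrightarrow>
      hom_germ (obj X i) Y (\<sigma> i') (compose (carrier (obj X i)) (g i') (trans X i i')) =
      hom_germ (obj X i) Y (\<sigma> i) (g i)"
  shows "level_mor X Y \<sigma> g \<in> ind_hom X Y"
proof -
  interpret X: ind_diagram X by (rule X)
  interpret Y: ind_diagram Y by (rule Y)
  have "level_mor X Y \<sigma> g \<in> (\<Pi>\<^sub>E i\<in>idx X. hom_colim (obj X i) Y)"
    using \<sigma> g by (auto simp: level_mor_def hom_colim_def)
  moreover have "(j, compose (carrier (obj X i)) h (trans X i i')) \<in> level_mor X Y \<sigma> g i"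
    if ii': "i \<in> idx X" "i' \<in> idx X" "le X i i'" and jh: "(j, h) \<in> level_mor X Y \<sigma> g i'" for i i' j h
  proof -
    have "(j, h) \<in> hom_germ (obj X i') Y (\<sigma> i') (g i')"
      using jh ii' by (simp add: level_mor_def)
    from Y.hom_germ_precompose[OF X.obj_vec_space[OF ii'(1)] X.trans_hom[OF ii'] this]
    show ?thesis
      using ii' by (simp add: compat level_mor_def)
  qed
  ultimately show ?thesis
    by (auto simp: ind_hom_def)
qed

text \<open>
  The composition of morphisms of ind-objects is a union over all representatives. For levelwise
  morphisms all the members of this union coincide with the germ of the evident representative: a
  change of representative in \<open>Y\<close> is absorbed by moving along \<open>trans Y j l\<close>, and the family defining
  the second morphism is compatible with these transitions.
\<close>

lemma ind_comp_level_mor: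
  fixes X :: "('i, 'a) ind" and Y :: "('j, 'b) ind" and Z :: "('k, 'c) ind"
  assumes X: "ind_diagram X" and Y: "ind_diagram Y" and Z: "ind_diagram Z"
    and \<sigma>: "\<And>i. i \<in> idx X \<Longrightarrow> \<sigma> i \<in> idx Y"
    and g: "\<And>i. i \<in> idx X \<Longrightarrow> g i \<in> ban_hom (obj X i) (obj Y (\<sigma> i))"
    and \<tau>: "\<And>j. j \<in> idx Y \<Longrightarrow> \<tau> j \<in> idx Z"
    and h: "\<And>j. j \<in> idx Y \<Longrightarrow> h j \<in> ban_hom (obj Y j) (obj Z (\<tau> j))"
    and v: "level_mor Y Z \<tau> h \<in> ind_hom Y Z"
  shows "ind_comp X Z (level_mor Y Z \<tau> h) (level_mor X Y \<sigma> g) =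
    level_mor X Z (\<tau> \<circ> \<sigma>) (\<lambda>i. compose (carrier (obj X i)) (h (\<sigma> i)) (g i))"
    (is "ind_comp X Z ?v ?u = _")
proof -
  interpret X: ind_diagram X by (rule X)
  interpret Y: ind_diagram Y by (rule Y)
  interpret Z: ind_diagram Z by (rule Z)
  have v_pull: "hom_germ U Z (\<tau> l) (compose (carrier U) (h l) (compose (carrier U) (trans Y j l) g')) =
      hom_germ U Z k (compose (carrier U) h' g')"
    if jl: "j \<in> idx Y" "l \<in> idx Y" "le Y j l" and U: "vec_space U" and g': "g' \<in> ban_hom U (obj Y j)"
      and kh: "(k, h') \<in> ?v j" for U :: "'a seminormed" and j l g' k h'
  proof -
    have *: "(\<tau> l, compose (carrier (obj Y j)) (h l) (trans Y j l)) \<in> ?v j"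
    proof -
      have "(\<tau> l, h l) \<in> ?v l"
        using jl by (simp add: level_mor_def Z.hom_germ_refl \<tau> h)
      then show ?thesis
        using v jl by (fastforce simp: ind_hom_def)
    qed
    have eq: "hom_germ U Z k'' (compose (carrier U) h'' g') =
        hom_germ U Z (\<tau> j) (compose (carrier U) (h j) g')" if "(k'', h'') \<in> ?v j" for k'' h''
    proof (rule Z.hom_germ_eqI)
      show "(k'', compose (carrier U) h'' g') \<in> hom_germ U Z (\<tau> j) (compose (carrier U) (h j) g')"
        using Z.hom_germ_precompose[OF U g'] that jl by (simp add: level_mor_def)
      show "compose (carrier U) (h j) g' \<in> ban_hom U (obj Z (\<tau> j))"
        using ban_hom_compose[OF U g'] h jl by blast
    qed (use \<tau> jl in auto)
    show ?thesis
      using eq[OF *] eq[OF kh] ban_hom_compose_assoc[OF g'] by metis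
  qed
  have "(\<Union>(j, g')\<in>?u i. \<Union>(k, h')\<in>?v j. hom_germ (obj X i) Z k (compose (carrier (obj X i)) h' g')) =
      hom_germ (obj X i) Z (\<tau> (\<sigma> i)) (compose (carrier (obj X i)) (h (\<sigma> i)) (g i))"
    (is "?L = ?R") if i: "i \<in> idx X" for i
  proof -
    note U = X.obj_vec_space[OF i]
    have eq: "hom_germ (obj X i) Z k (compose (carrier (obj X i)) h' g') = ?R"
      if jg: "(j, g') \<in> ?u i" and kh: "(k, h') \<in> ?v j" for j g' k h'
    proof -
      obtain l where j: "j \<in> idx Y" "g' \<in> ban_hom (obj X i) (obj Y j)"
        and l: "l \<in> idx Y" "le Y (\<sigma> i) l" "le Y j l"
        and e: "compose (carrier (obj X i)) (trans Y (\<sigma> i) l) (g i) =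
          compose (carrier (obj X i)) (trans Y j l) g'"
        using jg i by (auto simp: level_mor_def hom_germ_def)
      have "(\<tau> (\<sigma> i), h (\<sigma> i)) \<in> ?v (\<sigma> i)"
        using i by (simp add: level_mor_def Z.hom_germ_refl \<sigma> \<tau> h)
      from v_pull[OF \<sigma>[OF i] l(1,2) U g[OF i] this] v_pull[OF j(1) l(1,3) U j(2) kh]
      show ?thesis
        by (simp add: e)
    qed
    have "(\<sigma> i, g i) \<in> ?u i" "(\<tau> (\<sigma> i), h (\<sigma> i)) \<in> ?v (\<sigma> i)"
      using i by (simp_all add: level_mor_def Z.hom_germ_refl Y.hom_germ_refl \<sigma> g \<tau> h)
    then have "?R \<subseteq> ?L"
      by blast
    moreover have "?L \<subseteq> ?R"
      using eq by blast
    ultimately show ?thesis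
      by blast
  qed
  then show ?thesis
    unfolding ind_comp_def level_mor_def[of X Z] by (auto simp: fun_eq_iff)
qed

text \<open>
  The inverse sends the term of index \<open>j\<close> of \<open>Y\<close> along a transition morphism to some \<open>obj Y (\<sigma> i)\<close>
  and from there by \<open>h i\<close> to \<open>obj X i\<close>. The germ obtained does not depend on the choice of \<open>i\<close>: two
  choices can be compared at an index dominating both, and \<open>h\<close> commutes with the transition morphisms
  because \<open>g\<close> does.
\<close>

lemma ind_iso_cofinal:
  assumes X: "ind_diagram X" and Y: "ind_diagram Y"
    and \<sigma>: "\<And>i. i \<in> idx X \<Longrightarrow> \<sigma> i \<in> idx Y"
    and mono: "\<And>i i'. \<lbrakk>i \<in> idx X; i' \<in> idx X; le X i i'\<rbrakk> \<Longrightarrow> le Y (\<sigma> i) (\<sigma> i')"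
    and cofinal: "\<And>j. j \<in> idx Y \<Longrightarrow> \<exists>i\<in>idx X. le Y j (\<sigma> i)"
    and g: "\<And>i. i \<in> idx X \<Longrightarrow> g i \<in> ban_hom (obj X i) (obj Y (\<sigma> i))"
    and h: "\<And>i. i \<in> idx X \<Longrightarrow> h i \<in> ban_hom (obj Y (\<sigma> i)) (obj X i)"
    and hg: "\<And>i. i \<in> idx X \<Longrightarrow> compose (carrier (obj X i)) (h i) (g i) = ban_id (obj X i)"
    and gh: "\<And>i. i \<in> idx X \<Longrightarrow> compose (carrier (obj Y (\<sigma> i))) (g i) (h i) = ban_id (obj Y (\<sigma> i))"
    and natural: "\<And>i i'. \<lbrakk>i \<in> idx X; i' \<in> idx X; le X i i'\<rbrakk> \<Longrightarrow>
      compose (carrier (obj X i)) (g i') (trans X i i') =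
      compose (carrier (obj X i)) (trans Y (\<sigma> i) (\<sigma> i')) (g i)"
  shows "ind_iso X Y (level_mor X Y \<sigma> g)"
proof -
  interpret X: ind_diagram X by (rule X)
  interpret Y: ind_diagram Y by (rule Y)
  let ?u = "level_mor X Y \<sigma> g"
  define \<tau> where "\<tau> j = (SOME i. i \<in> idx X \<and> le Y j (\<sigma> i))" for j
  define k where "k j = compose (carrier (obj Y j)) (h (\<tau> j)) (trans Y j (\<sigma> (\<tau> j)))" for j
  let ?v = "level_mor Y X \<tau> k"
  have \<tau>: "\<tau> j \<in> idx X" "le Y j (\<sigma> (\<tau> j))" if "j \<in> idx Y" for j
    using someI_ex[of "\<lambda>i. i \<in> idx X \<and> le Y j (\<sigma> i)"] cofinal[OF that] by (auto simp: \<tau>_def)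
  have k: "k j \<in> ban_hom (obj Y j) (obj X (\<tau> j))" if "j \<in> idx Y" for j
    unfolding k_def using that \<tau> \<sigma> h Y.trans_hom Y.obj_vec_space by (intro ban_hom_compose) auto
  have natural_h: "compose (carrier (obj Y (\<sigma> i))) (trans X i i') (h i) =
      compose (carrier (obj Y (\<sigma> i))) (h i') (trans Y (\<sigma> i) (\<sigma> i'))"
    if ii': "i \<in> idx X" "i' \<in> idx X" "le X i i'" for i i'
  proof (rule ext)
    fix y
    show "compose (carrier (obj Y (\<sigma> i))) (trans X i i') (h i) y =
      compose (carrier (obj Y (\<sigma> i))) (h i') (trans Y (\<sigma> i) (\<sigma> i')) y"
    proof (cases "y \<in> carrier (obj Y (\<sigma> i))")
      case True
      define x where "x = h i y"
      have x: "x \<in> carrier (obj X i)"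
        unfolding x_def using ban_hom_closed[OF h[OF ii'(1)] True] .
      have "y = g i x"
        using fun_cong[OF gh[OF ii'(1)], of y] True by (simp add: x_def compose_def ban_id_def)
      moreover have "trans Y (\<sigma> i) (\<sigma> i') (g i x) = g i' (trans X i i' x)"
        using fun_cong[OF natural[OF ii'], of x] x by (simp add: compose_def)
      moreover have "h i' (g i' (trans X i i' x)) = trans X i i' x"
        using fun_cong[OF hg[OF ii'(2)], of "trans X i i' x"] ban_hom_closed[OF X.trans_hom[OF ii'] x]
        by (simp add: compose_def ban_id_def)
      ultimately show ?thesis
        using True by (simp add: compose_def x_def)
    qed (simp add: compose_def)
  qed
  \<comment> \<open>The germ of \<open>k j\<close> may be computed at any index \<open>i\<close> of \<open>X\<close> that is large enough.\<close>
  have germ_k: "hom_germ (obj Y j) X (\<tau> j) (k j) =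
      hom_germ (obj Y j) X i (compose (carrier (obj Y j)) (h i) (trans Y j (\<sigma> i)))"
    if j: "j \<in> idx Y" and i: "i \<in> idx X" "le Y j (\<sigma> i)" for i j
  proof -
    note U = Y.obj_vec_space[OF j]
    have step: "hom_germ (obj Y j) X i (compose (carrier (obj Y j)) (h i) (trans Y j (\<sigma> i))) =
      hom_germ (obj Y j) X m (compose (carrier (obj Y j)) (h m) (trans Y j (\<sigma> m)))"
      if i: "i \<in> idx X" "le Y j (\<sigma> i)" and m: "m \<in> idx X" "le X i m" for i m
    proof -
      note t = Y.trans_hom[OF j \<sigma>[OF i(1)] i(2)]
      have "hom_germ (obj Y j) X i (compose (carrier (obj Y j)) (h i) (trans Y j (\<sigma> i))) =
         hom_germ (obj Y j) X m (compose (carrier (obj Y j)) (trans X i m)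
           (compose (carrier (obj Y j)) (h i) (trans Y j (\<sigma> i))))"
        using X.hom_germ_trans[OF i(1) m U] ban_hom_compose[OF U t h[OF i(1)]] by simp
      also have "compose (carrier (obj Y j)) (trans X i m)
           (compose (carrier (obj Y j)) (h i) (trans Y j (\<sigma> i))) =
         compose (carrier (obj Y j)) (h m) (compose (carrier (obj Y j)) (trans Y (\<sigma> i) (\<sigma> m)) (trans Y j (\<sigma> i)))"
        using ban_hom_compose_assoc[OF t] natural_h[OF i(1) m] by metis
      also have "compose (carrier (obj Y j)) (trans Y (\<sigma> i) (\<sigma> m)) (trans Y j (\<sigma> i)) = trans Y j (\<sigma> m)"
        using Y.trans_comp[OF j \<sigma>[OF i(1)] \<sigma>[OF m(1)] i(2)] mono i m by simp
      finally show ?thesis .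
    qed
    obtain m where m: "m \<in> idx X" "le X i m" "le X (\<tau> j) m"
      using X.directed[OF i(1) \<tau>(1)[OF j]] by blast
    show ?thesis
      using step[OF i m(1,2)] step[OF \<tau>[OF j] m(1,3)] by (simp add: k_def)
  qed
  have u: "?u \<in> ind_hom X Y"
  proof (rule level_mor_in_ind_hom[OF X Y \<sigma> g])
    show "hom_germ (obj X i) Y (\<sigma> i') (compose (carrier (obj X i)) (g i') (trans X i i')) =
      hom_germ (obj X i) Y (\<sigma> i) (g i)" if ii': "i \<in> idx X" "i' \<in> idx X" "le X i i'" for i i'
      unfolding natural[OF ii']
      using ii' by (simp add: Y.hom_germ_trans \<sigma> mono X.obj_vec_space g)
  qed
  have v: "?v \<in> ind_hom Y X"
  proof (rule level_mor_in_ind_hom[OF Y X \<tau>(1) k])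
    show "hom_germ (obj Y i) X (\<tau> i') (compose (carrier (obj Y i)) (k i') (trans Y i i')) =
      hom_germ (obj Y i) X (\<tau> i) (k i)" if ii': "i \<in> idx Y" "i' \<in> idx Y" "le Y i i'" for i i'
    proof -
      have "compose (carrier (obj Y i)) (k i') (trans Y i i') =
         compose (carrier (obj Y i)) (h (\<tau> i')) (trans Y i (\<sigma> (\<tau> i')))"
        unfolding k_def ban_hom_compose_assoc[OF Y.trans_hom[OF ii']]
        using Y.trans_comp ii' \<tau> \<sigma> by simp
      moreover have "le Y i (\<sigma> (\<tau> i'))"
        using Y.le_trans[OF ii'(1,2) _ ii'(3)] \<tau> \<sigma> ii' by simp
      ultimately show ?thesis
        using germ_k[OF ii'(1) \<tau>(1)[OF ii'(2)]] by simp
    qed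
  qed
  have "ind_comp X X ?v ?u = ind_id X"
  proof -
    have "hom_germ (obj X i) X (\<tau> (\<sigma> i)) (compose (carrier (obj X i)) (k (\<sigma> i)) (g i)) =
      hom_germ (obj X i) X i (ban_id (obj X i))" if i: "i \<in> idx X" for i
    proof -
      note si = \<sigma>[OF i]
      note U = X.obj_vec_space[OF i]
      have refl: "le Y (\<sigma> i) (\<sigma> i)" by (rule Y.le_refl[OF si])
      have "(\<tau> (\<sigma> i), k (\<sigma> i)) \<in> hom_germ (obj Y (\<sigma> i)) X i
          (compose (carrier (obj Y (\<sigma> i))) (h i) (trans Y (\<sigma> i) (\<sigma> i)))"
        unfolding germ_k[OF si i refl, symmetric] using X.hom_germ_refl \<tau> k si by blast
      then have "(\<tau> (\<sigma> i), k (\<sigma> i)) \<in> hom_germ (obj Y (\<sigma> i)) X i (h i)"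
        using ban_hom_compose_id[OF h[OF i]] by (simp add: Y.trans_id[OF si])
      from X.hom_germ_precompose[OF U g[OF i] this]
      have mem: "(\<tau> (\<sigma> i), compose (carrier (obj X i)) (k (\<sigma> i)) (g i)) \<in> hom_germ (obj X i) X i (ban_id (obj X i))"
        by (simp add: hg[OF i])
      have "ban_id (obj X i) \<in> ban_hom (obj X i) (obj X i)"
        using X.trans_hom[OF i i X.le_refl[OF i]] by (simp add: X.trans_id[OF i])
      from X.hom_germ_eqI[OF i this mem] show ?thesis .
    qed
    then show ?thesis
      unfolding ind_comp_level_mor[OF X Y X \<sigma> g \<tau>(1) k v, simplified] ind_id_def
      by (auto simp: level_mor_def intro!: restrict_ext)
  qed
  moreover have "ind_comp Y Y ?u ?v = ind_id Y"
  proof -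
    have "hom_germ (obj Y j) Y (\<sigma> (\<tau> j)) (compose (carrier (obj Y j)) (g (\<tau> j)) (k j)) =
      hom_germ (obj Y j) Y j (ban_id (obj Y j))" if j: "j \<in> idx Y" for j
    proof -
      note t = Y.trans_hom[OF j \<sigma>[OF \<tau>(1)[OF j]] \<tau>(2)[OF j]]
      have "compose (carrier (obj Y j)) (g (\<tau> j)) (k j) = trans Y j (\<sigma> (\<tau> j))"
        unfolding k_def ban_hom_compose_assoc[OF t, symmetric] gh[OF \<tau>(1)[OF j]] ban_hom_compose_id[OF t] ..
      also have "\<dots> = compose (carrier (obj Y j)) (trans Y j (\<sigma> (\<tau> j))) (ban_id (obj Y j))"
        by (simp add: ban_hom_compose_id[OF t])
      finally show ?thesis
        using Y.hom_germ_trans[OF j \<sigma>[OF \<tau>(1)[OF j]] \<tau>(2)[OF j] Y.obj_vec_space[OF j]]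
          Y.trans_hom[OF j j Y.le_refl[OF j]] by (simp add: Y.trans_id[OF j])
    qed
    then show ?thesis
      unfolding ind_comp_level_mor[OF Y X Y \<tau>(1) k \<sigma> g u, simplified] ind_id_def
      by (auto simp: level_mor_def intro!: restrict_ext)
  qed
  ultimately show ?thesis
    unfolding ind_iso_def using u v by blast
qed

section \<open>Completions of seminormed spaces\<close>

lemma seminormed_space_vec_space: "seminormed_space X \<Longrightarrow> vec_space X"
  by (simp add: seminormed_space_def)

locale seminormed_vec_space = fixes X :: "'a seminormed" (structure)
  assumes seminormed: "seminormed_space X"
begin

sublocale complex_space X
  by (rule complex_space.intro[OF seminormed_space_vec_space[OF seminormed]])

abbreviation norm_X ("\<parallel>_\<parallel>") where "norm_X \<equiv> snorm X"

lemma norm_nonneg [simp]: "x \<in> carrier X \<Longrightarrow> 0 \<le> \<parallel>x\<parallel>"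
  and norm_triangle: "x \<in> carrier X \<Longrightarrow> y \<in> carrier X \<Longrightarrow> \<parallel>x \<oplus> y\<parallel> \<le> \<parallel>x\<parallel> + \<parallel>y\<parallel>"
  and norm_smult [simp]: "x \<in> carrier X \<Longrightarrow> \<parallel>c \<odot> x\<parallel> = cmod c * \<parallel>x\<parallel>"
  using seminormed by (auto simp: seminormed_space_def)

lemma norm_zero [simp]: "\<parallel>\<zero>\<parallel> = 0"
  using norm_smult[of \<zero> 0] by simp

lemma norm_minus_commute: "x \<in> carrier X \<Longrightarrow> y \<in> carrier X \<Longrightarrow> \<parallel>x \<ominus> y\<parallel> = \<parallel>y \<ominus> x\<parallel>"
  using norm_smult[of "y \<ominus> x" "-1"] by (simp add: smult_uminus_one minus_minus_eq)

lemma norm_triangle_minus: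
  assumes "x \<in> carrier X" "y \<in> carrier X" "z \<in> carrier X"
  shows "\<parallel>x \<ominus> z\<parallel> \<le> \<parallel>x \<ominus> y\<parallel> + \<parallel>y \<ominus> z\<parallel>"
  using norm_triangle[of "x \<ominus> y" "y \<ominus> z"] assms by (simp add: minus_add_minus)

lemma norm_diff_le: "x \<in> carrier X \<Longrightarrow> y \<in> carrier X \<Longrightarrow> \<bar>\<parallel>x\<parallel> - \<parallel>y\<parallel>\<bar> \<le> \<parallel>x \<ominus> y\<parallel>"
  using norm_triangle_minus[of x y \<zero>] norm_triangle_minus[of y x \<zero>] norm_minus_commute[of x y] by auto

lemma cauchy_seqD: "cauchy_seq X s \<Longrightarrow> s k \<in> carrier X"
  by (simp add: cauchy_seq_def)

lemma cauchy_seq_add: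
  assumes "cauchy_seq X s" "cauchy_seq X t"
  shows "cauchy_seq X (\<lambda>k. s k \<oplus> t k)"
proof -
  note cl = cauchy_seqD[OF assms(1)] cauchy_seqD[OF assms(2)]
  have "\<exists>N. \<forall>k\<ge>N. \<forall>l\<ge>N. \<parallel>(s k \<oplus> t k) \<ominus> (s l \<oplus> t l)\<parallel> < e" if e: "e > 0" for e
  proof -
    obtain M N where M: "\<And>k l. k \<ge> M \<Longrightarrow> l \<ge> M \<Longrightarrow> \<parallel>s k \<ominus> s l\<parallel> < e / 2"
      and N: "\<And>k l. k \<ge> N \<Longrightarrow> l \<ge> N \<Longrightarrow> \<parallel>t k \<ominus> t l\<parallel> < e / 2"
      using assms e unfolding cauchy_seq_def by (meson half_gt_zero)
    have "\<parallel>(s k \<oplus> t k) \<ominus> (s l \<oplus> t l)\<parallel> < e" if "k \<ge> max M N" "l \<ge> max M N" for k l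
      using norm_triangle[of "s k \<ominus> s l" "t k \<ominus> t l"] M[of k l] N[of k l] that cl
      by (simp add: add_minus_add)
    then show ?thesis by blast
  qed
  then show ?thesis
    using cl by (auto simp: cauchy_seq_def)
qed

lemma cauchy_seq_smult:
  assumes "cauchy_seq X s"
  shows "cauchy_seq X (\<lambda>k. c \<odot> s k)"
proof -
  note cl = cauchy_seqD[OF assms]
  have "\<exists>N. \<forall>k\<ge>N. \<forall>l\<ge>N. \<parallel>c \<odot> s k \<ominus> c \<odot> s l\<parallel> < e" if e: "e > 0" for e
  proof -
    obtain N where N: "\<And>k l. k \<ge> N \<Longrightarrow> l \<ge> N \<Longrightarrow> \<parallel>s k \<ominus> s l\<parallel> < e / (cmod c + 1)"
      using assms e unfolding cauchy_seq_def by (metis divide_pos_pos norm_ge_zero add_nonneg_pos zero_less_one)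
    have "\<parallel>c \<odot> s k \<ominus> c \<odot> s l\<parallel> < e" if "k \<ge> N" "l \<ge> N" for k l
    proof -
      have "\<parallel>c \<odot> s k \<ominus> c \<odot> s l\<parallel> = cmod c * \<parallel>s k \<ominus> s l\<parallel>"
        using cl by (simp flip: smult_minus_right)
      also have "\<dots> \<le> (cmod c + 1) * \<parallel>s k \<ominus> s l\<parallel>"
        using cl by (intro mult_right_mono) auto
      also have "\<dots> < e"
        using N[OF that] add_nonneg_pos[OF norm_ge_zero zero_less_one, of c]
        by (simp only: pos_less_divide_eq mult.commute)
      finally show ?thesis .
    qed
    then show ?thesis by blast
  qed
  then show ?thesis
    using cl by (auto simp: cauchy_seq_def)
qed

lemma cauchy_seq_zero: "cauchy_seq X (\<lambda>k. \<zero>)"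
  by (auto simp: cauchy_seq_def)

lemma norm_diff_null_le:
  assumes "\<And>k. f k \<in> carrier X" "\<And>k. g k \<in> carrier X" "(\<lambda>k. b k) \<longlonglongrightarrow> 0" "\<And>k. \<parallel>f k \<ominus> g k\<parallel> \<le> b k"
  shows "(\<lambda>k. \<parallel>f k \<ominus> g k\<parallel>) \<longlonglongrightarrow> 0"
  by (rule tendsto_sandwich[of "\<lambda>_. 0" _ _ b]) (use assms in auto)

lemma null_diff_sym:
  assumes "cauchy_seq X s" "cauchy_seq X t" "(\<lambda>k. \<parallel>s k \<ominus> t k\<parallel>) \<longlonglongrightarrow> 0"
  shows "(\<lambda>k. \<parallel>t k \<ominus> s k\<parallel>) \<longlonglongrightarrow> 0"
  using assms cauchy_seqD by (subst norm_minus_commute) auto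

lemma null_diff_trans:
  assumes "cauchy_seq X s" "cauchy_seq X t" "cauchy_seq X r"
    and "(\<lambda>k. \<parallel>s k \<ominus> t k\<parallel>) \<longlonglongrightarrow> 0" "(\<lambda>k. \<parallel>t k \<ominus> r k\<parallel>) \<longlonglongrightarrow> 0"
  shows "(\<lambda>k. \<parallel>s k \<ominus> r k\<parallel>) \<longlonglongrightarrow> 0"
proof (rule norm_diff_null_le)
  show "(\<lambda>k. \<parallel>s k \<ominus> t k\<parallel> + \<parallel>t k \<ominus> r k\<parallel>) \<longlonglongrightarrow> 0"
    using tendsto_add[OF assms(4,5)] by simp
qed (use assms cauchy_seqD norm_triangle_minus in auto)

text \<open>
  Equivalence of Cauchy sequences modulo null sequences, on which all operations of the completion
  are well defined.
\<close>

lemma compl_class_eq_iff: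
  assumes "cauchy_seq X s" "cauchy_seq X t"
  shows "compl_class X s = compl_class X t \<longleftrightarrow> (\<lambda>k. \<parallel>s k \<ominus> t k\<parallel>) \<longlonglongrightarrow> 0"
proof
  assume "compl_class X s = compl_class X t"
  moreover have "t \<in> compl_class X t"
    using assms cauchy_seqD by (simp add: compl_class_def)
  ultimately show "(\<lambda>k. \<parallel>s k \<ominus> t k\<parallel>) \<longlonglongrightarrow> 0"
    by (auto simp: compl_class_def)
next
  assume "(\<lambda>k. \<parallel>s k \<ominus> t k\<parallel>) \<longlonglongrightarrow> 0"
  then show "compl_class X s = compl_class X t"
    unfolding compl_class_def using assms null_diff_trans null_diff_sym by (intro Collect_cong) meson
qed

lemma compl_rep_class:
  assumes "cauchy_seq X s"
  shows "cauchy_seq X (compl_rep (compl_class X s))"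
    and "compl_class X (compl_rep (compl_class X s)) = compl_class X s"
proof -
  have "s \<in> compl_class X s"
    using assms cauchy_seqD by (simp add: compl_class_def)
  then have "compl_rep (compl_class X s) \<in> compl_class X s"
    unfolding compl_rep_def by (rule someI[of "\<lambda>t. t \<in> compl_class X s"])
  then show c: "cauchy_seq X (compl_rep (compl_class X s))"
    and "compl_class X (compl_rep (compl_class X s)) = compl_class X s"
    using compl_class_eq_iff[OF assms] by (auto simp: compl_class_def)
qed

lemma completion_carrierE:
  assumes "A \<in> carrier (completion X)"
  obtains s where "cauchy_seq X s" "A = compl_class X s"
  using assms by (auto simp: completion_def)

lemma compl_class_carrier [simp, intro]: "cauchy_seq X s \<Longrightarrow> compl_class X s \<in> carrier (completion X)"
  by (auto simp: completion_def)

lemma completion_add: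
  assumes s: "cauchy_seq X s" and t: "cauchy_seq X t"
  shows "compl_class X s \<oplus>\<^bsub>completion X\<^esub> compl_class X t = compl_class X (\<lambda>k. s k \<oplus> t k)"
proof -
  let ?s = "compl_rep (compl_class X s)" and ?t = "compl_rep (compl_class X t)"
  note s' = compl_rep_class[OF s] and t' = compl_rep_class[OF t]
  note cl = cauchy_seqD[OF s] cauchy_seqD[OF t] cauchy_seqD[OF s'(1)] cauchy_seqD[OF t'(1)]
  have "(\<lambda>k. \<parallel>(?s k \<oplus> ?t k) \<ominus> (s k \<oplus> t k)\<parallel>) \<longlonglongrightarrow> 0"
  proof (rule norm_diff_null_le)
    show "(\<lambda>k. \<parallel>?s k \<ominus> s k\<parallel> + \<parallel>?t k \<ominus> t k\<parallel>) \<longlonglongrightarrow> 0"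
      using tendsto_add[of _ 0 sequentially _ 0] s'(2) t'(2) compl_class_eq_iff s t s'(1) t'(1) by fastforce
  qed (use cl norm_triangle in \<open>auto simp: add_minus_add\<close>)
  then show ?thesis
    using compl_class_eq_iff[OF cauchy_seq_add[OF s'(1) t'(1)] cauchy_seq_add[OF s t]]
    by (simp add: completion_def)
qed

lemma completion_smult:
  assumes s: "cauchy_seq X s"
  shows "c \<odot>\<^bsub>completion X\<^esub> compl_class X s = compl_class X (\<lambda>k. c \<odot> s k)"
proof -
  let ?s = "compl_rep (compl_class X s)"
  note s' = compl_rep_class[OF s]
  note cl = cauchy_seqD[OF s] cauchy_seqD[OF s'(1)]
  have "(\<lambda>k. \<parallel>?s k \<ominus> s k\<parallel>) \<longlonglongrightarrow> 0"
    using s'(2) compl_class_eq_iff s s'(1) by blast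
  then have "(\<lambda>k. cmod c * \<parallel>?s k \<ominus> s k\<parallel>) \<longlonglongrightarrow> 0"
    by (rule tendsto_mult_right_zero)
  then have "(\<lambda>k. \<parallel>c \<odot> ?s k \<ominus> c \<odot> s k\<parallel>) \<longlonglongrightarrow> 0"
    using cl by (simp flip: smult_minus_right)
  then show ?thesis
    using compl_class_eq_iff[OF cauchy_seq_smult[OF s'(1)] cauchy_seq_smult[OF s]]
    by (simp add: completion_def)
qed

lemma completion_zero: "\<zero>\<^bsub>completion X\<^esub> = compl_class X (\<lambda>k. \<zero>)"
  by (simp add: completion_def)

lemma norm_cauchy_convergent:
  assumes "cauchy_seq X s"
  shows "convergent (\<lambda>k. \<parallel>s k\<parallel>)"
proof -
  have "\<exists>N. \<forall>k\<ge>N. \<forall>l\<ge>N. norm (\<parallel>s k\<parallel> - \<parallel>s l\<parallel>) < e" if e: "e > 0" for e :: real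
  proof -
    obtain N where "\<forall>k\<ge>N. \<forall>l\<ge>N. \<parallel>s k \<ominus> s l\<parallel> < e"
      using assms e unfolding cauchy_seq_def by blast
    then show ?thesis
      using norm_diff_le[OF cauchy_seqD[OF assms] cauchy_seqD[OF assms]]
      unfolding real_norm_def by (meson le_less_trans)
  qed
  then show ?thesis
    by (intro Cauchy_convergent CauchyI) blast
qed

lemma completion_norm:
  assumes s: "cauchy_seq X s"
  shows "(\<lambda>k. \<parallel>s k\<parallel>) \<longlonglongrightarrow> snorm (completion X) (compl_class X s)"
proof -
  let ?s = "compl_rep (compl_class X s)"
  note s' = compl_rep_class[OF s]
  note cl = cauchy_seqD[OF s] cauchy_seqD[OF s'(1)]
  have "(\<lambda>k. \<parallel>?s k \<ominus> s k\<parallel>) \<longlonglongrightarrow> 0"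
    using s'(2) compl_class_eq_iff s s'(1) by blast
  then have "(\<lambda>k. \<parallel>s k \<ominus> ?s k\<parallel>) \<longlonglongrightarrow> 0"
    using null_diff_sym s s' by blast
  then have "(\<lambda>k. \<parallel>s k\<parallel> - \<parallel>?s k\<parallel>) \<longlonglongrightarrow> 0"
    by (rule Lim_null_comparison[rotated]) (simp add: norm_diff_le cl)
  moreover have "(\<lambda>k. \<parallel>?s k\<parallel>) \<longlonglongrightarrow> lim (\<lambda>k. \<parallel>?s k\<parallel>)"
    using norm_cauchy_convergent[OF s'(1)] by (simp add: convergent_LIMSEQ_iff)
  ultimately have "(\<lambda>k. (\<parallel>s k\<parallel> - \<parallel>?s k\<parallel>) + \<parallel>?s k\<parallel>) \<longlonglongrightarrow> 0 + lim (\<lambda>k. \<parallel>?s k\<parallel>)"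
    by (rule tendsto_add)
  then show ?thesis
    by (simp add: completion_def)
qed

lemma vec_space_completion: "vec_space (completion X)"
proof (rule vec_spaceI)
  fix A B C assume A: "A \<in> carrier (completion X)" and B: "B \<in> carrier (completion X)"
    and C: "C \<in> carrier (completion X)"
  then obtain s t r where s: "cauchy_seq X s" "A = compl_class X s" and t: "cauchy_seq X t" "B = compl_class X t"
    and r: "cauchy_seq X r" "C = compl_class X r"
    by (metis completion_carrierE)
  show "(A \<oplus>\<^bsub>completion X\<^esub> B) \<oplus>\<^bsub>completion X\<^esub> C = A \<oplus>\<^bsub>completion X\<^esub> (B \<oplus>\<^bsub>completion X\<^esub> C)"
    using s t r by (simp add: completion_add cauchy_seq_add cauchy_seqD a_assoc)
next
  fix A B c assume A: "A \<in> carrier (completion X)" and B: "B \<in> carrier (completion X)"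
  then obtain s t where s: "cauchy_seq X s" "A = compl_class X s" and t: "cauchy_seq X t" "B = compl_class X t"
    by (metis completion_carrierE)
  show "A \<oplus>\<^bsub>completion X\<^esub> B \<in> carrier (completion X)"
    using s t by (simp add: completion_add cauchy_seq_add)
  show "A \<oplus>\<^bsub>completion X\<^esub> B = B \<oplus>\<^bsub>completion X\<^esub> A"
    using s t by (simp add: completion_add cauchy_seqD a_comm)
  show "c \<odot>\<^bsub>completion X\<^esub> (A \<oplus>\<^bsub>completion X\<^esub> B) = c \<odot>\<^bsub>completion X\<^esub> A \<oplus>\<^bsub>completion X\<^esub> c \<odot>\<^bsub>completion X\<^esub> B"
    using s t by (simp add: completion_add completion_smult cauchy_seq_add cauchy_seq_smult cauchy_seqD smult_add_right)
next
  fix A a b assume A: "A \<in> carrier (completion X)"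
  then obtain s where s: "cauchy_seq X s" "A = compl_class X s"
    by (metis completion_carrierE)
  note simps = completion_add completion_smult completion_zero cauchy_seq_zero cauchy_seq_smult cauchy_seqD
  show "a \<odot>\<^bsub>completion X\<^esub> A \<in> carrier (completion X)"
    using s by (simp add: simps)
  show "\<zero>\<^bsub>completion X\<^esub> \<oplus>\<^bsub>completion X\<^esub> A = A"
    using s by (simp add: simps)
  show "0 \<odot>\<^bsub>completion X\<^esub> A = \<zero>\<^bsub>completion X\<^esub>"
    using s by (simp add: simps)
  show "(a + b) \<odot>\<^bsub>completion X\<^esub> A = a \<odot>\<^bsub>completion X\<^esub> A \<oplus>\<^bsub>completion X\<^esub> b \<odot>\<^bsub>completion X\<^esub> A"
    using s by (simp add: simps smult_add_left)
  show "(a * b) \<odot>\<^bsub>completion X\<^esub> A = a \<odot>\<^bsub>completion X\<^esub> (b \<odot>\<^bsub>completion X\<^esub> A)"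
    using s by (simp add: simps smult_smult)
  show "1 \<odot>\<^bsub>completion X\<^esub> A = A"
    using s by (simp add: simps)
qed (simp add: completion_zero cauchy_seq_zero compl_class_carrier)

end

text \<open>
  The maps between spanned spaces that occur in the functor \<open>IB\<close> carry unit ball into unit ball, so
  they do not increase the seminorm. Restricting to this case spares all bookkeeping of norm bounds.
\<close>

definition short_map :: "'a seminormed \<Rightarrow> 'b seminormed \<Rightarrow> ('a \<Rightarrow> 'b) \<Rightarrow> bool" where
  "short_map X Y h \<longleftrightarrow> seminormed_space X \<and> seminormed_space Y \<and> linear_map X Y h \<and>
     (\<forall>x\<in>carrier X. snorm Y (h x) \<le> snorm X x)"

locale short_linear =
  fixes X :: "'a seminormed" and Y :: "'b seminormed" and h :: "'a \<Rightarrow> 'b"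
  assumes short: "short_map X Y h"
begin

sublocale X: seminormed_vec_space X
  using short by (intro seminormed_vec_space.intro) (simp add: short_map_def)

sublocale Y: seminormed_vec_space Y
  using short by (intro seminormed_vec_space.intro) (simp add: short_map_def)

sublocale complex_linear X Y h
  using short by (intro complex_linear.intro complex_linear_axioms.intro X.complex_space_axioms Y.complex_space_axioms) (simp add: short_map_def)

lemma h_norm: "x \<in> carrier X \<Longrightarrow> snorm Y (h x) \<le> snorm X x"
  using short by (simp add: short_map_def)

lemma cauchy_seq_image:
  assumes "cauchy_seq X s"
  shows "cauchy_seq Y (\<lambda>k. h (s k))"
proof -
  note cl = X.cauchy_seqD[OF assms]
  have "\<exists>N. \<forall>k\<ge>N. \<forall>l\<ge>N. snorm Y (h (s k) \<ominus>\<^bsub>Y\<^esub> h (s l)) < e" if e: "e > 0" for e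
  proof -
    obtain N where N: "\<forall>k\<ge>N. \<forall>l\<ge>N. snorm X (s k \<ominus>\<^bsub>X\<^esub> s l) < e"
      using assms e unfolding cauchy_seq_def by blast
    have "snorm Y (h (s k) \<ominus>\<^bsub>Y\<^esub> h (s l)) < e" if "k \<ge> N" "l \<ge> N" for k l
      using h_norm[of "s k \<ominus>\<^bsub>X\<^esub> s l"] N that cl by fastforce
    then show ?thesis by blast
  qed
  then show ?thesis
    using cl by (auto simp: cauchy_seq_def)
qed

text \<open>
  The map on completions may be computed from any Cauchy sequence representing a class, not only from
  the chosen one. Functoriality then becomes a computation with sequences.
\<close>

lemma completion_map_class:
  assumes s: "cauchy_seq X s"
  shows "completion_map X Y h (compl_class X s) = compl_class Y (\<lambda>k. h (s k))"
proof -
  let ?s = "compl_rep (compl_class X s)"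
  note s' = X.compl_rep_class[OF s]
  note cl = X.cauchy_seqD[OF s] X.cauchy_seqD[OF s'(1)]
  have "(\<lambda>k. snorm X (?s k \<ominus>\<^bsub>X\<^esub> s k)) \<longlonglongrightarrow> 0"
    using s'(2) X.compl_class_eq_iff s s'(1) by blast
  then have "(\<lambda>k. snorm Y (h (?s k) \<ominus>\<^bsub>Y\<^esub> h (s k))) \<longlonglongrightarrow> 0"
  proof (rule Y.norm_diff_null_le[rotated 2])
    show "snorm Y (h (?s k) \<ominus>\<^bsub>Y\<^esub> h (s k)) \<le> snorm X (?s k \<ominus>\<^bsub>X\<^esub> s k)" for k
      using h_norm[of "?s k \<ominus>\<^bsub>X\<^esub> s k"] cl by simp
  qed (use cl in auto)
  then show ?thesis
    using Y.compl_class_eq_iff[OF cauchy_seq_image[OF s'(1)] cauchy_seq_image[OF s]] s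
    by (simp add: completion_map_def X.compl_class_carrier)
qed

lemma completion_map_in_ban_hom: "completion_map X Y h \<in> ban_hom (completion X) (completion Y)"
proof -
  let ?h = "completion_map X Y h"
  have lin: "linear_map (completion X) (completion Y) ?h"
    unfolding linear_map_def
  proof (intro conjI ballI allI)
    show "?h \<in> carrier (completion X) \<rightarrow> carrier (completion Y)"
      by (auto elim!: X.completion_carrierE simp: completion_map_class cauchy_seq_image)
  next
    fix A B c assume "A \<in> carrier (completion X)" "B \<in> carrier (completion X)"
    then show "?h (A \<oplus>\<^bsub>completion X\<^esub> B) = ?h A \<oplus>\<^bsub>completion Y\<^esub> ?h B"
      by (auto elim!: X.completion_carrierE simp: completion_map_class cauchy_seq_image X.completion_add
          Y.completion_add X.cauchy_seq_add X.cauchy_seqD)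
  next
    fix A c assume "A \<in> carrier (completion X)"
    then show "?h (c \<odot>\<^bsub>completion X\<^esub> A) = c \<odot>\<^bsub>completion Y\<^esub> ?h A"
      by (auto elim!: X.completion_carrierE simp: completion_map_class cauchy_seq_image X.completion_smult
          Y.completion_smult X.cauchy_seq_smult X.cauchy_seqD)
  qed
  interpret L: complex_linear "completion X" "completion Y" ?h
    by (intro complex_linear.intro complex_space.intro complex_linear_axioms.intro lin
        X.vec_space_completion Y.vec_space_completion)
  have norm: "snorm (completion Y) (?h A) \<le> snorm (completion X) A" if A: "A \<in> carrier (completion X)" for A
  proof -
    obtain s where s: "cauchy_seq X s" "A = compl_class X s"
      using X.completion_carrierE[OF A] .
    have "(\<lambda>k. snorm Y (h (s k))) \<longlonglongrightarrow> snorm (completion Y) (?h A)"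
      using Y.completion_norm[OF cauchy_seq_image[OF s(1)]] by (simp add: s completion_map_class)
    then show ?thesis
      using X.completion_norm[OF s(1)] X.cauchy_seqD[OF s(1)] h_norm s(2) by (blast intro: LIMSEQ_le)
  qed
  have "\<exists>d>0. \<forall>B\<in>carrier (completion X). snorm (completion X) (B \<ominus>\<^bsub>completion X\<^esub> A) < d \<longrightarrow>
      snorm (completion Y) (?h B \<ominus>\<^bsub>completion Y\<^esub> ?h A) < e"
    if "A \<in> carrier (completion X)" "e > 0" for A e
  proof (intro exI conjI ballI impI)
    fix B assume B: "B \<in> carrier (completion X)" "snorm (completion X) (B \<ominus>\<^bsub>completion X\<^esub> A) < e"
    then show "snorm (completion Y) (?h B \<ominus>\<^bsub>completion Y\<^esub> ?h A) < e"
      using norm[of "B \<ominus>\<^bsub>completion X\<^esub> A"] that by simp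
  qed (rule that)
  moreover have "?h \<in> extensional (carrier (completion X))"
    by (simp add: completion_map_def)
  ultimately show ?thesis
    using lin by (auto simp: ban_hom_def)
qed

end

lemma short_map_compose:
  assumes "short_map X Y h" "short_map Y Z k"
  shows "short_map X Z (k \<circ> h)"
  using assms unfolding short_map_def linear_map_def by (auto simp: Pi_iff) (meson order_trans)

lemma completion_map_compose:
  assumes h: "short_map X Y h" and k: "short_map Y Z k"
  shows "compose (carrier (completion X)) (completion_map Y Z k) (completion_map X Y h) =
    completion_map X Z (k \<circ> h)"
proof -
  interpret h: short_linear X Y h using h by (rule short_linear.intro)
  interpret k: short_linear Y Z k using k by (rule short_linear.intro)
  interpret kh: short_linear X Z "k \<circ> h" using short_map_compose[OF h k] by (rule short_linear.intro)
  show ?thesis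
  proof (rule ext)
    fix A
    show "compose (carrier (completion X)) (completion_map Y Z k) (completion_map X Y h) A =
      completion_map X Z (k \<circ> h) A"
    proof (cases "A \<in> carrier (completion X)")
      case True
      then show ?thesis
        by (auto elim!: h.X.completion_carrierE
            simp: compose_def h.completion_map_class k.completion_map_class kh.completion_map_class h.cauchy_seq_image)
    qed (simp add: compose_def completion_map_def)
  qed
qed

lemma completion_map_cong:
  assumes "seminormed_space X" and eq: "\<And>x. x \<in> carrier X \<Longrightarrow> h x = k x"
  shows "completion_map X Y h = completion_map X Y k"
proof -
  interpret seminormed_vec_space X using assms(1) by (rule seminormed_vec_space.intro)
  show ?thesis
    unfolding completion_map_def
  proof (rule restrict_ext)
    fix A assume "A \<in> carrier (completion X)"
    then have "cauchy_seq X (compl_rep A)"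
      using compl_rep_class(1) by (auto elim: completion_carrierE)
    then show "compl_class Y (\<lambda>k. h (compl_rep A k)) = compl_class Y (\<lambda>n. k (compl_rep A n))"
      using eq cauchy_seqD by simp
  qed
qed

lemma completion_map_id:
  assumes "seminormed_space X" and eq: "\<And>x. x \<in> carrier X \<Longrightarrow> h x = x"
  shows "completion_map X X h = ban_id (completion X)"
proof -
  interpret seminormed_vec_space X using assms(1) by (rule seminormed_vec_space.intro)
  show ?thesis
    unfolding completion_map_def ban_id_def
  proof (rule restrict_ext)
    fix A assume "A \<in> carrier (completion X)"
    then have "cauchy_seq X (compl_rep A)" "compl_class X (compl_rep A) = A"
      using compl_rep_class by (auto elim!: completion_carrierE)
    then show "compl_class X (\<lambda>k. h (compl_rep A k)) = A"
      using eq cauchy_seqD by simp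
  qed
qed

section \<open>The space spanned by an absolutely convex set\<close>

locale disc =
  fixes E :: "'a tvs" (structure) and B :: "'a set"
  assumes vec: "vec_space E" and disc: "abs_convex_in E B"
begin

sublocale complex_space E
  by (rule complex_space.intro[OF vec])

lemma disc_carrier: "x \<in> B \<Longrightarrow> x \<in> carrier E"
  using disc by (auto simp: abs_convex_in_def)

lemma disc_comb: "x \<in> B \<Longrightarrow> y \<in> B \<Longrightarrow> cmod a + cmod b \<le> 1 \<Longrightarrow> a \<odot> x \<oplus> b \<odot> y \<in> B"
  using disc by (auto simp: abs_convex_in_def)

lemma disc_smult: "x \<in> B \<Longrightarrow> cmod a \<le> 1 \<Longrightarrow> a \<odot> x \<in> B"
  using disc_comb[of x x a 0] disc_carrier[of x] by simp

lemma disc_zero: "\<zero> \<in> B"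
  using disc disc_smult[of _ 0] disc_carrier by (fastforce simp: abs_convex_in_def)

lemma disc_add_scaled:
  assumes "x \<in> B" "y \<in> B" "0 < s" "0 < t"
  shows "\<exists>b\<in>B. complex_of_real s \<odot> x \<oplus> complex_of_real t \<odot> y = complex_of_real (s + t) \<odot> b"
proof
  show "complex_of_real (s / (s + t)) \<odot> x \<oplus> complex_of_real (t / (s + t)) \<odot> y \<in> B"
    using assms by (intro disc_comb) (auto simp: norm_divide simp flip: of_real_add add_divide_distrib)
  have "complex_of_real (s + t) * complex_of_real (s / (s + t)) = complex_of_real s"
    and "complex_of_real (s + t) * complex_of_real (t / (s + t)) = complex_of_real t"
    using assms unfolding of_real_mult[symmetric] by simp_all
  then show "complex_of_real s \<odot> x \<oplus> complex_of_real t \<odot> y =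
      complex_of_real (s + t) \<odot> (complex_of_real (s / (s + t)) \<odot> x \<oplus> complex_of_real (t / (s + t)) \<odot> y)"
    using assms disc_carrier by (simp only: smult_add_right smult_smult smult_cl)
qed

lemma disc_smult_scaled:
  assumes "x \<in> B" "0 < s"
  shows "\<exists>b\<in>B. c \<odot> (complex_of_real s \<odot> x) = complex_of_real (cmod c * s) \<odot> b"
proof
  show "sgn c \<odot> x \<in> B"
    using assms by (intro disc_smult) (auto simp: norm_sgn)
  have "c * complex_of_real s = complex_of_real (cmod c * s) * sgn c"
    by (cases "c = 0") (simp_all add: complex_sgn_def scaleR_conv_of_real field_simps)
  then show "c \<odot> (complex_of_real s \<odot> x) = complex_of_real (cmod c * s) \<odot> (sgn c \<odot> x)"
    using assms disc_carrier by (simp only: smult_smult)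
qed

text \<open>
  An absolutely convex set absorbs linear combinations up to a scalar, so its positive multiples already
  form a subspace.
\<close>

lemma linear_hull_eq: "linear_hull E B = {complex_of_real t \<odot> b | t b. 0 < t \<and> b \<in> B}"
  (is "_ = ?H")
proof (rule subset_antisym)
  have smult: "c \<odot> x \<in> ?H" if "x \<in> ?H" for c x
  proof -
    obtain t b where t: "x = complex_of_real t \<odot> b" "0 < t" "b \<in> B"
      using \<open>x \<in> ?H\<close> by blast
    show ?thesis
    proof (cases "c = 0")
      case True
      then have "c \<odot> x = complex_of_real 1 \<odot> \<zero>"
        using t disc_carrier by simp
      then show ?thesis
        using disc_zero zero_less_one by blast
    next
      case False
      then have "0 < cmod c * t"
        using t by simp
      then show ?thesis
        using disc_smult_scaled[OF t(3,2), of c] unfolding t(1) by blast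
    qed
  qed
  have "submodule ?H complex_ring E"
  proof (rule submoduleI)
    show "x \<oplus> y \<in> ?H" if "x \<in> ?H" "y \<in> ?H" for x y
    proof -
      obtain s b where s: "x = complex_of_real s \<odot> b" "0 < s" "b \<in> B"
        using \<open>x \<in> ?H\<close> by blast
      obtain t c where t: "y = complex_of_real t \<odot> c" "0 < t" "c \<in> B"
        using \<open>y \<in> ?H\<close> by blast
      have "0 < s + t" using s t by simp
      then show ?thesis
        using disc_add_scaled[OF s(3) t(3) s(2) t(2)] unfolding s t by blast
    qed
    have "complex_of_real 1 \<odot> \<zero> \<in> ?H"
      using disc_zero zero_less_one by blast
    then show "\<zero> \<in> ?H"
      by simp
    show "?H \<subseteq> carrier E"
      using disc_carrier by auto
    show "\<ominus> x \<in> ?H" if "x \<in> ?H" for x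
    proof -
      have "x \<in> carrier E"
        using that disc_carrier by auto
      then show ?thesis
        using smult[OF that, of "-1"] by (simp only: smult_uminus_one)
    qed
    show "a \<odot> x \<in> ?H" if "x \<in> ?H" for a x
      using smult[OF that] .
  qed
  moreover have "B \<subseteq> ?H"
  proof
    fix b assume "b \<in> B"
    then have "b = complex_of_real 1 \<odot> b"
      using disc_carrier by simp
    then show "b \<in> ?H"
      using \<open>b \<in> B\<close> zero_less_one by blast
  qed
  ultimately show "linear_hull E B \<subseteq> ?H"
    unfolding linear_hull_def by blast
next
  show "?H \<subseteq> linear_hull E B"
  proof (unfold linear_hull_def, rule Inter_greatest, rule subsetI)
    fix H x assume "H \<in> {H. submodule H complex_ring E \<and> B \<subseteq> H}" and "x \<in> ?H"
    then show "x \<in> H"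
      using submoduleE(4)[of H] by (auto simp: complex_ring_def)
  qed
qed

lemma hullE:
  assumes "x \<in> linear_hull E B"
  obtains t b where "0 < t" "b \<in> B" "x = complex_of_real t \<odot> b"
  using assms unfolding linear_hull_eq by blast

lemma hullI: "0 < t \<Longrightarrow> b \<in> B \<Longrightarrow> complex_of_real t \<odot> b \<in> linear_hull E B"
  unfolding linear_hull_eq by blast

lemma hull_carrier: "x \<in> linear_hull E B \<Longrightarrow> x \<in> carrier E"
  unfolding linear_hull_eq using disc_carrier by auto

lemma disc_hull: "b \<in> B \<Longrightarrow> b \<in> linear_hull E B"
  using hullI[of 1 b] disc_carrier[of b] by simp

lemma hull_add: "x \<in> linear_hull E B \<Longrightarrow> y \<in> linear_hull E B \<Longrightarrow> x \<oplus> y \<in> linear_hull E B"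
  by (elim hullE) (metis add_pos_pos disc_add_scaled hullI)

lemma hull_smult: "x \<in> linear_hull E B \<Longrightarrow> c \<odot> x \<in> linear_hull E B"
proof (elim hullE)
  fix t b assume t: "0 < t" "b \<in> B" "x = complex_of_real t \<odot> b"
  show ?thesis
  proof (cases "c = 0")
    case True
    then show ?thesis
      using t disc_carrier disc_hull[OF disc_zero] by simp
  next
    case False
    then have "0 < cmod c * t"
      using t by simp
    then show ?thesis
      using disc_smult_scaled[OF t(2,1), of c] hullI unfolding t(3) by metis
  qed
qed

abbreviation gauge where "gauge \<equiv> minkowski_gauge E B"

lemma gauge_le: "0 < t \<Longrightarrow> b \<in> B \<Longrightarrow> gauge (complex_of_real t \<odot> b) \<le> t"
  unfolding minkowski_gauge_def by (intro cInf_lower bdd_belowI[of _ 0]) auto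

text \<open>
  The infimum that defines the gauge may not be attained, but every \<open>r\<close> above it is an admissible
  multiplier, since \<open>B\<close> is stable under shrinking.
\<close>

lemma gauge_lessE:
  assumes x: "x \<in> linear_hull E B" and r: "gauge x < r"
  obtains b where "b \<in> B" "x = complex_of_real r \<odot> b"
proof -
  let ?T = "{t. 0 < t \<and> (\<exists>b\<in>B. x = complex_of_real t \<odot> b)}"
  have "?T \<noteq> {}"
    using x by (rule hullE) blast
  then obtain t where "t \<in> ?T" "t < r"
    using r cInf_lessD[of ?T r] unfolding minkowski_gauge_def by blast
  then obtain b where t: "0 < t" "t < r" and b: "b \<in> B" "x = complex_of_real t \<odot> b"
    by blast
  have "complex_of_real (t / r) \<odot> b \<in> B"
    using t b by (intro disc_smult) (auto simp: norm_divide)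
  moreover have "complex_of_real r * complex_of_real (t / r) = complex_of_real t"
    using t by simp
  then have "x = complex_of_real r \<odot> (complex_of_real (t / r) \<odot> b)"
    using b disc_carrier by (simp only: smult_smult)
  ultimately show ?thesis
    by (rule that)
qed

lemma gauge_nonneg:
  assumes "x \<in> linear_hull E B"
  shows "0 \<le> gauge x"
proof -
  have "{t. 0 < t \<and> (\<exists>b\<in>B. x = complex_of_real t \<odot> b)} \<noteq> {}"
    using assms by (rule hullE) blast
  then show ?thesis
    unfolding minkowski_gauge_def by (rule cInf_greatest) auto
qed

lemma gauge_triangle:
  assumes x: "x \<in> linear_hull E B" and y: "y \<in> linear_hull E B"
  shows "gauge (x \<oplus> y) \<le> gauge x + gauge y"
proof (rule field_le_epsilon)
  fix e :: real assume "0 < e"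
  define s t where "s = gauge x + e / 2" and "t = gauge y + e / 2"
  have st: "0 < s" "0 < t"
    using gauge_nonneg x y \<open>0 < e\<close> by (auto simp: s_def t_def add_nonneg_pos)
  obtain b where b: "b \<in> B" "x = complex_of_real s \<odot> b"
    using gauge_lessE[OF x, of s] \<open>0 < e\<close> by (auto simp: s_def)
  obtain c where c: "c \<in> B" "y = complex_of_real t \<odot> c"
    using gauge_lessE[OF y, of t] \<open>0 < e\<close> by (auto simp: t_def)
  obtain d where "d \<in> B" "x \<oplus> y = complex_of_real (s + t) \<odot> d"
    using disc_add_scaled[OF b(1) c(1) st] b c by auto
  then have "gauge (x \<oplus> y) \<le> s + t"
    using gauge_le[of "s + t" d] st by simp
  then show "gauge (x \<oplus> y) \<le> gauge x + gauge y + e"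
    by (simp add: s_def t_def)
qed

lemma gauge_smult_le:
  assumes x: "x \<in> linear_hull E B" and c: "c \<noteq> 0"
  shows "gauge (c \<odot> x) \<le> cmod c * gauge x"
proof (rule dense_ge)
  fix r assume "cmod c * gauge x < r"
  then have less: "gauge x < r / cmod c"
    using c by (simp add: pos_less_divide_eq mult.commute)
  then obtain b where b: "b \<in> B" "x = complex_of_real (r / cmod c) \<odot> b"
    using gauge_lessE[OF x] by blast
  have pos: "0 < r / cmod c"
    using less gauge_nonneg[OF x] by linarith
  then have "0 < r"
    using c by (simp add: zero_less_divide_iff)
  obtain d where "d \<in> B" "c \<odot> x = complex_of_real (cmod c * (r / cmod c)) \<odot> d"
    using disc_smult_scaled[OF b(1) pos, of c] b(2) by auto
  then show "gauge (c \<odot> x) \<le> r"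
    using gauge_le[of r d] c \<open>0 < r\<close> by simp
qed

lemma gauge_zero: "gauge \<zero> = 0"
proof (rule antisym)
  show "gauge \<zero> \<le> 0"
    by (rule dense_ge) (use gauge_le[OF _ disc_zero] in simp)
qed (rule gauge_nonneg[OF disc_hull[OF disc_zero]])

lemma gauge_smult:
  assumes x: "x \<in> linear_hull E B"
  shows "gauge (c \<odot> x) = cmod c * gauge x"
proof (cases "c = 0")
  case False
  have "gauge (inverse c \<odot> (c \<odot> x)) \<le> cmod (inverse c) * gauge (c \<odot> x)"
    using False hull_smult[OF x] by (intro gauge_smult_le) auto
  then have "gauge x \<le> cmod (inverse c) * gauge (c \<odot> x)"
    using False hull_carrier[OF x] by simp
  then have "cmod c * gauge x \<le> gauge (c \<odot> x)"
    using False by (simp add: norm_divide field_simps)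
  then show ?thesis
    using gauge_smult_le[OF x False] by simp
qed (use gauge_zero hull_carrier[OF x] in simp)

lemma gauge_disc_le: "b \<in> B \<Longrightarrow> gauge b \<le> 1"
  using gauge_le[of 1 b] disc_carrier[of b] by simp

lemma seminormed_space_hull: "seminormed_space (hull_space E B)"
  unfolding seminormed_space_def
proof (intro conjI)
  show "vec_space (hull_space E B)"
    by (rule vec_spaceI)
      (auto simp: hull_space_def hull_add hull_smult disc_hull disc_zero hull_carrier a_ac
        smult_add_left smult_add_right smult_smult)
qed (auto simp: hull_space_def gauge_nonneg gauge_triangle gauge_smult)

sublocale hull: seminormed_vec_space "hull_space E B"
  by (rule seminormed_vec_space.intro[OF seminormed_space_hull])

lemma hull_space_simps [simp]:
  "carrier (hull_space E B) = linear_hull E B" "snorm (hull_space E B) = gauge"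
  "add (hull_space E B) = add E" "smult (hull_space E B) = smult E" "zero (hull_space E B) = zero E"
  by (simp_all add: hull_space_def)

lemma hull_minus:
  "x \<in> linear_hull E B \<Longrightarrow> y \<in> linear_hull E B \<Longrightarrow> x \<ominus>\<^bsub>hull_space E B\<^esub> y = x \<ominus> y"
  using hull.minus_eq_smult[of x y] minus_eq_smult[of x y] hull_carrier by simp

end

lemma short_map_hull:
  assumes B: "disc E B" and C: "disc F C" and h: "linear_map E F h" and hB: "h ` B \<subseteq> C"
  shows "short_map (hull_space E B) (hull_space F C) h"
proof -
  interpret B: disc E B by (rule B)
  interpret C: disc F C by (rule C)
  interpret complex_linear E F h
    by (intro complex_linear.intro complex_linear_axioms.intro B.complex_space_axioms C.complex_space_axioms h)
  have hull: "h x \<in> linear_hull F C" if "x \<in> linear_hull E B" for x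
    using that hB B.disc_carrier by (auto elim!: B.hullE intro!: C.hullI)
  have "C.gauge (h x) \<le> B.gauge x" if x: "x \<in> linear_hull E B" for x
  proof (rule dense_ge)
    fix t assume t: "B.gauge x < t"
    then obtain b where "b \<in> B" "x = complex_of_real t \<odot>\<^bsub>E\<^esub> b"
      using B.gauge_lessE[OF x] by blast
    moreover have "0 < t"
      using t B.gauge_nonneg[OF x] by linarith
    ultimately show "C.gauge (h x) \<le> t"
      using C.gauge_le[of t "h b"] hB B.disc_carrier by auto
  qed
  then show ?thesis
    using hull B.hull_carrier
    by (auto simp: short_map_def B.seminormed_space_hull C.seminormed_space_hull linear_map_def)
qed

lemma abs_convex_image:
  assumes B: "disc E B" and F: "vec_space F" and h: "linear_map E F h"
  shows "disc F (h ` B)"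
proof -
  interpret B: disc E B by (rule B)
  interpret complex_linear E F h
    by (intro complex_linear.intro complex_linear_axioms.intro complex_space.intro B.vec F h)
  have "abs_convex_in F (h ` B)"
    unfolding abs_convex_in_def
  proof (intro conjI ballI allI impI)
    fix x y a b assume "x \<in> h ` B" "y \<in> h ` B" and ab: "cmod a + cmod b \<le> 1"
    then obtain x' y' where "x' \<in> B" "x = h x'" "y' \<in> B" "y = h y'"
      by blast
    then have "a \<odot>\<^bsub>F\<^esub> x \<oplus>\<^bsub>F\<^esub> b \<odot>\<^bsub>F\<^esub> y = h (a \<odot>\<^bsub>E\<^esub> x' \<oplus>\<^bsub>E\<^esub> b \<odot>\<^bsub>E\<^esub> y')"
      and "a \<odot>\<^bsub>E\<^esub> x' \<oplus>\<^bsub>E\<^esub> b \<odot>\<^bsub>E\<^esub> y' \<in> B"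
      using B.disc_comb[OF _ _ ab, of x' y'] B.disc_carrier by auto
    then show "a \<odot>\<^bsub>F\<^esub> x \<oplus>\<^bsub>F\<^esub> b \<odot>\<^bsub>F\<^esub> y \<in> h ` B"
      by simp
  qed (use B.disc_carrier B.disc_zero in auto)
  then show ?thesis
    by (rule disc.intro[OF F])
qed

section \<open>Topological vector spaces\<close>

locale tvs =
  fixes E :: "'a tvs" (structure)
  assumes tvs: "top_vec_space E"
begin

sublocale complex_space E
  using tvs by (intro complex_space.intro) (simp add: top_vec_space_def)

lemma topspace_eq [simp]: "topspace (topol E) = carrier E"
  using tvs by (simp add: top_vec_space_def)

definition nbhd :: "'a set \<Rightarrow> bool" where
  "nbhd U \<longleftrightarrow> openin (topol E) U \<and> \<zero> \<in> U"

lemma nbhd_carrier: "nbhd U \<Longrightarrow> x \<in> U \<Longrightarrow> x \<in> carrier E"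
  using openin_subset[of "topol E" U] by (auto simp: nbhd_def)

lemma nbhd_zero: "nbhd U \<Longrightarrow> \<zero> \<in> U"
  by (simp add: nbhd_def)

lemma nbhd_Int: "nbhd U \<Longrightarrow> nbhd V \<Longrightarrow> nbhd (U \<inter> V)"
  by (auto simp: nbhd_def)

lemma continuous_add: "continuous_map (prod_topology (topol E) (topol E)) (topol E) (\<lambda>(x, y). x \<oplus> y)"
  using tvs by (simp add: top_vec_space_def)

lemma continuous_smult: "continuous_map (prod_topology euclidean (topol E)) (topol E) (\<lambda>(c, x). c \<odot> x)"
  using tvs by (simp add: top_vec_space_def)

lemma continuous_scale: "continuous_map (topol E) (topol E) (\<lambda>x. c \<odot> x)"
proof -
  have "continuous_map (topol E) (prod_topology euclidean (topol E)) (\<lambda>x. (c, x))"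
    by (simp add: continuous_map_paired)
  from continuous_map_compose[OF this continuous_smult] show ?thesis
    by (simp add: o_def)
qed

lemma continuous_affine:
  assumes "a \<in> carrier E"
  shows "continuous_map (topol E) (topol E) (\<lambda>x. c \<odot> x \<oplus> a)"
proof -
  have "continuous_map (topol E) (prod_topology (topol E) (topol E)) (\<lambda>x. (c \<odot> x, a))"
    using assms by (simp add: continuous_map_paired continuous_scale)
  from continuous_map_compose[OF this continuous_add] show ?thesis
    by (simp add: o_def)
qed

lemma continuous_minus:
  assumes "a \<in> carrier E"
  shows "continuous_map (topol E) (topol E) (\<lambda>x. c \<odot> (a \<ominus> x))"
proof (rule continuous_map_eq[OF continuous_affine])
  show "c \<odot> a \<in> carrier E" using assms by simp
  show "(-c) \<odot> x \<oplus> c \<odot> a = c \<odot> (a \<ominus> x)" if "x \<in> topspace (topol E)" for x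
    using that assms by (simp add: minus_eq_smult smult_add_right smult_smult a_comm)
qed

lemma openin_preimage_minus:
  assumes "a \<in> carrier E" "openin (topol E) U"
  shows "openin (topol E) {x \<in> carrier E. c \<odot> (a \<ominus> x) \<in> U}"
  using openin_continuous_map_preimage[OF continuous_minus[OF assms(1)] assms(2)] by simp

text \<open>
  Continuity of addition and subtraction at the origin, in the form used for all
  \<open>\<epsilon>/2\<close>-arguments below.
\<close>

lemma nbhd_sum_diff:
  assumes U: "nbhd U"
  obtains V where "nbhd V" "V \<subseteq> U" "\<And>x y. x \<in> V \<Longrightarrow> y \<in> V \<Longrightarrow> x \<oplus> y \<in> U"
    "\<And>x y. x \<in> V \<Longrightarrow> y \<in> V \<Longrightarrow> x \<ominus> y \<in> U"
proof -
  have "openin (prod_topology (topol E) (topol E))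
      {p \<in> topspace (prod_topology (topol E) (topol E)). (\<lambda>(x, y). x \<oplus> y) p \<in> U}"
    using U by (intro openin_continuous_map_preimage[OF continuous_add]) (simp add: nbhd_def)
  moreover have "(\<zero>, \<zero>) \<in> {p \<in> topspace (prod_topology (topol E) (topol E)). (\<lambda>(x, y). x \<oplus> y) p \<in> U}"
    using nbhd_zero[OF U] by simp
  ultimately obtain V1 V2 where V1: "nbhd V1" and V2: "nbhd V2"
    and sub: "V1 \<times> V2 \<subseteq> {p \<in> topspace (prod_topology (topol E) (topol E)). (\<lambda>(x, y). x \<oplus> y) p \<in> U}"
    unfolding openin_prod_topology_alt nbhd_def by meson
  have add: "x \<oplus> y \<in> U" if "x \<in> V1" "y \<in> V2" for x y
    using sub that by auto
  define V3 where "V3 = {x \<in> carrier E. 1 \<odot> (\<zero> \<ominus> x) \<in> V2}"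
  have V3: "nbhd V3"
    unfolding nbhd_def V3_def using openin_preimage_minus[of \<zero> V2 1] V2 by (auto simp: nbhd_def)
  show ?thesis
  proof
    show "nbhd (V1 \<inter> V2 \<inter> V3)"
      using V1 V2 V3 by (intro nbhd_Int)
    fix x y assume xy: "x \<in> V1 \<inter> V2 \<inter> V3" "y \<in> V1 \<inter> V2 \<inter> V3"
    then show "x \<oplus> y \<in> U"
      using add by simp
    have "1 \<odot> (\<zero> \<ominus> y) \<in> V2"
      using xy unfolding V3_def by blast
    then have "x \<oplus> 1 \<odot> (\<zero> \<ominus> y) \<in> U"
      using xy add by blast
    moreover have "x \<in> carrier E" "y \<in> carrier E"
      using xy by (auto simp: V3_def)
    ultimately show "x \<ominus> y \<in> U"
      by (simp add: a_minus_def)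
  next
    show "V1 \<inter> V2 \<inter> V3 \<subseteq> U"
    proof
      fix x assume x: "x \<in> V1 \<inter> V2 \<inter> V3"
      then have "x \<oplus> \<zero> \<in> U"
        using add nbhd_zero[OF V2] by blast
      then show "x \<in> U"
        using x by (simp add: V3_def)
    qed
  qed
qed

lemma nbhd_absorbing:
  assumes U: "nbhd U" and x: "x \<in> carrier E"
  shows "\<exists>k. inverse (of_nat (Suc k)) \<odot> x \<in> U"
proof -
  have "continuous_map euclidean (prod_topology euclidean (topol E)) (\<lambda>c. (c, x))"
    using x by (simp add: continuous_map_paired)
  from continuous_map_compose[OF this continuous_smult]
  have "continuous_map euclidean (topol E) (\<lambda>c. c \<odot> x)"
    by (simp add: o_def)
  then have "openin euclidean {c \<in> topspace euclidean. c \<odot> x \<in> U}"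
    using U by (intro openin_continuous_map_preimage) (auto simp: nbhd_def)
  then have "open {c. c \<odot> x \<in> U}"
    by simp
  moreover have "0 \<in> {c. c \<odot> x \<in> U}"
    using x nbhd_zero[OF U] by simp
  moreover have "(\<lambda>k. inverse (of_nat (Suc k)) :: complex) \<longlonglongrightarrow> 0"
    using tendsto_of_real[OF LIMSEQ_inverse_real_of_nat, where 'a = complex]
    by (simp only: of_real_inverse of_real_of_nat_eq of_real_0)
  ultimately have "eventually (\<lambda>k. inverse (of_nat (Suc k)) \<in> {c. c \<odot> x \<in> U}) sequentially"
    by (metis topological_tendstoD)
  then show ?thesis
    by (auto dest: eventually_happens)
qed

lemma limitin_minus:
  assumes l: "limitin (topol E) s l sequentially" and V: "nbhd V"
  shows "\<exists>N. \<forall>m\<ge>N. s m \<in> carrier E \<and> l \<ominus> s m \<in> V"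
proof -
  have lc: "l \<in> carrier E"
    using limitin_topspace[OF l] by simp
  have "openin (topol E) {x \<in> carrier E. 1 \<odot> (l \<ominus> x) \<in> V}"
    using V lc by (intro openin_preimage_minus) (auto simp: nbhd_def)
  moreover have "l \<in> {x \<in> carrier E. 1 \<odot> (l \<ominus> x) \<in> V}"
    using lc nbhd_zero[OF V] by simp
  ultimately have "eventually (\<lambda>m. s m \<in> {x \<in> carrier E. 1 \<odot> (l \<ominus> x) \<in> V}) sequentially"
    using l unfolding limitin_def by blast
  then show ?thesis
    using lc unfolding eventually_sequentially by (metis (mono_tags, lifting) mem_Collect_eq minus_closed smult_1)
qed

lemma Hausdorff_zero:
  assumes haus: "Hausdorff_space (topol E)" and x: "x \<in> carrier E" and all: "\<And>U. nbhd U \<Longrightarrow> x \<in> U"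
  shows "x = \<zero>"
proof (rule ccontr)
  assume "x \<noteq> \<zero>"
  then obtain U V where "openin (topol E) U" "openin (topol E) V" "x \<in> U" "\<zero> \<in> V" "disjnt U V"
    using haus x unfolding Hausdorff_space_def by (metis topspace_eq zero_closed)
  then show False
    using all[of V] by (auto simp: nbhd_def disjnt_def)
qed

text \<open>
  Completeness is stated with Cauchy filters; a Cauchy sequence is fed to it through the image of the
  filter of its tails.
\<close>

lemma complete_seq:
  assumes complete: "complete_tvs E" and s: "\<And>k. s k \<in> carrier E"
    and cauchy: "\<And>U. nbhd U \<Longrightarrow> \<exists>N. \<forall>k\<ge>N. \<forall>l\<ge>N. s k \<ominus> s l \<in> U"
  shows "\<exists>l. limitin (topol E) s l sequentially"
proof -
  have "cauchy_filter_in E (filtermap s sequentially)"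
    unfolding cauchy_filter_in_def
  proof (intro conjI allI impI)
    show "filtermap s sequentially \<noteq> bot"
      by (simp add: filtermap_bot_iff)
    show "eventually (\<lambda>x. x \<in> carrier E) (filtermap s sequentially)"
      using s by (simp add: eventually_filtermap)
    fix U assume "openin (topol E) U \<and> \<zero> \<in> U"
    then obtain N where N: "\<forall>k\<ge>N. \<forall>l\<ge>N. s k \<ominus> s l \<in> U"
      using cauchy unfolding nbhd_def by blast
    have "eventually (\<lambda>x. x \<in> s ` {N..}) (filtermap s sequentially)"
      unfolding eventually_filtermap eventually_sequentially by auto
    then show "\<exists>A\<subseteq>carrier E. eventually (\<lambda>x. x \<in> A) (filtermap s sequentially) \<and>
        (\<forall>x\<in>A. \<forall>y\<in>A. x \<ominus> y \<in> U)"
      using N s by (intro exI[of _ "s ` {N..}"]) auto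
  qed
  then obtain l where "limitin (topol E) (\<lambda>x. x) l (filtermap s sequentially)"
    using complete unfolding complete_tvs_def by blast
  then show ?thesis
    by (auto simp: limitin_def eventually_filtermap)
qed

text \<open>
  Each \<open>U (Suc k)\<close> is chosen inside half of \<open>U k\<close> and inside half of the \<open>k\<close>-th member of a countable
  base at zero. Sums of elements \<open>y\<^sub>k \<in> U (Suc k)\<close> are then controlled by the first one, as with
  a geometric series.
\<close>

lemma fundamental_sequence:
  assumes met: "metrizable_space (topol E)" and W: "nbhd W"
  obtains U :: "nat \<Rightarrow> 'a set" where "\<And>k. nbhd (U k)" "\<And>x y. x \<in> U 0 \<Longrightarrow> y \<in> U 0 \<Longrightarrow> x \<oplus> y \<in> W"
    "\<And>k x y. x \<in> U (Suc k) \<Longrightarrow> y \<in> U (Suc k) \<Longrightarrow> x \<oplus> y \<in> U k"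
    "\<And>k x y. x \<in> U (Suc k) \<Longrightarrow> y \<in> U (Suc k) \<Longrightarrow> x \<ominus> y \<in> U k"
    "\<And>V. nbhd V \<Longrightarrow> \<exists>k. U k \<subseteq> V"
proof -
  have "\<exists>\<B>. countable \<B> \<and> (\<forall>V\<in>\<B>. openin (topol E) V) \<and>
      (\<forall>U. openin (topol E) U \<and> \<zero> \<in> U \<longrightarrow> (\<exists>V\<in>\<B>. \<zero> \<in> V \<and> V \<subseteq> U))"
    using bspec[OF metrizable_imp_first_countable[OF met, unfolded first_countable_def], of \<zero>] by simp
  then obtain \<B> where "countable \<B>" and \<B>: "\<And>V. V \<in> \<B> \<Longrightarrow> openin (topol E) V"
    and base: "\<And>U. openin (topol E) U \<and> \<zero> \<in> U \<Longrightarrow> \<exists>V\<in>\<B>. \<zero> \<in> V \<and> V \<subseteq> U"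
    by blast
  define \<C> where "\<C> = {V \<in> \<B>. \<zero> \<in> V}"
  have "countable \<C>"
    unfolding \<C>_def using \<open>countable \<B>\<close> by (rule countable_subset[rotated]) blast
  have "\<C> \<noteq> {}"
    using base[of W] W unfolding \<C>_def nbhd_def by blast
  define G where "G = from_nat_into \<C>"
  have G: "range G = \<C>"
    unfolding G_def using \<open>countable \<C>\<close> \<open>\<C> \<noteq> {}\<close> by (simp add: range_from_nat_into)
  have G_nbhd: "nbhd (G k)" for k
    using G \<B> by (auto simp: \<C>_def nbhd_def)
  let ?Q = "\<lambda>k U V. \<forall>x\<in>V. \<forall>y\<in>V. x \<oplus> y \<in> U \<inter> G k \<and> x \<ominus> y \<in> U \<inter> G k"
  obtain U0 where U0: "nbhd U0" "\<And>x y. x \<in> U0 \<Longrightarrow> y \<in> U0 \<Longrightarrow> x \<oplus> y \<in> W"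
    using nbhd_sum_diff[OF W] by metis
  have "\<exists>U. \<forall>k. (nbhd (U k) \<and> (k = 0 \<longrightarrow> U k = U0)) \<and> ?Q k (U k) (U (Suc k))"
  proof (rule dependent_nat_choice[where P = "\<lambda>k U. nbhd U \<and> (k = 0 \<longrightarrow> U = U0)" and Q = ?Q])
    show "\<exists>U. nbhd U \<and> ((0::nat) = 0 \<longrightarrow> U = U0)"
      using U0 by simp
    fix U and k :: nat assume "nbhd U \<and> (k = 0 \<longrightarrow> U = U0)"
    then have "nbhd (U \<inter> G k)"
      using G_nbhd nbhd_Int by simp
    then show "\<exists>V. (nbhd V \<and> (Suc k = 0 \<longrightarrow> V = U0)) \<and> ?Q k U V"
      using nbhd_sum_diff by (metis nat.distinct(1))
  qed
  then obtain U where U: "\<And>k. nbhd (U k)" "U 0 = U0" "\<And>k. ?Q k (U k) (U (Suc k))"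
    by metis
  show ?thesis
  proof
    show "\<exists>k. U k \<subseteq> V" if V: "nbhd V" for V
    proof -
      obtain V0 where V0: "V0 \<in> \<B>" "\<zero> \<in> V0" "V0 \<subseteq> V"
        using base[of V] V by (auto simp: nbhd_def)
      then have "V0 \<in> range G"
        by (simp add: G \<C>_def)
      then obtain k where k: "G k \<subseteq> V"
        using V0(3) by auto
      have "U (Suc k) \<subseteq> G k"
      proof
        fix x assume x: "x \<in> U (Suc k)"
        then have "x \<oplus> \<zero> \<in> G k"
          using U(3) nbhd_zero[OF U(1)] by blast
        then show "x \<in> G k"
          using nbhd_carrier[OF U(1) x] by simp
      qed
      with k show ?thesis by blast
    qed
  qed (use U U0 in auto)
qed

end

section \<open>Banach discs\<close>

locale bounded_disc = tvs E + disc E B for E :: "'a tvs" (structure) and B :: "'a set" +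
  assumes bounded: "bounded_in E B"
begin

text \<open>
  The normed space spanned by a bounded disc embeds continuously: a set that absorbs \<open>B\<close> contains a
  small multiple of the unit ball.
\<close>

lemma gauge_small_nbhd:
  assumes "nbhd U"
  shows "\<exists>r>0. \<forall>x\<in>linear_hull E B. gauge x < r \<longrightarrow> x \<in> U"
proof -
  obtain s where s: "s > 0" "\<And>c. s \<le> cmod c \<Longrightarrow> B \<subseteq> (\<lambda>x. c \<odot> x) ` U"
    using bounded assms unfolding bounded_in_def nbhd_def by blast
  have "x \<in> U" if x: "x \<in> linear_hull E B" and less: "gauge x < inverse s" for x
  proof -
    obtain t where t: "gauge x < t" "t < inverse s"
      using less dense by blast
    then obtain b where b: "b \<in> B" "x = complex_of_real t \<odot> b"
      using gauge_lessE[OF x] by blast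
    have "t > 0"
      using t gauge_nonneg[OF x] by linarith
    then have "s \<le> cmod (inverse (complex_of_real t))"
      using t s(1) by (simp add: norm_divide field_simps)
    then obtain v where "v \<in> U" "b = inverse (complex_of_real t) \<odot> v"
      using s(2) b(1) by blast
    then show ?thesis
      using b \<open>t > 0\<close> nbhd_carrier[OF assms] by simp
  qed
  then show ?thesis
    using s(1) by (intro exI[of _ "inverse s"]) auto
qed

text \<open>
  A sequence that is Cauchy for the gauge is Cauchy in \<open>E\<close>, hence has a limit in \<open>E\<close>. Its tails lie in
  translates of small multiples of \<open>B\<close>, and these are closed in \<open>E\<close>; the limit therefore lies in the
  same translates, which says that it is a limit for the gauge.
\<close>

lemma banach_space_hull:
  assumes complete: "complete_tvs E" and closed: "closedin (topol E) B"
  shows "banach_space (hull_space E B)"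
  unfolding banach_space_def
proof (intro conjI ballI allI impI seminormed_space_hull)
  fix x assume "x \<in> carrier (hull_space E B)" "snorm (hull_space E B) x = 0"
  then have x: "x \<in> linear_hull E B" "gauge x = 0"
    by simp_all
  have "x = \<zero>"
  proof (rule Hausdorff_zero)
    show "x \<in> U" if "nbhd U" for U
      using gauge_small_nbhd[OF that] x by auto
  qed (use complete x hull_carrier in \<open>auto simp: complete_tvs_def\<close>)
  then show "x = \<zero>\<^bsub>hull_space E B\<^esub>"
    by simp
next
  fix s assume cauchy: "cauchy_seq (hull_space E B) s"
  have s: "s k \<in> linear_hull E B" for k
    using cauchy by (simp add: cauchy_seq_def)
  have cauchy: "\<exists>N. \<forall>k\<ge>N. \<forall>l\<ge>N. gauge (s k \<ominus> s l) < e" if "e > 0" for e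
    using cauchy s that by (simp add: cauchy_seq_def hull_minus)
  have minus: "s k \<ominus> s l \<in> linear_hull E B" for k l
    using hull.minus_closed[of "s k" "s l"] s by (simp add: hull_minus)
  have "\<exists>N. \<forall>k\<ge>N. \<forall>l\<ge>N. s k \<ominus> s l \<in> U" if "nbhd U" for U
    using gauge_small_nbhd[OF that] cauchy minus by meson
  then obtain l where l: "limitin (topol E) s l sequentially"
    using complete_seq[OF complete] s hull_carrier by blast
  then have lc: "l \<in> carrier E"
    using limitin_topspace by fastforce
  have near: "\<exists>N. \<forall>k\<ge>N. s k \<ominus> l \<in> linear_hull E B \<and> gauge (s k \<ominus> l) \<le> e" if "e > 0" for e
  proof -
    obtain N where N: "\<forall>k\<ge>N. \<forall>m\<ge>N. gauge (s k \<ominus> s m) < e"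
      using cauchy[OF \<open>e > 0\<close>] by blast
    define c where "c = complex_of_real e"
    have c: "c \<noteq> 0"
      using \<open>e > 0\<close> by (simp add: c_def)
    have "s k \<ominus> l \<in> linear_hull E B \<and> gauge (s k \<ominus> l) \<le> e" if "k \<ge> N" for k
    proof -
      have sk: "s k \<in> carrier E"
        using s hull_carrier by blast
      have "inverse c \<odot> (s k \<ominus> s m) \<in> B" if m: "m \<ge> N" for m
      proof -
        obtain b where b: "b \<in> B" "s k \<ominus> s m = c \<odot> b"
          using gauge_lessE[OF minus] N \<open>k \<ge> N\<close> m unfolding c_def by metis
        then show ?thesis
          using c disc_carrier by simp
      qed
      then have "eventually (\<lambda>m. inverse c \<odot> (s k \<ominus> s m) \<in> B) sequentially"
        unfolding eventually_sequentially by blast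
      moreover have "limitin (topol E) (\<lambda>m. inverse c \<odot> (s k \<ominus> s m)) (inverse c \<odot> (s k \<ominus> l)) sequentially"
        using continuous_map_limit[OF continuous_minus[OF sk] l] by (simp add: o_def)
      ultimately have b: "inverse c \<odot> (s k \<ominus> l) \<in> B"
        using limitin_closedin closed by (metis sequentially_bot)
      have "s k \<ominus> l = complex_of_real e \<odot> (inverse c \<odot> (s k \<ominus> l))"
        using sk lc c by (simp add: c_def[symmetric])
      then show ?thesis
        using hullI[OF \<open>e > 0\<close> b] gauge_le[OF \<open>e > 0\<close> b] by metis
    qed
    then show ?thesis by blast
  qed
  obtain k where "s k \<ominus> l \<in> linear_hull E B"
    using near[of 1] by auto
  moreover have "s k \<ominus> (s k \<ominus> l) = l"
    using s[of k] lc hull_carrier by (simp add: a_minus_def minus_add r_neg1 r_neg2)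
  ultimately have lh: "l \<in> linear_hull E B"
    using hull.minus_closed[of "s k" "s k \<ominus> l"] s by (simp add: hull_minus)
  have "(\<lambda>k. gauge (s k \<ominus> l)) \<longlonglongrightarrow> 0"
  proof (rule LIMSEQ_I)
    fix e :: real assume "e > 0"
    then obtain N where "\<forall>k\<ge>N. s k \<ominus> l \<in> linear_hull E B \<and> gauge (s k \<ominus> l) \<le> e / 2"
      using near[of "e / 2"] by auto
    then show "\<exists>N. \<forall>k\<ge>N. norm (gauge (s k \<ominus> l) - 0) < e"
      using gauge_nonneg \<open>e > 0\<close> by (intro exI[of _ N]) fastforce
  qed
  then show "\<exists>l\<in>carrier (hull_space E B). (\<lambda>k. snorm (hull_space E B) (s k \<ominus>\<^bsub>hull_space E B\<^esub> l)) \<longlonglongrightarrow> 0"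
    using lh s by (auto simp: hull_minus)
qed

text \<open>
  Absolute convexity passes to the closure by continuity of the operations. For boundedness, a point
  of the closure differs from a point of \<open>B\<close> by an element of \<open>c \<odot> V\<close>, so that \<open>B \<subseteq> c \<odot> V\<close> and
  \<open>V \<oplus> V \<subseteq> U\<close> place the closure in \<open>c \<odot> U\<close>.
\<close>

lemma bounded_disc_closure: "bounded_disc E (topol E closure_of B)"
proof -
  let ?C = "topol E closure_of B"
  have C: "?C \<subseteq> carrier E"
    using closure_of_subset_topspace[of "topol E" B] by simp
  have BC: "B \<subseteq> ?C"
    using disc_carrier by (intro closure_of_subset) auto
  have "a \<odot> x \<oplus> b \<odot> y \<in> ?C" if "x \<in> ?C" "y \<in> ?C" and ab: "cmod a + cmod b \<le> 1" for x y a b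
  proof -
    let ?f = "\<lambda>p. a \<odot> fst p \<oplus> b \<odot> snd p"
    have "continuous_map (prod_topology (topol E) (topol E)) (prod_topology (topol E) (topol E))
        (\<lambda>p. (a \<odot> fst p, b \<odot> snd p))"
      unfolding continuous_map_paired
      by (intro conjI continuous_map_compose[OF continuous_map_fst continuous_scale, unfolded o_def]
          continuous_map_compose[OF continuous_map_snd continuous_scale, unfolded o_def])
    from continuous_map_compose[OF this continuous_add]
    have "continuous_map (prod_topology (topol E) (topol E)) (topol E) ?f"
      by (simp add: o_def)
    from continuous_map_image_closure_subset[OF this, of "B \<times> B"]
    have "?f (x, y) \<in> topol E closure_of (?f ` (B \<times> B))"
      using that unfolding closure_of_Times by blast
    then have "a \<odot> x \<oplus> b \<odot> y \<in> topol E closure_of (?f ` (B \<times> B))"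
      by simp
    moreover have "?f ` (B \<times> B) \<subseteq> B"
      using disc_comb[OF _ _ ab] by auto
    ultimately show ?thesis
      using closure_of_mono by fastforce
  qed
  then have "abs_convex_in E ?C"
    using C BC disc_zero by (auto simp: abs_convex_in_def)
  moreover have "bounded_in E ?C"
    unfolding bounded_in_def
  proof (intro conjI allI impI C)
    fix U assume "openin (topol E) U \<and> \<zero> \<in> U"
    then obtain V where V: "nbhd V" "\<And>x y. x \<in> V \<Longrightarrow> y \<in> V \<Longrightarrow> x \<oplus> y \<in> U"
      using nbhd_sum_diff unfolding nbhd_def by metis
    obtain s where s: "s > 0" "\<And>c. s \<le> cmod c \<Longrightarrow> B \<subseteq> (\<lambda>x. c \<odot> x) ` V"
      using bounded V(1) unfolding bounded_in_def nbhd_def by blast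
    have "x \<in> (\<lambda>x. c \<odot> x) ` U" if x: "x \<in> ?C" and c: "s \<le> cmod c" for x c
    proof -
      have xc: "x \<in> carrier E" and c0: "c \<noteq> 0"
        using x C c s(1) by auto
      \<comment> \<open>A neighbourhood of \<open>x\<close>, which therefore meets \<open>B\<close>.\<close>
      define N where "N = {y \<in> carrier E. inverse c \<odot> (x \<ominus> y) \<in> V}"
      have "openin (topol E) N"
        unfolding N_def using V(1) xc by (intro openin_preimage_minus) (auto simp: nbhd_def)
      moreover have "x \<in> N"
        using xc nbhd_zero[OF V(1)] by (simp add: N_def)
      ultimately obtain b where "b \<in> B" "b \<in> N"
        using x in_closure_of[of x "topol E" B] by metis
      then have b: "b \<in> B" "inverse c \<odot> (x \<ominus> b) \<in> V"
        by (simp_all add: N_def)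
      then obtain v where v: "v \<in> V" "b = c \<odot> v"
        using s(2)[OF c] by blast
      have "v \<oplus> inverse c \<odot> (x \<ominus> b) \<in> U"
        using V(2) v b by blast
      moreover have "c \<odot> (v \<oplus> inverse c \<odot> (x \<ominus> b)) = x"
        using v nbhd_carrier[OF V(1)] xc c0 by (simp add: smult_add_right)
      ultimately show ?thesis
        by (metis image_eqI)
    qed
    then show "\<exists>s>0. \<forall>c. s \<le> cmod c \<longrightarrow> ?C \<subseteq> (\<lambda>x. c \<odot> x) ` U"
      using s(1) by blast
  qed
  ultimately show ?thesis
    by (intro bounded_disc.intro disc.intro bounded_disc_axioms.intro tvs_axioms vec)
qed

end

section \<open>Grothendieck's factorization theorem\<close>

text \<open>
  Baire's theorem in the form in which it is applied: one of countably many sets covering a Banach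
  space is dense in some ball.
\<close>

lemma banach_baire:
  assumes X: "banach_space X" and \<A>: "countable \<A>" and cover: "carrier X = \<Union>\<A>"
  shows "\<exists>S\<in>\<A>. \<exists>x\<in>carrier X. \<exists>e>0. \<forall>y\<in>carrier X. snorm X (x \<ominus>\<^bsub>X\<^esub> y) < e \<longrightarrow>
    (\<forall>d>0. \<exists>a\<in>S. snorm X (y \<ominus>\<^bsub>X\<^esub> a) < d)"
proof -
  interpret seminormed_vec_space X
    using X by (intro seminormed_vec_space.intro) (simp add: banach_space_def)
  \<comment> \<open>A metric space in the sense of \<^locale>\<open>Metric_space\<close> has a distance that is nonnegative and
     symmetric on the whole type, hence the value 0 off the carrier.\<close>
  define d where "d x y = (if x \<in> carrier X \<and> y \<in> carrier X then snorm X (x \<ominus>\<^bsub>X\<^esub> y) else 0)" for x y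
  interpret Metric_space "carrier X" d
  proof
    show "0 \<le> d x y" for x y
      by (simp add: d_def)
    show "d x y = d y x" for x y
      by (simp add: d_def norm_minus_commute)
    show "d x y = 0 \<longleftrightarrow> x = y" if "x \<in> carrier X" "y \<in> carrier X" for x y
    proof
      assume "d x y = 0"
      then have "x \<ominus>\<^bsub>X\<^esub> y = \<zero>\<^bsub>X\<^esub>"
        using X that by (simp add: d_def banach_space_def)
      then show "x = y"
        using that by (simp add: minus_eq_zero_iff)
    qed (simp add: d_def that)
    show "d x z \<le> d x y + d y z" if "x \<in> carrier X" "y \<in> carrier X" "z \<in> carrier X" for x y z
      using that norm_triangle_minus by (simp add: d_def)
  qed
  have complete: mcomplete
    unfolding mcomplete_def
  proof (intro allI impI)
    fix \<sigma> assume "MCauchy \<sigma>"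
    then have \<sigma>: "\<sigma> k \<in> carrier X" for k
      by (auto simp: MCauchy_def)
    then have "cauchy_seq X \<sigma>"
      using \<open>MCauchy \<sigma>\<close> by (auto simp: MCauchy_def cauchy_seq_def d_def)
    then obtain l where l: "l \<in> carrier X" "(\<lambda>k. snorm X (\<sigma> k \<ominus>\<^bsub>X\<^esub> l)) \<longlonglongrightarrow> 0"
      using X unfolding banach_space_def by blast
    have "limitin mtopology \<sigma> l sequentially"
      unfolding limitin_metric
    proof (intro conjI allI impI l)
      fix e :: real assume "e > 0"
      then have "\<forall>\<^sub>F k in sequentially. snorm X (\<sigma> k \<ominus>\<^bsub>X\<^esub> l) < e"
        by (rule order_tendstoD(2)[OF l(2)])
      then show "\<forall>\<^sub>F k in sequentially. \<sigma> k \<in> carrier X \<and> d (\<sigma> k) l < e"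
        by (rule eventually_mono) (simp add: \<sigma> d_def l)
    qed
    then show "\<exists>x. limitin mtopology \<sigma> x sequentially" ..
  qed
  have "\<exists>S\<in>\<A>. mtopology interior_of (mtopology closure_of S) \<noteq> {}"
  proof (rule ccontr)
    assume neg: "\<not> ?thesis"
    have "mtopology interior_of (\<Union>((closure_of) mtopology ` \<A>)) = {}"
      by (rule metric_Baire_category_alt[OF complete]) (use \<A> neg in auto)
    moreover have "carrier X \<subseteq> \<Union>((closure_of) mtopology ` \<A>)"
    proof
      fix x assume "x \<in> carrier X"
      then obtain S where "S \<in> \<A>" "x \<in> S"
        using cover by blast
      then have "x \<in> mtopology closure_of S"
        using closure_of_subset[of S mtopology] Sup_upper[OF \<open>S \<in> \<A>\<close>] unfolding cover[symmetric] by auto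
      then show "x \<in> \<Union>((closure_of) mtopology ` \<A>)"
        using \<open>S \<in> \<A>\<close> by blast
    qed
    moreover have "mtopology interior_of carrier X = carrier X"
      using interior_of_topspace[of mtopology] by simp
    ultimately have "carrier X \<subseteq> {}"
      using interior_of_mono by metis
    then show False
      using zero_closed by blast
  qed
  then obtain S x where S: "S \<in> \<A>" and x: "x \<in> mtopology interior_of (mtopology closure_of S)"
    by blast
  have "openin mtopology (mtopology interior_of (mtopology closure_of S))"
    by simp
  then obtain e where e: "e > 0" "mball x e \<subseteq> mtopology interior_of (mtopology closure_of S)"
    using x unfolding openin_mtopology by blast
  have xc: "x \<in> carrier X"
    using x interior_of_subset_topspace[of mtopology] by auto
  have "\<exists>a\<in>S. snorm X (y \<ominus>\<^bsub>X\<^esub> a) < r"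
    if "y \<in> carrier X" "snorm X (x \<ominus>\<^bsub>X\<^esub> y) < e" "r > 0" for y r
  proof -
    have "y \<in> mball x e"
      using that xc by (simp add: in_mball d_def)
    then have "y \<in> mtopology closure_of S"
      using subsetD[OF interior_of_subset subsetD[OF e(2)]] by simp
    then obtain a where "a \<in> S" "a \<in> mball y r"
      using \<open>r > 0\<close> unfolding metric_closure_of by blast
    then show ?thesis
      by (auto simp: in_mball d_def split: if_splits)
  qed
  then show ?thesis
    using S xc e(1) by blast
qed

text \<open>
  The setting of Grothendieck's factorization theorem: a Banach space \<open>X\<close> is mapped continuously by
  \<open>u\<close> into a Hausdorff space that is covered, over the image of \<open>u\<close>, by countably many Frechet
  spaces.
\<close>

locale banach_to_frechet_union =
  fixes X :: "'x seminormed" and E :: "'b tvs" and F :: "nat \<Rightarrow> 'a tvs"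
    and u :: "'x \<Rightarrow> 'b" and i :: "nat \<Rightarrow> 'a \<Rightarrow> 'b"
  assumes X: "banach_space X" and E: "top_vec_space E" and Hausdorff: "Hausdorff_space (topol E)"
    and frechet: "\<And>n. frechet_space (F n)"
    and i: "\<And>n. cont_linear (F n) E (i n)"
    and u: "linear_map X E u"
    and u_continuous: "\<And>U. openin (topol E) U \<Longrightarrow> \<zero>\<^bsub>E\<^esub> \<in> U \<Longrightarrow>
      \<exists>r>0. \<forall>x\<in>carrier X. snorm X x < r \<longrightarrow> u x \<in> U"
    and cover: "u ` carrier X \<subseteq> (\<Union>n. i n ` carrier (F n))"
begin

sublocale X: seminormed_vec_space X
  using X by (intro seminormed_vec_space.intro) (simp add: banach_space_def)

sublocale E: tvs E
  by (rule tvs.intro[OF E])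

sublocale F: tvs "F n" for n
  using frechet[of n] by (intro tvs.intro) (simp add: frechet_space_def loc_convex_def)

sublocale u: complex_linear X E u
  by (intro complex_linear.intro complex_linear_axioms.intro X.complex_space_axioms E.complex_space_axioms u)

sublocale i: complex_linear "F n" E "i n" for n
  using i[of n] by (intro complex_linear.intro complex_linear_axioms.intro F.complex_space_axioms E.complex_space_axioms)
    (simp add: cont_linear_def)

lemma nbhd_preimage: "E.nbhd U \<Longrightarrow> F.nbhd n {y \<in> carrier (F n). i n y \<in> U}"
  using i[of n] openin_continuous_map_preimage[of "topol (F n)" "topol E" "i n" U]
  by (auto simp: cont_linear_def E.nbhd_def F.nbhd_def)

text \<open>
  If the conclusion failed for every \<open>n\<close>, with bad neighbourhoods \<open>W n\<close>, choose \<open>V n\<close> with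
  \<open>V n \<ominus> V n \<subseteq> W n\<close>. The preimages of the multiples \<open>c \<odot> i n ` V n\<close> with \<open>c = 1, 2, \<dots>\<close> cover \<open>X\<close>,
  so one of them is dense in a ball; taking differences moves the centre of this ball to zero, and
  dividing by \<open>c\<close> contradicts the choice of \<open>W n\<close>.
\<close>

lemma almost_open:
  "\<exists>n. \<forall>W. F.nbhd n W \<longrightarrow> (\<exists>r>0. \<forall>x\<in>carrier X. snorm X x < r \<longrightarrow>
     (\<forall>d>0. \<exists>a\<in>carrier X. u a \<in> i n ` W \<and> snorm X (x \<ominus>\<^bsub>X\<^esub> a) < d))"
proof (rule ccontr)
  assume "\<not> ?thesis"
  then obtain W where W: "\<And>n. F.nbhd n (W n)"
    and no_ball: "\<And>n r. r > 0 \<Longrightarrow> \<exists>x\<in>carrier X. snorm X x < r \<and>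
      (\<exists>d>0. \<forall>a\<in>carrier X. u a \<in> i n ` W n \<longrightarrow> \<not> snorm X (x \<ominus>\<^bsub>X\<^esub> a) < d)"
    by metis
  have "\<exists>V. F.nbhd n V \<and> (\<forall>x\<in>V. \<forall>y\<in>V. x \<ominus>\<^bsub>F n\<^esub> y \<in> W n)" for n
    using F.nbhd_sum_diff[OF W[of n]] by metis
  then obtain V where V: "\<And>n. F.nbhd n (V n)" "\<And>n x y. x \<in> V n \<Longrightarrow> y \<in> V n \<Longrightarrow> x \<ominus>\<^bsub>F n\<^esub> y \<in> W n"
    by metis
  define c where "c k = (of_nat (Suc k) :: complex)" for k
  have c: "c k \<noteq> 0" "cmod (c k) = real (Suc k)" for k
    unfolding c_def by (simp_all only: norm_of_nat of_nat_eq_0_iff)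
  define S where "S n k = {x \<in> carrier X. \<exists>y\<in>V n. u x = c k \<odot>\<^bsub>E\<^esub> i n y}" for n k
  have "carrier X = \<Union>(range (\<lambda>(n, k). S n k))"
  proof (intro subset_antisym subsetI)
    fix x assume x: "x \<in> carrier X"
    then obtain n y where y: "y \<in> carrier (F n)" "u x = i n y"
      using cover by blast
    obtain k where "inverse (c k) \<odot>\<^bsub>F n\<^esub> y \<in> V n"
      using F.nbhd_absorbing[OF V(1) y(1)] unfolding c_def by blast
    moreover have "u x = c k \<odot>\<^bsub>E\<^esub> i n (inverse (c k) \<odot>\<^bsub>F n\<^esub> y)"
      using y c by simp
    ultimately have "x \<in> S n k"
      using x by (auto simp: S_def)
    then show "x \<in> \<Union>(range (\<lambda>(n, k). S n k))"
      by auto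
  qed (auto simp: S_def)
  from banach_baire[OF X _ this] obtain n k x0 e where x0: "x0 \<in> carrier X" and "e > 0"
    and dense: "\<And>y d. y \<in> carrier X \<Longrightarrow> snorm X (x0 \<ominus>\<^bsub>X\<^esub> y) < e \<Longrightarrow> d > 0 \<Longrightarrow>
      \<exists>a\<in>S n k. snorm X (y \<ominus>\<^bsub>X\<^esub> a) < d"
    by force
  have pos: "e / real (Suc k) > 0"
    using \<open>e > 0\<close> by simp
  obtain x d where x: "x \<in> carrier X" "snorm X x < e / real (Suc k)" and "d > 0"
    and far: "\<And>a. a \<in> carrier X \<Longrightarrow> u a \<in> i n ` W n \<Longrightarrow> \<not> snorm X (x \<ominus>\<^bsub>X\<^esub> a) < d"
    using no_ball[OF pos, of n] by blast
  define y where "y = x0 \<oplus>\<^bsub>X\<^esub> c k \<odot>\<^bsub>X\<^esub> x"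
  have y: "y \<in> carrier X" "y \<ominus>\<^bsub>X\<^esub> x0 = c k \<odot>\<^bsub>X\<^esub> x"
    using x0 x by (simp_all add: y_def)
  define d' where "d' = real (Suc k) * d / 2"
  have "d' > 0"
    using \<open>d > 0\<close> by (simp add: d'_def)
  have "snorm X (x0 \<ominus>\<^bsub>X\<^esub> y) = real (Suc k) * snorm X x"
    using X.norm_minus_commute[OF x0 y(1)] y(2) x(1) c by simp
  also have "\<dots> < e"
    using x(2) by (simp add: pos_less_divide_eq mult.commute)
  finally obtain a where a: "a \<in> S n k" "snorm X (y \<ominus>\<^bsub>X\<^esub> a) < d'"
    using dense[OF y(1) _ \<open>d' > 0\<close>] by blast
  obtain a0 where a0: "a0 \<in> S n k" "snorm X (x0 \<ominus>\<^bsub>X\<^esub> a0) < d'"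
    using dense[OF x0 _ \<open>d' > 0\<close>] x0 \<open>e > 0\<close> by auto
  have ac: "a \<in> carrier X" "a0 \<in> carrier X"
    using a a0 by (auto simp: S_def)
  obtain v v0 where v: "v \<in> V n" "u a = c k \<odot>\<^bsub>E\<^esub> i n v" and v0: "v0 \<in> V n" "u a0 = c k \<odot>\<^bsub>E\<^esub> i n v0"
    using a(1) a0(1) by (auto simp: S_def)
  have vc: "v \<in> carrier (F n)" "v0 \<in> carrier (F n)"
    using v v0 F.nbhd_carrier[OF V(1)] by auto
  define b where "b = inverse (c k) \<odot>\<^bsub>X\<^esub> (a \<ominus>\<^bsub>X\<^esub> a0)"
  have b: "b \<in> carrier X"
    using ac by (simp add: b_def)
  have "u b = inverse (c k) \<odot>\<^bsub>E\<^esub> (c k \<odot>\<^bsub>E\<^esub> i n (v \<ominus>\<^bsub>F n\<^esub> v0))"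
    using ac v v0 vc by (simp add: b_def E.smult_minus_right)
  also have "\<dots> = i n (v \<ominus>\<^bsub>F n\<^esub> v0)"
    using vc c by simp
  finally have ub: "u b \<in> i n ` W n"
    using V(2)[OF v(1) v0(1)] by blast
  have "c k \<odot>\<^bsub>X\<^esub> (x \<ominus>\<^bsub>X\<^esub> b) = (y \<ominus>\<^bsub>X\<^esub> x0) \<ominus>\<^bsub>X\<^esub> (a \<ominus>\<^bsub>X\<^esub> a0)"
    using x b ac c y(2) by (simp add: X.smult_minus_right) (simp add: b_def)
  also have "\<dots> = (y \<ominus>\<^bsub>X\<^esub> a) \<ominus>\<^bsub>X\<^esub> (x0 \<ominus>\<^bsub>X\<^esub> a0)"
    using x0 y(1) ac by (simp add: a_minus_def X.minus_add X.a_ac)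
  finally have "real (Suc k) * snorm X (x \<ominus>\<^bsub>X\<^esub> b) = snorm X ((y \<ominus>\<^bsub>X\<^esub> a) \<ominus>\<^bsub>X\<^esub> (x0 \<ominus>\<^bsub>X\<^esub> a0))"
    using X.norm_smult[of "x \<ominus>\<^bsub>X\<^esub> b" "c k"] x b c by simp
  also have "\<dots> \<le> snorm X (y \<ominus>\<^bsub>X\<^esub> a) + snorm X (x0 \<ominus>\<^bsub>X\<^esub> a0)"
    using X.norm_triangle_minus[of "y \<ominus>\<^bsub>X\<^esub> a" "\<zero>\<^bsub>X\<^esub>" "x0 \<ominus>\<^bsub>X\<^esub> a0"]
      X.norm_minus_commute[of "\<zero>\<^bsub>X\<^esub>" "x0 \<ominus>\<^bsub>X\<^esub> a0"] x0 y(1) ac by simp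
  also have "\<dots> < real (Suc k) * d"
    using a(2) a0(2) by (simp add: d'_def)
  finally have "snorm X (x \<ominus>\<^bsub>X\<^esub> b) < d"
    by (simp add: mult_less_cancel_left_pos)
  then show False
    using far[OF b ub] by blast
qed

text \<open>
  For a given \<open>W\<close>, take neighbourhoods \<open>U k\<close> shrinking to zero in \<open>F n\<close> whose sums remain in \<open>W\<close>. If
  \<open>x\<close> is small, subtract from it an element of the preimage of \<open>U 1\<close> so that the remainder is so
  small as to be approximable from \<open>U 2\<close>, and iterate. The partial sums of the elements of \<open>F n\<close> used
  on the way form a Cauchy sequence; its limit \<open>y\<close> lies in \<open>W\<close>, and \<open>i n y = u x\<close> as the remainders
  tend to zero and \<open>E\<close> is Hausdorff.
\<close>

lemma ball_in_image:
  "\<exists>n. \<forall>W. F.nbhd n W \<longrightarrow> (\<exists>r>0. \<forall>x\<in>carrier X. snorm X x < r \<longrightarrow> u x \<in> i n ` W)"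
proof -
  obtain n where n: "\<And>W. F.nbhd n W \<Longrightarrow> \<exists>r>0. \<forall>x\<in>carrier X. snorm X x < r \<longrightarrow>
     (\<forall>d>0. \<exists>a\<in>carrier X. u a \<in> i n ` W \<and> snorm X (x \<ominus>\<^bsub>X\<^esub> a) < d)"
    using almost_open by blast
  have "\<exists>r>0. \<forall>x\<in>carrier X. snorm X x < r \<longrightarrow> u x \<in> i n ` W" if W: "F.nbhd n W" for W
  proof -
    have met: "metrizable_space (topol (F n))"
      using frechet[of n] by (simp add: frechet_space_def)
    obtain U :: "nat \<Rightarrow> 'a set" where U: "\<And>k. F.nbhd n (U k)"
      and U_W: "\<And>x y. x \<in> U 0 \<Longrightarrow> y \<in> U 0 \<Longrightarrow> x \<oplus>\<^bsub>F n\<^esub> y \<in> W"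
      and U_add: "\<And>k x y. x \<in> U (Suc k) \<Longrightarrow> y \<in> U (Suc k) \<Longrightarrow> x \<oplus>\<^bsub>F n\<^esub> y \<in> U k"
      and U_minus: "\<And>k x y. x \<in> U (Suc k) \<Longrightarrow> y \<in> U (Suc k) \<Longrightarrow> x \<ominus>\<^bsub>F n\<^esub> y \<in> U k"
      and U_base: "\<And>V. F.nbhd n V \<Longrightarrow> \<exists>k. U k \<subseteq> V"
      by (rule F.fundamental_sequence[OF met W]) (rule that)
    obtain r where r: "\<And>k. r k > 0" and r_dense: "\<And>k x d. x \<in> carrier X \<Longrightarrow> snorm X x < r k \<Longrightarrow> d > 0 \<Longrightarrow>
       \<exists>a\<in>carrier X. u a \<in> i n ` U k \<and> snorm X (x \<ominus>\<^bsub>X\<^esub> a) < d"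
      using n[OF U] by metis
    \<comment> \<open>Besides allowing the next approximation, the radii force the remainders to tend to zero.\<close>
    define \<rho> where "\<rho> k = min (r k) (inverse (real (Suc k)))" for k
    have \<rho>: "\<rho> k > 0" for k
      using r by (simp add: \<rho>_def)
    have "u x \<in> i n ` W" if x: "x \<in> carrier X" "snorm X x < \<rho> 1" for x
    proof -
      \<comment> \<open>The remainders \<open>xs k\<close>; the difference of consecutive ones comes from \<open>U (Suc k)\<close>.\<close>
      have "\<exists>xs. \<forall>k. (xs k \<in> carrier X \<and> snorm X (xs k) < \<rho> (Suc k) \<and> (k = 0 \<longrightarrow> xs k = x)) \<and>
          (\<exists>y\<in>U (Suc k). u (xs k \<ominus>\<^bsub>X\<^esub> xs (Suc k)) = i n y)"
      proof (rule dependent_nat_choice[where Q = "\<lambda>k x x'. \<exists>y\<in>U (Suc k). u (x \<ominus>\<^bsub>X\<^esub> x') = i n y"])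
        show "\<exists>x'. x' \<in> carrier X \<and> snorm X x' < \<rho> (Suc 0) \<and> ((0::nat) = 0 \<longrightarrow> x' = x)"
          using x by simp
        fix z and k :: nat assume z: "z \<in> carrier X \<and> snorm X z < \<rho> (Suc k) \<and> (k = 0 \<longrightarrow> z = x)"
        then obtain a where a: "a \<in> carrier X" "u a \<in> i n ` U (Suc k)" "snorm X (z \<ominus>\<^bsub>X\<^esub> a) < \<rho> (Suc (Suc k))"
          using r_dense[of z "Suc k" "\<rho> (Suc (Suc k))"] \<rho> by (auto simp: \<rho>_def)
        have "z \<ominus>\<^bsub>X\<^esub> (z \<ominus>\<^bsub>X\<^esub> a) = a"
          using z a by (simp add: a_minus_def X.minus_add X.r_neg1 X.r_neg2)
        then show "\<exists>x'. (x' \<in> carrier X \<and> snorm X x' < \<rho> (Suc (Suc k)) \<and> (Suc k = 0 \<longrightarrow> x' = x)) \<and>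
          (\<exists>y\<in>U (Suc k). u (z \<ominus>\<^bsub>X\<^esub> x') = i n y)"
          using a z by (intro exI[of _ "z \<ominus>\<^bsub>X\<^esub> a"]) auto
      qed
      then obtain xs where xs: "\<And>k. xs k \<in> carrier X" "\<And>k. snorm X (xs k) < \<rho> (Suc k)" "xs 0 = x"
        and "\<And>k. \<exists>y\<in>U (Suc k). u (xs k \<ominus>\<^bsub>X\<^esub> xs (Suc k)) = i n y"
        by metis
      then obtain ys where ys: "\<And>k. ys k \<in> U (Suc k)" "\<And>k. u (xs k \<ominus>\<^bsub>X\<^esub> xs (Suc k)) = i n (ys k)"
        by metis
      have yc: "ys k \<in> carrier (F n)" for k
        using F.nbhd_carrier[OF U ys(1)] .
      define s where "s = rec_nat \<zero>\<^bsub>F n\<^esub> (\<lambda>k z. z \<oplus>\<^bsub>F n\<^esub> ys k)"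
      have s_simps: "s 0 = \<zero>\<^bsub>F n\<^esub>" "s (Suc k) = s k \<oplus>\<^bsub>F n\<^esub> ys k" for k
        by (simp_all add: s_def)
      have sc: "s k \<in> carrier (F n)" for k
        by (induction k) (simp_all add: s_simps yc)
      \<comment> \<open>The shift of the index to \<open>Suc k\<close> in the induction is what lets the halving property of \<open>U\<close> act.\<close>
      have s_diff: "s (k + j) \<ominus>\<^bsub>F n\<^esub> s k \<in> U k" for k j
      proof (induction j arbitrary: k)
        case 0
        show ?case
          using F.nbhd_zero[OF U] sc by simp
      next
        case (Suc j)
        have "s (Suc k) \<ominus>\<^bsub>F n\<^esub> s k = ys k"
          using sc yc by (simp add: s_simps)
        then have "s (k + Suc j) \<ominus>\<^bsub>F n\<^esub> s k = (s (Suc k + j) \<ominus>\<^bsub>F n\<^esub> s (Suc k)) \<oplus>\<^bsub>F n\<^esub> ys k"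
          using F.minus_add_minus[OF sc[of "Suc k + j"] sc[of "Suc k"] sc[of k]] by simp
        then show ?case
          using U_add[OF Suc.IH ys(1)] by simp
      qed
      have s_cauchy: "\<exists>N. \<forall>k\<ge>N. \<forall>l\<ge>N. s k \<ominus>\<^bsub>F n\<^esub> s l \<in> V" if V: "F.nbhd n V" for V
      proof -
        obtain j where j: "U j \<subseteq> V"
          using U_base[OF V] by blast
        have "s k \<ominus>\<^bsub>F n\<^esub> s l \<in> V" if "k \<ge> Suc j" "l \<ge> Suc j" for k l
        proof -
          have "s k \<ominus>\<^bsub>F n\<^esub> s (Suc j) \<in> U (Suc j)" "s l \<ominus>\<^bsub>F n\<^esub> s (Suc j) \<in> U (Suc j)"
            using s_diff[of "Suc j" "k - Suc j"] s_diff[of "Suc j" "l - Suc j"] that by simp_all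
          then have "(s k \<ominus>\<^bsub>F n\<^esub> s (Suc j)) \<ominus>\<^bsub>F n\<^esub> (s l \<ominus>\<^bsub>F n\<^esub> s (Suc j)) \<in> U j"
            by (rule U_minus)
          moreover have "(s k \<ominus>\<^bsub>F n\<^esub> s (Suc j)) \<ominus>\<^bsub>F n\<^esub> (s l \<ominus>\<^bsub>F n\<^esub> s (Suc j)) = s k \<ominus>\<^bsub>F n\<^esub> s l"
            by (rule F.minus_minus_minus[OF sc sc sc])
          ultimately show ?thesis
            using j by auto
        qed
        then show ?thesis by blast
      qed
      obtain y where y: "limitin (topol (F n)) s y sequentially"
        using F.complete_seq[OF _ sc s_cauchy] frechet[of n] by (auto simp: frechet_space_def)
      have yn: "y \<in> carrier (F n)"
        using limitin_topspace[OF y] by simp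
      obtain m where "y \<ominus>\<^bsub>F n\<^esub> s m \<in> U 0"
        using F.limitin_minus[OF y U] by blast
      moreover have "s m \<in> U 0"
        using s_diff[of 0 m] sc by (simp add: s_simps)
      ultimately have yW: "y \<in> W"
        using U_W[of "s m" "y \<ominus>\<^bsub>F n\<^esub> s m"] yn sc by simp
      have i_s: "i n (s k) = u x \<ominus>\<^bsub>E\<^esub> u (xs k)" for k
      proof (induction k)
        case 0
        show ?case
          using x by (simp add: s_simps xs(3))
      next
        case (Suc k)
        then have "i n (s (Suc k)) = (u x \<ominus>\<^bsub>E\<^esub> u (xs k)) \<oplus>\<^bsub>E\<^esub> (u (xs k) \<ominus>\<^bsub>E\<^esub> u (xs (Suc k)))"
          using ys(2)[of k] xs(1) sc yc by (simp add: s_simps)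
        then show ?case
          using x xs(1) by (simp add: E.minus_add_minus)
      qed
      have "i n y \<ominus>\<^bsub>E\<^esub> u x = \<zero>\<^bsub>E\<^esub>"
      proof (rule E.Hausdorff_zero[OF Hausdorff])
        fix V assume "E.nbhd V"
        then obtain V' where V': "E.nbhd V'" "\<And>x y. x \<in> V' \<Longrightarrow> y \<in> V' \<Longrightarrow> x \<ominus>\<^bsub>E\<^esub> y \<in> V"
          using E.nbhd_sum_diff by metis
        obtain N where N: "\<And>k. k \<ge> N \<Longrightarrow> i n (y \<ominus>\<^bsub>F n\<^esub> s k) \<in> V'"
          using F.limitin_minus[OF y nbhd_preimage[OF V'(1)]] by blast
        obtain t where t: "t > 0" "\<And>x. x \<in> carrier X \<Longrightarrow> snorm X x < t \<Longrightarrow> u x \<in> V'"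
          using u_continuous[of V'] V'(1) unfolding E.nbhd_def by blast
        obtain M where M: "inverse (real (Suc M)) < t"
          using reals_Archimedean[OF t(1)] by blast
        define k where "k = max N M"
        have "snorm X (xs k) < inverse (real (Suc (Suc k)))"
          using xs(2)[of k] by (simp add: \<rho>_def)
        also have "\<dots> \<le> inverse (real (Suc M))"
          by (rule le_imp_inverse_le) (auto simp: k_def)
        finally have "u (xs k) \<in> V'"
          using t(2) xs(1) M by simp
        moreover have "i n (y \<ominus>\<^bsub>F n\<^esub> s k) \<in> V'"
          by (rule N) (simp add: k_def)
        ultimately have "i n (y \<ominus>\<^bsub>F n\<^esub> s k) \<ominus>\<^bsub>E\<^esub> u (xs k) \<in> V"
          using V'(2) by blast
        moreover have "i n (y \<ominus>\<^bsub>F n\<^esub> s k) \<ominus>\<^bsub>E\<^esub> u (xs k) = i n y \<ominus>\<^bsub>E\<^esub> u x"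
          using yn sc x xs(1) by (simp add: i_s E.minus_diff_minus)
        ultimately show "i n y \<ominus>\<^bsub>E\<^esub> u x \<in> V"
          by simp
      qed (use yn x in simp)
      then have "i n y = u x"
        using yn x by (simp add: E.minus_eq_zero_iff)
      then show ?thesis
        using yW by (metis image_eqI)
    qed
    then show ?thesis
      using \<rho> by blast
  qed
  then show ?thesis
    by blast
qed

end

section \<open>The inductive limit of an injective system\<close>

lemma with_topol_simps [simp]:
  "carrier (with_topol V T) = carrier V" "add (with_topol V T) = add V" "zero (with_topol V T) = zero V"
  "smult (with_topol V T) = smult V" "topol (with_topol V T) = T"
  by (simp_all add: with_topol_def module.defs)

lemma vec_space_with_topol:
  assumes "vec_space V"
  shows "vec_space (with_topol V T)"
proof -
  interpret complex_space V by (rule complex_space.intro[OF assms])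
  show ?thesis
    by (rule vec_spaceI) (auto simp: a_ac smult_add_left smult_add_right smult_smult)
qed

text \<open>
  The topology of the limit is a supremum over a family of topologies, and its underlying set is the
  whole limit only if this family is nonempty. The indiscrete topology is a member.
\<close>

lemma loc_convex_indiscrete:
  assumes "vec_space V"
  shows "loc_convex (with_topol V (pullback_topology (carrier V) (\<lambda>_. ()) (discrete_topology UNIV)))"
    (is "loc_convex (with_topol V ?I)")
proof -
  interpret V: complex_space V by (rule complex_space.intro[OF assms])
  have openin_I: "openin ?I U \<longleftrightarrow> U = {} \<or> U = carrier V" for U
  proof -
    have "(\<exists>W :: unit set. U = (\<lambda>_. ()) -` W \<inter> carrier V) \<longleftrightarrow> U = {} \<or> U = carrier V"
    proof
      assume "\<exists>W :: unit set. U = (\<lambda>_. ()) -` W \<inter> carrier V"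
      then show "U = {} \<or> U = carrier V"
        by (auto simp: vimage_def split: if_splits)
    next
      assume "U = {} \<or> U = carrier V"
      then show "\<exists>W :: unit set. U = (\<lambda>_. ()) -` W \<inter> carrier V"
      proof
        assume "U = {}"
        then show ?thesis by (intro exI[of _ "{}"]) simp
      next
        assume "U = carrier V"
        then show ?thesis by (intro exI[of _ UNIV]) simp
      qed
    qed
    then show ?thesis
      by (simp add: openin_pullback_topology)
  qed
  have top_I: "topspace ?I = carrier V"
    by (simp add: topspace_pullback_topology)
  have cont: "continuous_map Y ?I g" if "g ` topspace Y \<subseteq> carrier V" for Y g
    unfolding continuous_map_def top_I openin_I
  proof (intro conjI allI impI)
    show "openin Y {x \<in> topspace Y. g x \<in> U}" if "U = {} \<or> U = carrier V" for U
    proof -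
      have "{x \<in> topspace Y. g x \<in> U} = {} \<or> {x \<in> topspace Y. g x \<in> U} = topspace Y"
        using that \<open>g ` topspace Y \<subseteq> carrier V\<close> by auto
      then show ?thesis
        by (metis openin_empty openin_topspace)
    qed
  qed (use that in auto)
  have "top_vec_space (with_topol V ?I)"
    unfolding top_vec_space_def using vec_space_with_topol[OF assms]
    by (auto simp: top_I intro!: cont)
  moreover have "convex_in (with_topol V ?I) (carrier V)"
    by (auto simp: convex_in_def)
  ultimately show ?thesis
    unfolding loc_convex_def using V.zero_closed by (auto simp: openin_I)
qed

locale injective_system =
  fixes F :: "nat \<Rightarrow> 'a tvs" and f :: "nat \<Rightarrow> nat \<Rightarrow> 'a \<Rightarrow> 'a"
  assumes system: "inductive_system F f"
    and injective: "n \<le> m \<Longrightarrow> inj_on (f m n) (carrier (F n))"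
begin

abbreviation L where "L \<equiv> ind_lim F f"
abbreviation cls where "cls \<equiv> lim_class F f"

lemma cont: "n \<le> m \<Longrightarrow> cont_linear (F n) (F m) (f m n)"
  and f_id [simp]: "x \<in> carrier (F n) \<Longrightarrow> f n n x = x"
  and f_f [simp]: "n \<le> m \<Longrightarrow> m \<le> k \<Longrightarrow> x \<in> carrier (F n) \<Longrightarrow> f k m (f m n x) = f k n x"
  using system by (auto simp: inductive_system_def)

sublocale F: tvs "F n" for n
  using system by (intro tvs.intro) (simp add: inductive_system_def loc_convex_def)

lemma linear_f: "n \<le> m \<Longrightarrow> linear_map (F n) (F m) (f m n)"
  using cont by (simp add: cont_linear_def)

lemma f_closed [simp]: "n \<le> m \<Longrightarrow> x \<in> carrier (F n) \<Longrightarrow> f m n x \<in> carrier (F m)"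
  and f_add [simp]: "n \<le> m \<Longrightarrow> x \<in> carrier (F n) \<Longrightarrow> y \<in> carrier (F n) \<Longrightarrow>
    f m n (x \<oplus>\<^bsub>F n\<^esub> y) = f m n x \<oplus>\<^bsub>F m\<^esub> f m n y"
  and f_smult [simp]: "n \<le> m \<Longrightarrow> x \<in> carrier (F n) \<Longrightarrow> f m n (c \<odot>\<^bsub>F n\<^esub> x) = c \<odot>\<^bsub>F m\<^esub> f m n x"
  using linear_f[of n m] by (auto simp: linear_map_def)

text \<open>
  With injective transition morphisms, whether two elements agree at a common level does not depend on
  that level. The classes of the limit can thus be compared at any level that is large enough.
\<close>

lemma f_eq_iff_level:
  assumes x: "x \<in> carrier (F n)" and y: "y \<in> carrier (F m)" and k: "n \<le> k" "m \<le> k" "n \<le> k'" "m \<le> k'"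
  shows "f k n x = f k m y \<longleftrightarrow> f k' n x = f k' m y"
proof -
  have *: "f k n x = f k m y \<longleftrightarrow> f l n x = f l m y" if "n \<le> k" "m \<le> k" "k \<le> l" for k l
    using inj_on_eq_iff[OF injective[OF \<open>k \<le> l\<close>], of "f k n x" "f k m y"] that x y by simp
  show ?thesis
    using *[of k "max k k'"] *[of k' "max k k'"] k by simp
qed

lemma cls_self: "x \<in> carrier (F n) \<Longrightarrow> (n, x) \<in> cls n x"
  by (auto simp: lim_class_def)

lemma mem_cls_iff:
  assumes x: "x \<in> carrier (F n)" and z: "z \<in> carrier (F p)" and l: "n \<le> l" "p \<le> l"
  shows "(p, z) \<in> cls n x \<longleftrightarrow> f l n x = f l p z"
proof
  assume "(p, z) \<in> cls n x"
  then obtain k where k: "n \<le> k" "p \<le> k" "f k n x = f k p z"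
    by (auto simp: lim_class_def)
  then show "f l n x = f l p z"
    using f_eq_iff_level[OF x z k(1,2) l] by blast
next
  assume "f l n x = f l p z"
  then show "(p, z) \<in> cls n x"
    using z l by (auto simp: lim_class_def)
qed

lemma cls_eq_iff:
  assumes x: "x \<in> carrier (F n)" and y: "y \<in> carrier (F m)" and k: "n \<le> k" "m \<le> k"
  shows "cls n x = cls m y \<longleftrightarrow> f k n x = f k m y"
proof
  assume "cls n x = cls m y"
  then have "(m, y) \<in> cls n x"
    using cls_self[OF y] by simp
  then show "f k n x = f k m y"
    using mem_cls_iff[OF x y k] by blast
next
  assume eq: "f k n x = f k m y"
  have "(p, z) \<in> cls n x \<longleftrightarrow> (p, z) \<in> cls m y" for p z
  proof (cases "z \<in> carrier (F p)")
    case True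
    define l where "l = max k p"
    have l: "n \<le> l" "m \<le> l" "p \<le> l" "k \<le> l"
      using k by (auto simp: l_def)
    have "(p, z) \<in> cls n x \<longleftrightarrow> f l n x = f l p z" "(p, z) \<in> cls m y \<longleftrightarrow> f l m y = f l p z"
      using mem_cls_iff[OF x True l(1,3)] mem_cls_iff[OF y True l(2,3)] by simp_all
    moreover have "f l n x = f l m y"
      using f_eq_iff_level[OF x y k l(1,2)] eq by blast
    ultimately show ?thesis by simp
  qed (auto simp: lim_class_def)
  then show "cls n x = cls m y"
    by auto
qed

lemma cls_f: "n \<le> m \<Longrightarrow> x \<in> carrier (F n) \<Longrightarrow> cls m (f m n x) = cls n x"
  by (subst cls_eq_iff[where k = m]) auto

lemma inj_cls: "inj_on (cls n) (carrier (F n))"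
  by (rule inj_onI) (simp add: cls_eq_iff[where k = n])

lemma lim_rep_cls:
  assumes "x \<in> carrier (F n)"
  obtains p a where "lim_rep (cls n x) = (p, a)" "a \<in> carrier (F p)" "cls p a = cls n x"
proof -
  obtain p a where pa: "lim_rep (cls n x) = (p, a)"
    by fastforce
  have "(p, a) \<in> cls n x"
    unfolding pa[symmetric] lim_rep_def using cls_self[OF assms] by (rule someI[of "\<lambda>q. q \<in> cls n x"])
  then have mem: "(p, a) \<in> cls n x" and a: "a \<in> carrier (F p)"
    by (auto simp: lim_class_def)
  have "f (max n p) n x = f (max n p) p a"
    using mem mem_cls_iff[OF assms a, of "max n p"] by simp
  then have "cls p a = cls n x"
    using cls_eq_iff[OF a assms, of "max n p"] by simp
  with pa a show ?thesis
    by (rule that)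
qed

text \<open>
  The sum is defined through chosen representatives, possibly from other levels; comparing at a level
  above all of them shows that it is the sum of any representatives from one step.
\<close>

lemma lim_add:
  assumes x: "x \<in> carrier (F n)" and y: "y \<in> carrier (F n)"
  shows "cls n x \<oplus>\<^bsub>lim_vec_space F f\<^esub> cls n y = cls n (x \<oplus>\<^bsub>F n\<^esub> y)"
proof -
  obtain p a where a: "lim_rep (cls n x) = (p, a)" "a \<in> carrier (F p)" "cls p a = cls n x"
    using lim_rep_cls[OF x] .
  obtain q b where b: "lim_rep (cls n y) = (q, b)" "b \<in> carrier (F q)" "cls q b = cls n y"
    using lim_rep_cls[OF y] .
  define m where "m = max p q"
  define k where "k = max n m"
  have le: "p \<le> m" "q \<le> m" "m \<le> k" "n \<le> k" "p \<le> k" "q \<le> k"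
    by (auto simp: m_def k_def)
  have "f k p a = f k n x" "f k q b = f k n y"
    using cls_eq_iff[OF a(2) x, of k] cls_eq_iff[OF b(2) y, of k] a(3) b(3) le by auto
  then have "cls m (f m p a \<oplus>\<^bsub>F m\<^esub> f m q b) = cls n (x \<oplus>\<^bsub>F n\<^esub> y)"
    using x y a(2) b(2) le by (subst cls_eq_iff[where k = k]) auto
  then show ?thesis
    by (simp add: lim_vec_space_def a b m_def)
qed

lemma lim_smult:
  assumes x: "x \<in> carrier (F n)"
  shows "c \<odot>\<^bsub>lim_vec_space F f\<^esub> cls n x = cls n (c \<odot>\<^bsub>F n\<^esub> x)"
proof -
  obtain p a where a: "lim_rep (cls n x) = (p, a)" "a \<in> carrier (F p)" "cls p a = cls n x"
    using lim_rep_cls[OF x] .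
  define k where "k = max n p"
  have le: "p \<le> k" "n \<le> k"
    by (auto simp: k_def)
  have "f k p a = f k n x"
    using cls_eq_iff[OF a(2) x, of k] a(3) le by auto
  then have "cls p (c \<odot>\<^bsub>F p\<^esub> a) = cls n (c \<odot>\<^bsub>F n\<^esub> x)"
    using x a(2) le by (subst cls_eq_iff[where k = k]) auto
  then show ?thesis
    by (simp add: lim_vec_space_def a)
qed

lemma f_zero: "n \<le> m \<Longrightarrow> f m n \<zero>\<^bsub>F n\<^esub> = \<zero>\<^bsub>F m\<^esub>"
  using f_smult[of n m "\<zero>\<^bsub>F n\<^esub>" 0] f_closed[of n m "\<zero>\<^bsub>F n\<^esub>"] F.zero_closed by simp

lemma lim_zero: "\<zero>\<^bsub>lim_vec_space F f\<^esub> = cls n \<zero>\<^bsub>F n\<^esub>"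
  using cls_f[of 0 n "\<zero>\<^bsub>F 0\<^esub>"] by (simp add: f_zero lim_vec_space_def)

lemma lim_carrier: "carrier (lim_vec_space F f) = (\<Union>n. cls n ` carrier (F n))"
  by (simp add: lim_vec_space_def)

lemma cls_closed: "x \<in> carrier (F n) \<Longrightarrow> cls n x \<in> carrier (lim_vec_space F f)"
  by (auto simp: lim_carrier)

text \<open>
  Any three elements of the limit live in one step \<open>F n\<close>, from which the vector space axioms are
  inherited.
\<close>

lemma common_level:
  assumes "A \<in> carrier (lim_vec_space F f)" "B \<in> carrier (lim_vec_space F f)" "C \<in> carrier (lim_vec_space F f)"
  obtains n x y z where "x \<in> carrier (F n)" "y \<in> carrier (F n)" "z \<in> carrier (F n)"
    "A = cls n x" "B = cls n y" "C = cls n z"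
proof -
  obtain p a q b r c where a: "a \<in> carrier (F p)" "A = cls p a" and b: "b \<in> carrier (F q)" "B = cls q b"
    and c: "c \<in> carrier (F r)" "C = cls r c"
    using assms unfolding lim_carrier by blast
  define n where "n = max p (max q r)"
  have "p \<le> n" "q \<le> n" "r \<le> n"
    by (auto simp: n_def)
  then show ?thesis
    using that[of "f n p a" n "f n q b" "f n r c"] a b c by (simp add: cls_f)
qed

lemma vec_space_lim: "vec_space (lim_vec_space F f)"
proof (rule vec_spaceI)
  fix A B C assume "A \<in> carrier (lim_vec_space F f)" "B \<in> carrier (lim_vec_space F f)"
    "C \<in> carrier (lim_vec_space F f)"
  then show "(A \<oplus>\<^bsub>lim_vec_space F f\<^esub> B) \<oplus>\<^bsub>lim_vec_space F f\<^esub> C = A \<oplus>\<^bsub>lim_vec_space F f\<^esub> (B \<oplus>\<^bsub>lim_vec_space F f\<^esub> C)"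
    by (elim common_level[of A B C]) (simp_all add: lim_add F.a_assoc)
next
  fix A B c assume "A \<in> carrier (lim_vec_space F f)" "B \<in> carrier (lim_vec_space F f)"
  then obtain n x y where xy: "x \<in> carrier (F n)" "y \<in> carrier (F n)" "A = cls n x" "B = cls n y"
    by (metis common_level)
  show "A \<oplus>\<^bsub>lim_vec_space F f\<^esub> B \<in> carrier (lim_vec_space F f)"
    using xy by (simp add: lim_add cls_closed)
  show "A \<oplus>\<^bsub>lim_vec_space F f\<^esub> B = B \<oplus>\<^bsub>lim_vec_space F f\<^esub> A"
    using xy by (simp add: lim_add F.a_comm)
  show "c \<odot>\<^bsub>lim_vec_space F f\<^esub> (A \<oplus>\<^bsub>lim_vec_space F f\<^esub> B) =
      c \<odot>\<^bsub>lim_vec_space F f\<^esub> A \<oplus>\<^bsub>lim_vec_space F f\<^esub> c \<odot>\<^bsub>lim_vec_space F f\<^esub> B"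
    using xy by (simp add: lim_add lim_smult F.smult_add_right)
next
  fix A a b assume "A \<in> carrier (lim_vec_space F f)"
  then obtain n x where x: "x \<in> carrier (F n)" "A = cls n x"
    by (metis common_level)
  note simps = x lim_add lim_smult lim_zero[of n]
  show "a \<odot>\<^bsub>lim_vec_space F f\<^esub> A \<in> carrier (lim_vec_space F f)"
    by (simp add: simps cls_closed)
  show "\<zero>\<^bsub>lim_vec_space F f\<^esub> \<oplus>\<^bsub>lim_vec_space F f\<^esub> A = A"
    by (simp add: simps)
  show "0 \<odot>\<^bsub>lim_vec_space F f\<^esub> A = \<zero>\<^bsub>lim_vec_space F f\<^esub>"
    by (simp add: simps)
  show "(a + b) \<odot>\<^bsub>lim_vec_space F f\<^esub> A = a \<odot>\<^bsub>lim_vec_space F f\<^esub> A \<oplus>\<^bsub>lim_vec_space F f\<^esub> b \<odot>\<^bsub>lim_vec_space F f\<^esub> A"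
    by (simp add: simps F.smult_add_left)
  show "(a * b) \<odot>\<^bsub>lim_vec_space F f\<^esub> A = a \<odot>\<^bsub>lim_vec_space F f\<^esub> (b \<odot>\<^bsub>lim_vec_space F f\<^esub> A)"
    by (simp add: simps F.smult_smult)
  show "1 \<odot>\<^bsub>lim_vec_space F f\<^esub> A = A"
    by (simp add: simps)
qed (use lim_zero[of 0] in \<open>simp add: cls_closed\<close>)

lemma L_simps [simp]:
  "carrier L = carrier (lim_vec_space F f)" "add L = add (lim_vec_space F f)"
  "zero L = zero (lim_vec_space F f)" "smult L = smult (lim_vec_space F f)"
  by (simp_all add: ind_lim_def)

lemma linear_cls: "linear_map (F n) L (cls n)"
  by (auto simp: linear_map_def lim_add lim_smult cls_closed)

text \<open>
  The topologies whose supremum is the topology of the limit.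
\<close>

definition admissible :: "(nat \<times> 'a) set topology \<Rightarrow> bool" where
  "admissible T \<longleftrightarrow> loc_convex (with_topol (lim_vec_space F f) T) \<and>
     (\<forall>n. continuous_map (topol (F n)) T (cls n))"

lemma topol_L: "topol L = topology_generated_by (\<Union>{{U. openin T U} | T. admissible T})"
  by (simp add: ind_lim_def admissible_def)

lemma ex_admissible: "\<exists>T. admissible T"
proof -
  let ?I = "pullback_topology (carrier (lim_vec_space F f)) (\<lambda>_. ()) (discrete_topology UNIV)"
  have "continuous_map (topol (F n)) ?I (cls n)" for n
    by (rule continuous_map_pullback') (auto simp: cls_closed o_def)
  then have "admissible ?I"
    using loc_convex_indiscrete[OF vec_space_lim] by (simp add: admissible_def)
  then show ?thesis ..
qed

lemma topspace_admissible: "admissible T \<Longrightarrow> topspace T = carrier L"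
  by (simp add: admissible_def loc_convex_def top_vec_space_def)

lemma topspace_L: "topspace (topol L) = carrier L"
proof -
  have "{T. admissible T} \<noteq> {}"
    using ex_admissible by blast
  have "\<Union>{U. openin T U} = carrier L" if "admissible T" for T
    unfolding topspace_admissible[OF that, symmetric] topspace_def ..
  then have "(\<Union>T\<in>{T. admissible T}. \<Union>{U. openin T U}) = carrier L"
    using \<open>{T. admissible T} \<noteq> {}\<close> by auto
  moreover have "topspace (topol L) = (\<Union>T\<in>{T. admissible T}. \<Union>{U. openin T U})"
    unfolding topol_L topology_generated_by_topspace by auto
  ultimately show ?thesis
    by simp
qed

lemma continuous_into_L:
  assumes "\<And>T. admissible T \<Longrightarrow> continuous_map Y T g"
  shows "continuous_map Y (topol L) g"
  unfolding topol_L
proof (rule continuous_on_generated_topo)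
  fix U assume "U \<in> \<Union>{{U. openin T U} | T. admissible T}"
  then obtain T where "admissible T" "openin T U"
    by blast
  then show "openin Y (g -` U \<inter> topspace Y)"
    using assms[of T] by (simp add: continuous_map_alt)
next
  obtain T where T: "admissible T"
    using ex_admissible ..
  have "g ` topspace Y \<subseteq> topspace T"
    using assms[OF T] by (auto simp: continuous_map_def)
  then show "g ` topspace Y \<subseteq> \<Union>(\<Union>{{U. openin T U} | T. admissible T})"
    using T openin_topspace by blast
qed

lemma continuous_from_L: "admissible T \<Longrightarrow> continuous_map (topol L) T (\<lambda>x. x)"
proof -
  assume T: "admissible T"
  have open_L: "openin (topol L) U" if "openin T U" for U
    unfolding topol_L using T that by (intro topology_generated_by_Basis) blast
  show "continuous_map (topol L) T (\<lambda>x. x)"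
    unfolding continuous_map_def topspace_L topspace_admissible[OF T]
  proof (intro conjI allI impI)
    fix U assume U: "openin T U"
    then have "{x \<in> carrier L. x \<in> U} = U"
      using openin_subset[OF U] topspace_admissible[OF T] by blast
    then show "openin (topol L) {x \<in> carrier L. x \<in> U}"
      using open_L[OF U] by simp
  qed simp
qed

text \<open>
  A map into the supremum of a family of topologies is continuous if it is so for each member, and the
  identity from the supremum to each member is continuous; the operations inherit their continuity.
\<close>

lemma top_vec_space_L: "top_vec_space L"
  unfolding top_vec_space_def
proof (intro conjI topspace_L)
  show "vec_space L"
    unfolding ind_lim_def by (rule vec_space_with_topol[OF vec_space_lim])
  show "continuous_map (prod_topology (topol L) (topol L)) (topol L) (\<lambda>(x, y). x \<oplus>\<^bsub>L\<^esub> y)"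
  proof (rule continuous_into_L)
    fix T assume T: "admissible T"
    have "continuous_map (prod_topology (topol L) (topol L)) (prod_topology T T) (\<lambda>p. (fst p, snd p))"
      unfolding continuous_map_paired
      by (intro conjI continuous_map_compose[OF continuous_map_fst continuous_from_L[OF T], unfolded o_def]
          continuous_map_compose[OF continuous_map_snd continuous_from_L[OF T], unfolded o_def])
    moreover have "continuous_map (prod_topology T T) T (\<lambda>(x, y). x \<oplus>\<^bsub>L\<^esub> y)"
      using T by (simp add: admissible_def loc_convex_def top_vec_space_def)
    ultimately show "continuous_map (prod_topology (topol L) (topol L)) T (\<lambda>(x, y). x \<oplus>\<^bsub>L\<^esub> y)"
      using continuous_map_compose by (fastforce simp: o_def case_prod_unfold)
  qed
  show "continuous_map (prod_topology euclidean (topol L)) (topol L) (\<lambda>(c, x). c \<odot>\<^bsub>L\<^esub> x)"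
  proof (rule continuous_into_L)
    fix T assume T: "admissible T"
    have "continuous_map (prod_topology euclidean (topol L)) (prod_topology euclidean T) (\<lambda>p. (fst p, snd p))"
      unfolding continuous_map_paired
      by (intro conjI continuous_map_fst
          continuous_map_compose[OF continuous_map_snd continuous_from_L[OF T], unfolded o_def])
    moreover have "continuous_map (prod_topology euclidean T) T (\<lambda>(c, x). c \<odot>\<^bsub>L\<^esub> x)"
      using T by (simp add: admissible_def loc_convex_def top_vec_space_def)
    ultimately show "continuous_map (prod_topology euclidean (topol L)) T (\<lambda>(c, x). c \<odot>\<^bsub>L\<^esub> x)"
      using continuous_map_compose by (fastforce simp: o_def case_prod_unfold)
  qed
qed

lemma cont_linear_cls: "cont_linear (F n) L (cls n)"
  using linear_cls by (auto simp: cont_linear_def admissible_def intro: continuous_into_L)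

end

section \<open>The functor IB on locally convex spaces\<close>

lemma bounded_disc_iff:
  "top_vec_space E \<Longrightarrow> bounded_disc E B \<longleftrightarrow> abs_convex_in E B \<and> bounded_in E B"
  by (auto simp: bounded_disc_def disc_def tvs_def bounded_disc_axioms_def top_vec_space_def)

lemma bounded_disc_image:
  assumes B: "bounded_disc E B" and F: "top_vec_space F" and h: "cont_linear E F h"
  shows "bounded_disc F (h ` B)"
proof -
  interpret B: bounded_disc E B by (rule B)
  interpret F: tvs F by (rule tvs.intro[OF F])
  interpret complex_linear E F h
    using h by (intro complex_linear.intro complex_linear_axioms.intro B.complex_space_axioms F.complex_space_axioms)
      (simp add: cont_linear_def)
  interpret hB: disc F "h ` B"
    by (rule abs_convex_image[OF B.disc_axioms F.vec_space linear])
  have "\<exists>s>0. \<forall>c. s \<le> cmod c \<longrightarrow> h ` B \<subseteq> (\<lambda>x. c \<odot>\<^bsub>F\<^esub> x) ` U" if U: "F.nbhd U" for U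
  proof -
    define V where "V = {x \<in> carrier E. h x \<in> U}"
    have "B.nbhd V"
      unfolding V_def B.nbhd_def using h U openin_continuous_map_preimage[of "topol E" "topol F" h U]
      by (auto simp: cont_linear_def F.nbhd_def)
    then obtain s where s: "s > 0" "\<And>c. s \<le> cmod c \<Longrightarrow> B \<subseteq> (\<lambda>x. c \<odot>\<^bsub>E\<^esub> x) ` V"
      using B.bounded unfolding bounded_in_def B.nbhd_def by blast
    have "h b \<in> (\<lambda>x. c \<odot>\<^bsub>F\<^esub> x) ` U" if c: "s \<le> cmod c" and b: "b \<in> B" for c b
    proof -
      obtain v where "v \<in> V" "b = c \<odot>\<^bsub>E\<^esub> v"
        using s(2)[OF c] b by blast
      then show ?thesis
        by (auto simp: V_def)
    qed
    then show ?thesis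
      using s(1) by blast
  qed
  then have "bounded_in F (h ` B)"
    using hB.disc_carrier by (auto simp: bounded_in_def F.nbhd_def)
  then show ?thesis
    by (intro bounded_disc.intro bounded_disc_axioms.intro F.tvs_axioms hB.disc_axioms)
qed

text \<open>
  The sum \<open>B \<oplus> C\<close> contains both sets, as zero belongs to each.
\<close>

lemma bounded_disc_directed:
  assumes B: "bounded_disc E B" and C: "bounded_disc E C"
  shows "\<exists>D. bounded_disc E D \<and> B \<subseteq> D \<and> C \<subseteq> D"
proof -
  interpret B: bounded_disc E B by (rule B)
  interpret C: bounded_disc E C by (rule C)
  define D where "D = {b \<oplus>\<^bsub>E\<^esub> c | b c. b \<in> B \<and> c \<in> C}"
  have D: "b \<oplus>\<^bsub>E\<^esub> c \<in> D" if "b \<in> B" "c \<in> C" for b c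
    using that by (auto simp: D_def)
  have carrier: "D \<subseteq> carrier E"
    using B.disc_carrier C.disc_carrier by (auto simp: D_def)
  have "b \<in> D" if "b \<in> B" for b
    using D[OF that C.disc_zero] B.disc_carrier[OF that] by simp
  moreover have "c \<in> D" if "c \<in> C" for c
    using D[OF B.disc_zero that] C.disc_carrier[OF that] by simp
  moreover have "abs_convex_in E D"
    unfolding abs_convex_in_def
  proof (intro conjI ballI allI impI carrier)
    show "D \<noteq> {}"
      using D[OF B.disc_zero C.disc_zero] by blast
    fix x y p q assume "x \<in> D" "y \<in> D" and pq: "cmod p + cmod q \<le> 1"
    then obtain b c b' c' where x: "b \<in> B" "c \<in> C" "x = b \<oplus>\<^bsub>E\<^esub> c" and y: "b' \<in> B" "c' \<in> C" "y = b' \<oplus>\<^bsub>E\<^esub> c'"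
      by (auto simp: D_def)
    have cl: "b \<in> carrier E" "c \<in> carrier E" "b' \<in> carrier E" "c' \<in> carrier E"
      using x y B.disc_carrier C.disc_carrier by auto
    have "p \<odot>\<^bsub>E\<^esub> x \<oplus>\<^bsub>E\<^esub> q \<odot>\<^bsub>E\<^esub> y =
        (p \<odot>\<^bsub>E\<^esub> b \<oplus>\<^bsub>E\<^esub> q \<odot>\<^bsub>E\<^esub> b') \<oplus>\<^bsub>E\<^esub> (p \<odot>\<^bsub>E\<^esub> c \<oplus>\<^bsub>E\<^esub> q \<odot>\<^bsub>E\<^esub> c')"
      using cl by (simp add: x y B.smult_add_right B.add_add_add)
    then show "p \<odot>\<^bsub>E\<^esub> x \<oplus>\<^bsub>E\<^esub> q \<odot>\<^bsub>E\<^esub> y \<in> D"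
      using D[OF B.disc_comb[OF x(1) y(1) pq] C.disc_comb[OF x(2) y(2) pq]] by simp
  qed
  moreover have "bounded_in E D"
    unfolding bounded_in_def
  proof (intro conjI allI impI carrier)
    fix U assume "openin (topol E) U \<and> \<zero>\<^bsub>E\<^esub> \<in> U"
    then obtain V where V: "B.nbhd V" "\<And>x y. x \<in> V \<Longrightarrow> y \<in> V \<Longrightarrow> x \<oplus>\<^bsub>E\<^esub> y \<in> U"
      using B.nbhd_sum_diff unfolding B.nbhd_def by metis
    obtain s where s: "s > 0" "\<And>c. s \<le> cmod c \<Longrightarrow> B \<subseteq> (\<lambda>x. c \<odot>\<^bsub>E\<^esub> x) ` V"
      using B.bounded V(1) unfolding bounded_in_def B.nbhd_def by blast
    obtain t where t: "t > 0" "\<And>c. t \<le> cmod c \<Longrightarrow> C \<subseteq> (\<lambda>x. c \<odot>\<^bsub>E\<^esub> x) ` V"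
      using C.bounded V(1) unfolding bounded_in_def B.nbhd_def by blast
    have "x \<in> (\<lambda>x. p \<odot>\<^bsub>E\<^esub> x) ` U" if x: "x \<in> D" and p: "max s t \<le> cmod p" for x p
    proof -
      obtain b c where bc: "b \<in> B" "c \<in> C" "x = b \<oplus>\<^bsub>E\<^esub> c"
        using x by (auto simp: D_def)
      obtain v where v: "v \<in> V" "b = p \<odot>\<^bsub>E\<^esub> v"
        using s(2)[of p] p bc(1) by auto
      obtain w where w: "w \<in> V" "c = p \<odot>\<^bsub>E\<^esub> w"
        using t(2)[of p] p bc(2) by auto
      have "x = p \<odot>\<^bsub>E\<^esub> (v \<oplus>\<^bsub>E\<^esub> w)"
        using v w B.nbhd_carrier[OF V(1)] by (simp add: bc B.smult_add_right)
      then show ?thesis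
        using V(2)[OF v(1) w(1)] by blast
    qed
    then show "\<exists>s>0. \<forall>c. s \<le> cmod c \<longrightarrow> D \<subseteq> (\<lambda>x. c \<odot>\<^bsub>E\<^esub> x) ` U"
      using s(1) t(1) by (intro exI[of _ "max s t"]) auto
  qed
  ultimately show ?thesis
    using B.tvs bounded_disc_iff by blast
qed

lemma disc_bounded_disc: "bounded_disc E B \<Longrightarrow> disc E B"
  by (simp add: bounded_disc_def)

text \<open>
  An injective linear map \<open>h\<close> identifies the space spanned by \<open>B\<close> isometrically with the one spanned
  by \<open>h ` B\<close>. The inverse is linear only on the latter, so \<open>short_map_hull\<close> does not cover it.
\<close>

lemma short_map_hull_inv:
  assumes B: "disc E B" and F: "vec_space F" and h: "linear_map E F h" and inj: "inj_on h (carrier E)"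
  shows "short_map (hull_space F (h ` B)) (hull_space E B) (inv_into (carrier E) h)"
proof -
  interpret B: disc E B by (rule B)
  interpret C: disc F "h ` B" by (rule abs_convex_image[OF B F h])
  interpret complex_linear E F h
    by (intro complex_linear.intro complex_linear_axioms.intro B.complex_space_axioms C.complex_space_axioms h)
  let ?g = "inv_into (carrier E) h"
  have g_h: "?g (h x) = x" if "x \<in> carrier E" for x
    using inv_into_f_f[OF inj that] .
  have hull: "\<exists>x\<in>linear_hull E B. y = h x" if "y \<in> linear_hull F (h ` B)" for y
    using that
  proof (rule C.hullE)
    fix t b' assume "0 < t" "b' \<in> h ` B" "y = complex_of_real t \<odot>\<^bsub>F\<^esub> b'"
    then obtain b where b: "b \<in> B" "y = complex_of_real t \<odot>\<^bsub>F\<^esub> h b"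
      by blast
    then have "y = h (complex_of_real t \<odot>\<^bsub>E\<^esub> b)"
      using B.disc_carrier by simp
    then show ?thesis
      using B.hullI[OF \<open>0 < t\<close> b(1)] by blast
  qed
  have gauge: "B.gauge x \<le> C.gauge (h x)" if x: "x \<in> linear_hull E B" and hx: "h x \<in> linear_hull F (h ` B)" for x
  proof (rule dense_ge)
    fix t assume t: "C.gauge (h x) < t"
    then obtain b where b: "b \<in> B" "h x = complex_of_real t \<odot>\<^bsub>F\<^esub> h b"
      using C.gauge_lessE[OF hx] by blast
    then have "h x = h (complex_of_real t \<odot>\<^bsub>E\<^esub> b)"
      using B.disc_carrier by simp
    then have "x = complex_of_real t \<odot>\<^bsub>E\<^esub> b"
      using inj_onD[OF inj] B.hull_carrier[OF x] B.disc_carrier[OF b(1)] by blast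
    moreover have "0 < t"
      using t C.gauge_nonneg[OF hx] by linarith
    ultimately show "B.gauge x \<le> t"
      using B.gauge_le b(1) by simp
  qed
  have g: "?g y \<in> linear_hull E B \<and> h (?g y) = y" if "y \<in> linear_hull F (h ` B)" for y
    using hull[OF that] g_h B.hull_carrier by auto
  have "linear_map (hull_space F (h ` B)) (hull_space E B) ?g"
    unfolding linear_map_def
  proof (intro conjI ballI allI)
    show "?g \<in> carrier (hull_space F (h ` B)) \<rightarrow> carrier (hull_space E B)"
      using g by simp
  next
    fix y z assume "y \<in> carrier (hull_space F (h ` B))" "z \<in> carrier (hull_space F (h ` B))"
    then obtain x w where "x \<in> linear_hull E B" "y = h x" "w \<in> linear_hull E B" "z = h w"
      using hull[of y] hull[of z] by auto
    then show "?g (y \<oplus>\<^bsub>hull_space F (h ` B)\<^esub> z) = ?g y \<oplus>\<^bsub>hull_space E B\<^esub> ?g z"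
      using g_h[of "x \<oplus>\<^bsub>E\<^esub> w"] g_h B.hull_carrier by simp
  next
    fix c y assume "y \<in> carrier (hull_space F (h ` B))"
    then obtain x where "x \<in> linear_hull E B" "y = h x"
      using hull by auto
    then show "?g (c \<odot>\<^bsub>hull_space F (h ` B)\<^esub> y) = c \<odot>\<^bsub>hull_space E B\<^esub> ?g y"
      using g_h[of "c \<odot>\<^bsub>E\<^esub> x"] g_h B.hull_carrier by simp
  qed
  moreover have "B.gauge (?g y) \<le> C.gauge y" if "y \<in> linear_hull F (h ` B)" for y
    using gauge[of "?g y"] g[OF that] that by simp
  ultimately show ?thesis
    by (simp add: short_map_def B.seminormed_space_hull C.seminormed_space_hull)
qed

lemma linear_map_id: "linear_map E E (\<lambda>x. x)"
  by (simp add: linear_map_def)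

lemma short_map_inclusion:
  assumes "bounded_disc E B" "bounded_disc E C" "B \<subseteq> C"
  shows "short_map (hull_space E B) (hull_space E C) (\<lambda>x. x)"
  using assms by (intro short_map_hull linear_map_id) (auto simp: bounded_disc_def)

lemma ind_diagram_IB:
  assumes E: "top_vec_space E"
  shows "ind_diagram (IB E)"
proof (rule ind_diagram.intro)
  show "vec_space (obj (IB E) B)" if "B \<in> idx (IB E)" for B
  proof -
    interpret bounded_disc E B
      using that E by (simp add: IB_def bounded_disc_iff)
    show ?thesis
      by (simp add: IB_def hull.vec_space_completion)
  qed
  show "trans (IB E) B C \<in> ban_hom (obj (IB E) B) (obj (IB E) C)"
    if "B \<in> idx (IB E)" "C \<in> idx (IB E)" "le (IB E) B C" for B C
  proof -
    interpret short_linear "hull_space E B" "hull_space E C" "\<lambda>x. x"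
      using that E by (intro short_linear.intro short_map_inclusion) (auto simp: IB_def bounded_disc_iff)
    show ?thesis
      by (simp add: IB_def completion_map_in_ban_hom)
  qed
  show "trans (IB E) B B = ban_id (obj (IB E) B)" if "B \<in> idx (IB E)" for B
  proof -
    interpret bounded_disc E B
      using that E by (simp add: IB_def bounded_disc_iff)
    show ?thesis
      by (simp add: IB_def completion_map_id[OF seminormed_space_hull])
  qed
  show "compose (carrier (obj (IB E) B)) (trans (IB E) C D) (trans (IB E) B C) = trans (IB E) B D"
    if "B \<in> idx (IB E)" "C \<in> idx (IB E)" "D \<in> idx (IB E)" "le (IB E) B C" "le (IB E) C D" for B C D
    using that E completion_map_compose[OF short_map_inclusion short_map_inclusion, of E B C D]
    by (simp add: IB_def bounded_disc_iff o_def)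
  show "\<exists>D\<in>idx (IB E). le (IB E) B D \<and> le (IB E) C D" if "B \<in> idx (IB E)" "C \<in> idx (IB E)" for B C
    using that E bounded_disc_directed[of E B C] by (auto simp: IB_def bounded_disc_iff)
qed (auto simp: IB_def)

section \<open>Bounded sets of the limit come from a step\<close>

context injective_system begin

lemma top_vec_space_F: "top_vec_space (F n)"
  by (rule F.tvs)

lemma idx_lim_IB: "idx (lim_IB F f) = {(n, B). bounded_disc (F n) B}"
  by (auto simp: lim_IB_def seq_ind_lim_def IB_def bounded_disc_iff top_vec_space_F)

lemma le_lim_IB: "le (lim_IB F f) (n, B) (m, C) \<longleftrightarrow> n \<le> m \<and> f m n ` B \<subseteq> C"
  by (simp add: lim_IB_def seq_ind_lim_def IB_def)

lemma obj_lim_IB: "obj (lim_IB F f) (n, B) = completion (hull_space (F n) B)"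
  by (simp add: lim_IB_def seq_ind_lim_def IB_def)

lemma bounded_disc_f: "bounded_disc (F n) B \<Longrightarrow> n \<le> m \<Longrightarrow> bounded_disc (F m) (f m n ` B)"
  using bounded_disc_image top_vec_space_F cont by blast

lemma short_map_f:
  assumes "bounded_disc (F n) B" "bounded_disc (F m) C" "n \<le> m" "f m n ` B \<subseteq> C"
  shows "short_map (hull_space (F n) B) (hull_space (F m) C) (f m n)"
  using assms by (intro short_map_hull disc_bounded_disc linear_f)

lemma trans_lim_IB:
  assumes B: "bounded_disc (F n) B" and C: "bounded_disc (F m) C" and le: "n \<le> m" "f m n ` B \<subseteq> C"
  shows "trans (lim_IB F f) (n, B) (m, C) = completion_map (hull_space (F n) B) (hull_space (F m) C) (f m n)"
  using completion_map_compose[OF short_map_f[OF B bounded_disc_f[OF B le(1)] le(1) subset_refl]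
      short_map_inclusion[OF bounded_disc_f[OF B le(1)] C le(2)]]
  by (simp add: lim_IB_def seq_ind_lim_def IB_def o_def)

lemma ind_diagram_lim_IB: "ind_diagram (lim_IB F f)"
proof (rule ind_diagram.intro)
  let ?X = "lim_IB F f"
  note simps = idx_lim_IB le_lim_IB obj_lim_IB
  fix p assume "p \<in> idx ?X"
  then obtain n B where p: "p = (n, B)" and B: "bounded_disc (F n) B"
    by (auto simp: simps)
  interpret B: bounded_disc "F n" B by (rule B)
  show "le ?X p p"
    using B.disc_carrier by (auto simp: p simps)
  show "vec_space (obj ?X p)"
    by (simp add: p simps B.hull.vec_space_completion)
  show "trans ?X p p = ban_id (obj ?X p)"
    using B.disc_carrier B.hull_carrier
    by (auto simp: p simps trans_lim_IB[OF B B] image_subset_iff intro!: completion_map_id B.seminormed_space_hull)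
  fix q assume "q \<in> idx ?X"
  then obtain m C where q: "q = (m, C)" and C: "bounded_disc (F m) C"
    by (auto simp: simps)
  show "\<exists>r\<in>idx ?X. le ?X p r \<and> le ?X q r"
  proof -
    define k where "k = max n m"
    have k: "n \<le> k" "m \<le> k"
      by (auto simp: k_def)
    obtain D where "bounded_disc (F k) D" "f k n ` B \<subseteq> D" "f k m ` C \<subseteq> D"
      using bounded_disc_directed[OF bounded_disc_f[OF B k(1)] bounded_disc_f[OF C k(2)]] by blast
    then show ?thesis
      using k by (intro bexI[of _ "(k, D)"]) (auto simp: p q simps)
  qed
  show "trans ?X p q \<in> ban_hom (obj ?X p) (obj ?X q)" if "le ?X p q"
  proof -
    have le: "n \<le> m" "f m n ` B \<subseteq> C"
      using that by (auto simp: p q simps)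
    interpret short_linear "hull_space (F n) B" "hull_space (F m) C" "f m n"
      by (rule short_linear.intro[OF short_map_f[OF B C le]])
    show ?thesis
      by (simp add: p q simps trans_lim_IB[OF B C le] completion_map_in_ban_hom)
  qed
  fix r assume "r \<in> idx ?X"
  then obtain k D where r: "r = (k, D)" and D: "bounded_disc (F k) D"
    by (auto simp: simps)
  assume "le ?X p q" "le ?X q r"
  then have le: "n \<le> m" "f m n ` B \<subseteq> C" "m \<le> k" "f k m ` C \<subseteq> D"
    by (auto simp: p q r simps)
  have f_f_B: "f k m (f m n x) = f k n x" if "x \<in> carrier (F n)" for x
    using that le by simp
  have le': "n \<le> k" "f k n ` B \<subseteq> D"
  proof -
    show "f k n ` B \<subseteq> D"
    proof
      fix y assume "y \<in> f k n ` B"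
      then obtain x where x: "x \<in> B" "y = f k n x"
        by blast
      then have "y = f k m (f m n x)"
        using f_f_B B.disc_carrier by simp
      then show "y \<in> D"
        using le x(1) by blast
    qed
  qed (use le in simp)
  then show "le ?X p r"
    by (simp add: p r simps)
  show "compose (carrier (obj ?X p)) (trans ?X q r) (trans ?X p q) = trans ?X p r"
    unfolding p q r obj_lim_IB trans_lim_IB[OF B C le(1,2)] trans_lim_IB[OF C D le(3,4)] trans_lim_IB[OF B D le']
      completion_map_compose[OF short_map_f[OF B C le(1,2)] short_map_f[OF C D le(3,4)]]
    by (rule completion_map_cong[OF B.seminormed_space_hull]) (simp add: f_f_B B.hull_carrier)
qed

lemma bounded_disc_cls: "bounded_disc (F n) B \<Longrightarrow> bounded_disc L (cls n ` B)"
  using bounded_disc_image top_vec_space_L cont_linear_cls by blast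

text \<open>
  As \<open>L\<close> is complete, the closure \<open>K\<close> of \<open>B\<close> spans a Banach space; the factorization theorem turns
  this into a step \<open>n\<close> at which the preimage of \<open>K\<close> is bounded and has all of \<open>K\<close> as its image.
\<close>

lemma bounded_disc_from_step:
  assumes frechet: "\<And>n. frechet_space (F n)" and complete: "complete_tvs L" and B: "bounded_disc L B"
  shows "\<exists>n C. bounded_disc (F n) C \<and> B \<subseteq> cls n ` C"
proof -
  interpret B0: bounded_disc L B by (rule B)
  define K where "K = topol L closure_of B"
  interpret K: bounded_disc L K
    unfolding K_def by (rule B0.bounded_disc_closure)
  have BK: "B \<subseteq> K"
    unfolding K_def using B0.disc_carrier by (intro closure_of_subset) (auto simp: topspace_L)
  have banach: "banach_space (hull_space L K)"
    by (rule K.banach_space_hull[OF complete]) (simp add: K_def)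
  interpret G: banach_to_frechet_union "hull_space L K" L F "\<lambda>x. x" cls
  proof
    show "Hausdorff_space (topol L)"
      using complete by (simp add: complete_tvs_def)
    show "linear_map (hull_space L K) L (\<lambda>x. x)"
      using K.hull_carrier by (auto simp: linear_map_def)
    show "\<exists>r>0. \<forall>x\<in>carrier (hull_space L K). snorm (hull_space L K) x < r \<longrightarrow> x \<in> U"
      if "openin (topol L) U" "\<zero>\<^bsub>L\<^esub> \<in> U" for U
      using K.gauge_small_nbhd[of U] that by (simp add: B0.nbhd_def)
    show "(\<lambda>x. x) ` carrier (hull_space L K) \<subseteq> (\<Union>n. cls n ` carrier (F n))"
      using K.hull_carrier by (auto simp: lim_carrier)
  qed (use banach top_vec_space_L frechet cont_linear_cls in auto)
  obtain n where n: "\<And>W. F.nbhd n W \<Longrightarrow>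
      \<exists>r>0. \<forall>x\<in>linear_hull L K. K.gauge x < r \<longrightarrow> x \<in> cls n ` W"
    using G.ball_in_image by auto
  define C where "C = {y \<in> carrier (F n). cls n y \<in> K}"
  \<comment> \<open>All large multiples of a neighbourhood of zero in \<open>F n\<close> have an image containing \<open>K\<close>. With the
     whole space this gives \<open>K \<subseteq> cls n ` C\<close>, with small neighbourhoods the boundedness of \<open>C\<close>.\<close>
  have absorb: "\<exists>s>0. \<forall>c. s \<le> cmod c \<longrightarrow> K \<subseteq> (\<lambda>w. cls n (c \<odot>\<^bsub>F n\<^esub> w)) ` W" if W: "F.nbhd n W" for W
  proof -
    obtain r where r: "r > 0" "\<And>x. x \<in> linear_hull L K \<Longrightarrow> K.gauge x < r \<Longrightarrow> x \<in> cls n ` W"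
      using n[OF W] by blast
    have "b \<in> (\<lambda>w. cls n (c \<odot>\<^bsub>F n\<^esub> w)) ` W" if c: "2 / r \<le> cmod c" and b: "b \<in> K" for c b
    proof -
      have pos: "cmod c > 0"
        using c r(1) by (meson divide_pos_pos less_le_trans zero_less_numeral)
      then have c0: "c \<noteq> 0"
        by simp
      have "K.gauge (inverse c \<odot>\<^bsub>L\<^esub> b) = inverse (cmod c) * K.gauge b"
        using K.gauge_smult[OF K.disc_hull[OF b]] by (simp add: norm_inverse)
      also have "\<dots> \<le> inverse (cmod c) * 1"
        using K.gauge_disc_le[OF b] by (intro mult_left_mono) auto
      also have "\<dots> < r"
        using c r(1) pos by (simp add: field_simps)
      finally obtain w where w: "w \<in> W" "inverse c \<odot>\<^bsub>L\<^esub> b = cls n w"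
        using r(2)[OF K.hull_smult[OF K.disc_hull[OF b]]] by blast
      have "b = c \<odot>\<^bsub>L\<^esub> (inverse c \<odot>\<^bsub>L\<^esub> b)"
        using B0.smult_inverse_cancel(1)[OF c0 K.disc_carrier[OF b]] by simp
      also have "\<dots> = cls n (c \<odot>\<^bsub>F n\<^esub> w)"
        unfolding w(2) using F.nbhd_carrier[OF W w(1)] by (simp add: G.i.h_smult)
      finally show ?thesis
        using w(1) by blast
    qed
    then show ?thesis
      using r(1) by (intro exI[of _ "2 / r"]) auto
  qed
  have "F.nbhd n (carrier (F n))"
    using openin_topspace[of "topol (F n)"] by (simp add: F.nbhd_def)
  from absorb[OF this] obtain s where s: "s > 0"
    "\<And>c. s \<le> cmod c \<Longrightarrow> K \<subseteq> (\<lambda>w. cls n (c \<odot>\<^bsub>F n\<^esub> w)) ` carrier (F n)"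
    by blast
  have "K \<subseteq> cls n ` C"
  proof
    fix b assume b: "b \<in> K"
    have "b \<in> (\<lambda>w. cls n (complex_of_real s \<odot>\<^bsub>F n\<^esub> w)) ` carrier (F n)"
      using s(2)[of "complex_of_real s"] s(1) b by auto
    then obtain y where "y \<in> carrier (F n)" "b = cls n y"
      by blast
    then show "b \<in> cls n ` C"
      using b by (auto simp: C_def)
  qed
  moreover have "abs_convex_in (F n) C"
    unfolding abs_convex_in_def
  proof (intro conjI ballI allI impI)
    show "C \<noteq> {}"
      using \<open>K \<subseteq> cls n ` C\<close> K.disc_zero by blast
    fix x y a b assume "x \<in> C" "y \<in> C" and ab: "cmod a + cmod b \<le> 1"
    then show "a \<odot>\<^bsub>F n\<^esub> x \<oplus>\<^bsub>F n\<^esub> b \<odot>\<^bsub>F n\<^esub> y \<in> C"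
      using K.disc_comb[OF _ _ ab, of "cls n x" "cls n y"] by (simp add: C_def)
  qed (auto simp: C_def)
  moreover have "bounded_in (F n) C"
    unfolding bounded_in_def
  proof (intro conjI allI impI)
    fix W assume "openin (topol (F n)) W \<and> \<zero>\<^bsub>F n\<^esub> \<in> W"
    then have W: "F.nbhd n W"
      by (simp add: F.nbhd_def)
    obtain s where s: "s > 0" "\<And>c. s \<le> cmod c \<Longrightarrow> K \<subseteq> (\<lambda>w. cls n (c \<odot>\<^bsub>F n\<^esub> w)) ` W"
      using absorb[OF W] by blast
    have "y \<in> (\<lambda>x. c \<odot>\<^bsub>F n\<^esub> x) ` W" if c: "s \<le> cmod c" and y: "y \<in> C" for c y
    proof -
      obtain w where w: "w \<in> W" "cls n y = cls n (c \<odot>\<^bsub>F n\<^esub> w)"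
        using s(2)[OF c] y by (auto simp: C_def)
      have "y \<in> carrier (F n)" "c \<odot>\<^bsub>F n\<^esub> w \<in> carrier (F n)"
        using y F.nbhd_carrier[OF W w(1)] by (auto simp: C_def)
      then have "y = c \<odot>\<^bsub>F n\<^esub> w"
        by (rule inj_onD[OF inj_cls w(2)])
      then show ?thesis
        using w(1) by blast
    qed
    then show "\<exists>s>0. \<forall>c. s \<le> cmod c \<longrightarrow> C \<subseteq> (\<lambda>x. c \<odot>\<^bsub>F n\<^esub> x) ` W"
      using s(1) by blast
  qed (auto simp: C_def)
  ultimately show ?thesis
    using BK bounded_disc_iff[OF top_vec_space_F] by blast
qed

end

text \<open>
  At the index \<open>(n, B)\<close> the canonical morphism is represented by the map induced by \<open>cls n\<close>, with
  inverse induced by the inverse of \<open>cls n\<close> on its image.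
\<close>

theorem proposition1p8:
  fixes F :: "nat \<Rightarrow> 'a tvs" and f :: "nat \<Rightarrow> nat \<Rightarrow> 'a \<Rightarrow> 'a"
  assumes "inductive_system F f"
    and "\<And>n. frechet_space (F n)"
    and "\<And>m n. n \<le> m \<Longrightarrow> inj_on (f m n) (carrier (F n))"
    and "complete_tvs (ind_lim F f)"
  shows "ind_iso (lim_IB F f) (IB (ind_lim F f)) (canonical_mor F f)"
proof -
  interpret injective_system F f
    using assms by unfold_locales
  let ?X = "lim_IB F f" and ?Y = "IB L"
  define \<sigma> where "\<sigma> = (\<lambda>(n, B). cls n ` B)"
  define g where "g = (\<lambda>(n, B). IB_comp (F n) L (cls n) B)"
  define h where "h = (\<lambda>(n, B). completion_map (hull_space L (cls n ` B)) (hull_space (F n) B)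
    (inv_into (carrier (F n)) (cls n)))"
  have idx_Y: "idx ?Y = {B. bounded_disc L B}"
    using bounded_disc_iff[OF top_vec_space_L] by (simp add: IB_def)
  have le_Y: "le ?Y = (\<subseteq>)" and obj_Y: "obj ?Y B = completion (hull_space L B)"
    and trans_Y: "trans ?Y B C = completion_map (hull_space L B) (hull_space L C) (\<lambda>x. x)" for B C
    by (simp_all add: IB_def)
  note simps = idx_lim_IB le_lim_IB obj_lim_IB idx_Y le_Y obj_Y trans_Y \<sigma>_def g_def h_def
  have short_cls: "short_map (hull_space (F n) B) (hull_space L C) (cls n)"
    if "bounded_disc (F n) B" "bounded_disc L C" "cls n ` B \<subseteq> C" for n B C
    using that by (intro short_map_hull disc_bounded_disc linear_cls)
  have short_inv: "short_map (hull_space L (cls n ` B)) (hull_space (F n) B) (inv_into (carrier (F n)) (cls n))"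
    if "bounded_disc (F n) B" for n B
    using that top_vec_space_L
    by (intro short_map_hull_inv disc_bounded_disc linear_cls inj_cls) (simp_all add: top_vec_space_def)
  have canonical: "canonical_mor F f = level_mor ?X ?Y \<sigma> g"
    unfolding canonical_mor_def seq_ind_lim_desc_def IB_map_def level_mor_def
    by (rule ext) (auto simp: lim_IB_def seq_ind_lim_def \<sigma>_def g_def restrict_def)
  show ?thesis
    unfolding canonical
  proof (rule ind_iso_cofinal[where h = h, OF ind_diagram_lim_IB ind_diagram_IB[OF top_vec_space_L]])
    show "\<exists>p\<in>idx ?X. le ?Y B (\<sigma> p)" if "B \<in> idx ?Y" for B
      using bounded_disc_from_step[OF assms(2,4), of B] that by (auto simp: simps)
  next
    fix p assume "p \<in> idx ?X"
    then obtain n B where p: "p = (n, B)" and B: "bounded_disc (F n) B"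
      by (auto simp: simps)
    interpret B: bounded_disc "F n" B by (rule B)
    interpret C: bounded_disc L "cls n ` B" by (rule bounded_disc_cls[OF B])
    note short = short_cls[OF B C.bounded_disc_axioms subset_refl]
    show "\<sigma> p \<in> idx ?Y"
      using C.bounded_disc_axioms by (simp add: p simps)
    show "g p \<in> ban_hom (obj ?X p) (obj ?Y (\<sigma> p))"
      using short_linear.completion_map_in_ban_hom[OF short_linear.intro[OF short]] by (simp add: p simps)
    show "h p \<in> ban_hom (obj ?Y (\<sigma> p)) (obj ?X p)"
      using short_linear.completion_map_in_ban_hom[OF short_linear.intro[OF short_inv[OF B]]] by (simp add: p simps)
    show "compose (carrier (obj ?X p)) (h p) (g p) = ban_id (obj ?X p)"
      unfolding p simps prod.case completion_map_compose[OF short short_inv[OF B]]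
      by (rule completion_map_id[OF B.seminormed_space_hull]) (simp add: B.hull_carrier inv_into_f_f[OF inj_cls])
    show "compose (carrier (obj ?Y (\<sigma> p))) (g p) (h p) = ban_id (obj ?Y (\<sigma> p))"
      unfolding p simps prod.case completion_map_compose[OF short_inv[OF B] short]
    proof (rule completion_map_id[OF C.seminormed_space_hull])
      fix y assume "y \<in> carrier (hull_space L (cls n ` B))"
      then obtain t b where "b \<in> B" "y = complex_of_real t \<odot>\<^bsub>L\<^esub> cls n b"
        by (auto elim: C.hullE)
      then have "y = cls n (complex_of_real t \<odot>\<^bsub>F n\<^esub> b)"
        using B.disc_carrier linear_cls[of n] by (simp add: linear_map_def)
      then have "y \<in> cls n ` carrier (F n)"
        using \<open>b \<in> B\<close> B.disc_carrier by blast
      then show "(cls n \<circ> inv_into (carrier (F n)) (cls n)) y = y"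
        by (simp add: f_inv_into_f)
    qed
    fix q assume "q \<in> idx ?X" "le ?X p q"
    then obtain m D where q: "q = (m, D)" and D: "bounded_disc (F m) D" and le: "n \<le> m" "f m n ` B \<subseteq> D"
      by (auto simp: p simps)
    have image: "cls n ` B \<subseteq> cls m ` D"
    proof
      fix y assume "y \<in> cls n ` B"
      then obtain b where "b \<in> B" "y = cls n b"
        by blast
      then have "y = cls m (f m n b)" "f m n b \<in> D"
        using cls_f[OF le(1)] B.disc_carrier le(2) by auto
      then show "y \<in> cls m ` D"
        by blast
    qed
    then show "le ?Y (\<sigma> p) (\<sigma> q)"
      by (simp add: p q simps)
    note D' = bounded_disc_cls[OF D]
    show "compose (carrier (obj ?X p)) (g q) (trans ?X p q) =
        compose (carrier (obj ?X p)) (trans ?Y (\<sigma> p) (\<sigma> q)) (g p)"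
      unfolding p q trans_lim_IB[OF B D le] simps prod.case
        completion_map_compose[OF short_map_f[OF B D le] short_cls[OF D D' subset_refl]]
        completion_map_compose[OF short short_map_inclusion[OF C.bounded_disc_axioms D' image]]
      by (rule completion_map_cong[OF B.seminormed_space_hull]) (simp add: B.hull_carrier cls_f[OF le(1)])
  qed
qed

end
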